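(* Let $\mathcal{H}$ be the class of convex polygons in $\mathbb{R}^2$ which tessellate the plane by translations, and let $\mathcal{F}:\mathcal{H}\to\mathbb{R}\cup\{+\infty\}$ be any functional satisfying the following two conditions: (1) if $(H_n)$ is a sequence in $\mathcal{H}$ converging to $H\in\mathcal{H}$ in Hausdorff distance, then $\liminf_{n}\mathcal{F}(H_n)\ge\mathcal{F}(H)$; (2) for every straight line $\pi$ through the origin and every $H\in\mathcal{H}$, one has $\mathcal{F}(S_\pi(H))\le\mathcal{F}(H)$, where $S_\pi(H)$ denotes the Steiner symmetrization of $H$ with respect to $\pi$. Then $$\min\{\mathcal{F}(H) : H\in\mathcal{H},\ |H|=1\}=\mathcal{F}(H^* ),$$ where $H^*$ is the regular hexagon with unit area. Moreover, if the inequality in (2) holds as a strict inequality when $H\neq S_\pi(H)$, then $H^*$ is the unique minimizer.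
   Context: A convex polygon which tessellates the plane by translations can only be either a centrally symmetric hexagon or a parallelogram. $|\cdot|$ denotes area. Steiner symmetrization: let $E\subset\mathbb{R}^2$ be a compact convex set with nonempty interior, let $\pi\subset\mathbb{R}^2$ be a straight line passing through the origin, and let $v$ be the unit normal to $\pi$. For $x\in\pi$ set $L_x=\{x+tv : t\in\mathbb{R}\}$. The Steiner symmetrization of $E$ with respect to $\pi$ is $$S_\pi(E)=\bigcup_{x\in\pi,\ L_x\cap E\neq\emptyset}\{x+rv : 2|r|\le \mathcal{H}^1(E\cap L_x)\},$$ where $\mathcal{H}^1$ is the one-dimensional Hausdorff measure (length).
   Formalization: H* is determined only up to rigid motion and F need not be invariant: the minimum is attained at some regular hexagon of unit area, at each one if F agrees on all of them, and uniqueness means every minimizer is a regular hexagon; (2) is required only when S_π(H) is in the class. *)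

theory Defs
  imports "HOL-Analysis.Analysis"
begin

text \<open>Arbitrary (not necessarily lattice) sets of translation vectors are allowed.\<close>

definition tessellates_by_translations :: "(real^2) set \<Rightarrow> bool" where
  "tessellates_by_translations P \<longleftrightarrow>
     (\<exists>T. (\<Union>t\<in>T. (+) t ` P) = UNIV \<and>
          pairwise (\<lambda>s t. interior ((+) s ` P) \<inter> interior ((+) t ` P) = {}) T)"

definition tiles :: "(real^2) set set" where
  "tiles = {P. polytope P \<and> interior P \<noteq> {} \<and> tessellates_by_translations P}"

text \<open>Meaningful for nonempty bounded sets, as are all members of \<open>tiles\<close>.\<close>

definition hausdorff_distance :: "'a::metric_space set \<Rightarrow> 'a set \<Rightarrow> real" where
  "hausdorff_distance A B = max (SUP a\<in>A. infdist a B) (SUP b\<in>B. infdist b A)"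

text \<open>One-dimensional Hausdorff measure. Covering sets must be explicitly bounded, because
  \<open>diameter\<close> has no specified value on unbounded sets.\<close>

definition hausdorff_measure1 :: "'a::metric_space set \<Rightarrow> ennreal" where
  "hausdorff_measure1 A =
     (SUP \<delta>\<in>{0<..}.
        INF C\<in>{C :: nat \<Rightarrow> 'a set. A \<subseteq> (\<Union>i. C i) \<and> (\<forall>i. bounded (C i) \<and> diameter (C i) \<le> \<delta>)}.
          \<Sum>i. ennreal (diameter (C i)))"

text \<open>A line through the origin is represented by a unit normal \<open>v\<close>, i.e. it is
  \<open>{x. x \<bullet> v = 0}\<close>; the two choices \<open>v\<close> and \<open>- v\<close> give the same symmetrization.\<close>

definition normal_line :: "real^2 \<Rightarrow> real^2 \<Rightarrow> (real^2) set" where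
  "normal_line v x = {x + t *\<^sub>R v | t. True}"

definition steiner :: "real^2 \<Rightarrow> (real^2) set \<Rightarrow> (real^2) set" where
  "steiner v E =
     (\<Union>x\<in>{x. x \<bullet> v = 0 \<and> normal_line v x \<inter> E \<noteq> {}}.
        {x + r *\<^sub>R v | r. ennreal (2 * \<bar>r\<bar>) \<le> hausdorff_measure1 (E \<inter> normal_line v x)})"

definition regular_hexagon :: "(real^2) set \<Rightarrow> bool" where
  "regular_hexagon H \<longleftrightarrow>
     (\<exists>c \<rho> \<theta>. \<rho> > 0 \<and>
        H = convex hull {c + \<rho> *\<^sub>R vector [cos (\<theta> + real k * pi / 3), sin (\<theta> + real k * pi / 3)] | k.
                         k < (6::nat)})"

definition unit_regular_hexagon :: "(real^2) set \<Rightarrow> bool" where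
  "unit_regular_hexagon H \<longleftrightarrow> regular_hexagon H \<and> measure lebesgue H = 1"

definition unit_area_minimizer :: "((real^2) set \<Rightarrow> ereal) \<Rightarrow> (real^2) set \<Rightarrow> bool" where
  "unit_area_minimizer F = is_arg_min F (\<lambda>H. H \<in> tiles \<and> measure lebesgue H = 1)"

text \<open>The symmetrization of a centrally symmetric hexagon can have up to ten vertices, hence leave
  \<open>tiles\<close>, where a functional on \<open>tiles\<close> has no value; the inequality is demanded only when
  the symmetrization lies in \<open>tiles\<close>.\<close>

definition steiner_decreasing :: "((real^2) set \<Rightarrow> ereal) \<Rightarrow> bool" where
  "steiner_decreasing F \<longleftrightarrow>
     (\<forall>v H. norm v = 1 \<longrightarrow> H \<in> tiles \<longrightarrow> steiner v H \<in> tiles \<longrightarrow> F (steiner v H) \<le> F H)"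

text \<open>\<open>steiner\<close> also moves a set towards the line of symmetry. Strictness is therefore not
  demanded when the symmetrization is merely a translate of the set: otherwise no finite
  translation-invariant functional could qualify. This hypothesis is implied by strictness
  for all \<open>H \<noteq> steiner v H\<close>.\<close>

definition strictly_steiner_decreasing :: "((real^2) set \<Rightarrow> ereal) \<Rightarrow> bool" where
  "strictly_steiner_decreasing F \<longleftrightarrow>
     (\<forall>v H. norm v = 1 \<longrightarrow> H \<in> tiles \<longrightarrow> steiner v H \<in> tiles \<longrightarrow>
        \<not> (\<exists>a. steiner v H = (+) a ` H) \<longrightarrow> F (steiner v H) < F H)"

end

theory Submission
  imports Defs
begin

text \<open>A convex polygon that tiles the plane by translations is a centrally symmetric hexagon, possibly
degenerated to a parallelogram (\<open>tile_is_hexagonal\<close>). The proof is local. Edges of a tile come in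
parallel pairs of equal length, and, except for parallelograms, the neighbour across an edge is glued
to it along the whole opposite edge (\<open>opposite_edges\<close>). The opposite edges of two adjacent edges are
adjacent as well (\<open>opposite_edges_meet\<close>), and the requirement that the two neighbours across adjacent
edges do not overlap closes the polygon after six sides.

A centrally symmetric hexagon stays a hexagon when it is symmetrized in the direction of one of its
short diagonals, which join vertices two steps apart: chords in this direction have constant length
between the diagonal and its mirror image, and shrink linearly from there to the two remaining
vertices (\<open>steiner_hexagon\<close>). The result has two perpendicular axes of symmetry and is described by half
of its width, a vector \<open>D\<close>, a perpendicular vector \<open>E\<close>, and a shape parameter \<open>k\<close>. Symmetrizing along a
short diagonal that is oblique to the axes gives another hexagon of this kind. Under iteration the
shape parameter obeys \<open>k \<mapsto> 1 + 2/k\<close>, and for unit area the square \<open>u\<close> of the half width obeys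
\<open>u \<mapsto> (u + 1/(4u))/4\<close>. Both recursions are eventually contractions, with fixed points that belong to
the regular hexagon.

The axes turn during the iteration, so the hexagons converge only along a subsequence
(\<open>iterates_converge_to_regular\<close>). By lower semicontinuity, every tile of unit area lies above some
centred regular hexagon of unit area. Which one may depend on the tile, since \<open>F\<close> need not be invariant
under rotations; but the centred regular hexagons of unit area form a compact family, on which the lower
semicontinuous \<open>F\<close> attains a minimum (\<open>regular_minimizer\<close>). If \<open>F\<close> is strictly decreasing, every
symmetrization of a minimizer is a translate of it. The iterates are all centred at the origin, hence
they coincide and are equal to their regular limit (\<open>minimizer_regular\<close>).\<close>

section \<open>Faces of planar convex sets\<close>

definition face :: "'a::real_inner set \<Rightarrow> 'a \<Rightarrow> 'a set" where
  "face P u = {x\<in>P. \<forall>y\<in>P. u \<bullet> y \<le> u \<bullet> x}"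

lemma face_in: "x \<in> face P u \<Longrightarrow> x \<in> P"
  by (simp add: face_def)

lemma face_le: "x \<in> face P u \<Longrightarrow> y \<in> P \<Longrightarrow> u \<bullet> y \<le> u \<bullet> x"
  by (simp add: face_def)

lemma face_eq: "x \<in> face P u \<Longrightarrow> y \<in> face P u \<Longrightarrow> u \<bullet> x = u \<bullet> y"
  by (simp add: face_def order_antisym)

lemma faceI: "y \<in> face P u \<Longrightarrow> x \<in> P \<Longrightarrow> u \<bullet> y \<le> u \<bullet> x \<Longrightarrow> x \<in> face P u"
  by (force simp: face_def)

lemma face_compact:
  assumes "compact P" shows "compact (face P u)"
proof -
  have "face P u = P \<inter> (\<Inter>y\<in>P. {x. u \<bullet> y \<le> u \<bullet> x})"
    by (auto simp: face_def)
  then show ?thesis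
    using assms by (auto intro!: compact_Int_closed closed_halfspace_ge)
qed

lemma face_convex:
  assumes "convex P" shows "convex (face P u)"
proof -
  have "face P u = P \<inter> (\<Inter>y\<in>P. {x. u \<bullet> x \<ge> u \<bullet> y})"
    by (auto simp: face_def)
  then show ?thesis
    using assms by (auto intro!: convex_Int convex_INT convex_halfspace_ge)
qed

lemma face_nonempty:
  assumes "compact P" "P \<noteq> {}" shows "face P u \<noteq> {}"
proof -
  obtain x where "x \<in> P" "\<forall>y\<in>P. u \<bullet> y \<le> u \<bullet> x"
    using continuous_attains_sup[OF assms continuous_on_inner[OF continuous_on_const continuous_on_id], of u]
    by auto
  then show ?thesis by (auto simp: face_def)
qed

lemma inner_real2: "(x::real^2) \<bullet> y = x$1 * y$1 + x$2 * y$2"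
  by (simp add: inner_vec_def sum_2)

lemma parallel_if_orthogonal_to_same:
  fixes n u d :: "real^2"
  assumes "n \<bullet> d = 0" "u \<bullet> d = 0" "d \<noteq> 0" "u \<noteq> 0"
  obtains c where "n = c *\<^sub>R u"
proof -
  have n: "n$1 * d$1 + n$2 * d$2 = 0" and u: "u$1 * d$1 + u$2 * d$2 = 0"
    using assms by (simp_all add: inner_real2)
  have det: "n$1 * u$2 = n$2 * u$1"
  proof -
    have "(n$1 * u$2 - n$2 * u$1) * d$1 = 0" "(n$1 * u$2 - n$2 * u$1) * d$2 = 0"
      using n u by algebra+
    then show ?thesis using \<open>d \<noteq> 0\<close> by (auto simp: vec_eq_iff forall_2)
  qed
  show thesis
  proof (cases "u$1 = 0")
    case True
    then have "u$2 \<noteq> 0" using \<open>u \<noteq> 0\<close> by (simp add: vec_eq_iff forall_2)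
    then show thesis
      using det True by (intro that[of "n$2 / u$2"]) (auto simp: vec_eq_iff forall_2)
  next
    case False
    then show thesis
      using det by (intro that[of "n$1 / u$1"]) (auto simp: vec_eq_iff forall_2 field_simps)
  qed
qed

text \<open>A line carries the face, so the ends are the extrema of a functional \<open>d\<close> that varies along this
  line.\<close>

lemma face_segment:
  fixes P :: "(real^2) set"
  assumes "compact P" "convex P" "P \<noteq> {}" "u \<noteq> 0"
  obtains p q where "face P u = closed_segment p q"
proof -
  define d :: "real^2" where "d = vector [- u$2, u$1]"
  have zero: "y = 0" if "d \<bullet> y = 0" "u \<bullet> y = 0" for y
  proof -
    have "d \<bullet> u = 0" "d \<noteq> 0"
      using \<open>u \<noteq> 0\<close> by (auto simp: d_def inner_real2 vec_eq_iff forall_2)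
    moreover have "y \<bullet> u = 0" using that(2) by (simp add: inner_commute)
    ultimately obtain c where "y = c *\<^sub>R d"
      using parallel_if_orthogonal_to_same \<open>u \<noteq> 0\<close> by blast
    then show ?thesis using that(1) \<open>d \<noteq> 0\<close> by simp
  qed
  let ?F = "face P u"
  have F: "compact ?F" "?F \<noteq> {}" "convex ?F"
    using face_compact[OF assms(1)] face_nonempty[OF assms(1,3)] face_convex[OF assms(2)] by auto
  have cont: "continuous_on ?F (\<lambda>x. d \<bullet> x)" by (intro continuous_intros)
  obtain p where p: "p \<in> ?F" "\<And>x. x \<in> ?F \<Longrightarrow> d \<bullet> p \<le> d \<bullet> x"
    using continuous_attains_inf[OF F(1,2) cont] by blast
  obtain q where q: "q \<in> ?F" "\<And>x. x \<in> ?F \<Longrightarrow> d \<bullet> x \<le> d \<bullet> q"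
    using continuous_attains_sup[OF F(1,2) cont] by blast
  have "x \<in> closed_segment p q" if x: "x \<in> ?F" for x
  proof -
    define s where "s = (d \<bullet> x - d \<bullet> p) / (d \<bullet> q - d \<bullet> p)"
    have s: "0 \<le> s" "s \<le> 1" "d \<bullet> x - d \<bullet> p = s * (d \<bullet> q - d \<bullet> p)"
      using p(2)[OF x] q(2)[OF x]
      by (cases "d \<bullet> p = d \<bullet> q"; auto simp: s_def divide_le_eq_1)+
    let ?y = "x - p - s *\<^sub>R (q - p)"
    have "d \<bullet> ?y = 0" "u \<bullet> ?y = 0"
      using s(3) face_eq[OF x p(1)] face_eq[OF q(1) p(1)] by (simp_all add: inner_diff_right)
    then have "?y = 0" by (rule zero)
    then have "x = (1 - s) *\<^sub>R p + s *\<^sub>R q" by (simp add: algebra_simps)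
    then show ?thesis using s unfolding closed_segment_def by blast
  qed
  moreover have "closed_segment p q \<subseteq> ?F"
    using closed_segment_subset p(1) q(1) F(3) by blast
  ultimately show thesis using that[of p q] by blast
qed

section \<open>Edges in tilings by translations\<close>

locale translation_tiling =
  fixes P T :: "'a::euclidean_space set"
  assumes convex: "convex P" and compact: "compact P" and interior: "interior P \<noteq> {}"
    and cover: "(\<Union>t\<in>T. (+) t ` P) = UNIV"
    and disjoint: "pairwise (\<lambda>s t. interior ((+) s ` P) \<inter> interior ((+) t ` P) = {}) T"
begin

text \<open>The interiors are separated by a hyperplane, and the tiles are the closures of their interiors.\<close>

lemma separating_functional:
  assumes "s \<in> T" "t \<in> T" "s \<noteq> t"
  obtains n \<beta> where "n \<noteq> 0" "\<And>x. x \<in> P \<Longrightarrow> n \<bullet> (s + x) \<le> \<beta>" "\<And>x. x \<in> P \<Longrightarrow> \<beta> \<le> n \<bullet> (t + x)"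
proof -
  let ?S = "(+) s ` interior P" and ?R = "(+) t ` interior P"
  have "?S \<inter> ?R = {}"
    using disjoint assms unfolding pairwise_def interior_translation by auto
  moreover have "convex ?S" "convex ?R"
    using convex by (auto simp: convex_interior convex_translation_eq)
  ultimately obtain n \<beta> where n: "n \<noteq> 0" "\<forall>x\<in>?S. n \<bullet> x \<le> \<beta>" "\<forall>x\<in>?R. \<beta> \<le> n \<bullet> x"
    using separating_hyperplane_sets[of ?S ?R] interior by (auto simp: image_is_empty)
  have P: "P = closure (interior P)"
    using convex_closure_interior[OF convex interior] compact by (simp add: compact_imp_closed)
  have "closure (interior P) \<subseteq> {x. n \<bullet> x \<le> \<beta> - n \<bullet> s}"
    by (rule closure_minimal[OF _ closed_halfspace_le]) (use n in \<open>auto simp: inner_add_right algebra_simps\<close>)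
  moreover have "closure (interior P) \<subseteq> {x. n \<bullet> x \<ge> \<beta> - n \<bullet> t}"
    by (rule closure_minimal[OF _ closed_halfspace_ge]) (use n in \<open>auto simp: inner_add_right algebra_simps\<close>)
  ultimately show thesis
    using that[of n \<beta>] n(1) P by (auto simp: inner_add_right algebra_simps subset_iff)
qed

lemma translations_separated:
  obtains \<epsilon> where "\<epsilon> > 0" "\<And>s t. s \<in> T \<Longrightarrow> t \<in> T \<Longrightarrow> dist s t < \<epsilon> \<Longrightarrow> s = t"
proof -
  obtain z \<epsilon> where z: "\<epsilon> > 0" "ball z \<epsilon> \<subseteq> interior P"
    using interior open_interior open_contains_ball by (metis equals0I)
  have "s = t" if "s \<in> T" "t \<in> T" "dist s t < \<epsilon>" for s t
  proof (rule ccontr)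
    assume "s \<noteq> t"
    then have "(+) s ` interior P \<inter> (+) t ` interior P = {}"
      using disjoint that unfolding pairwise_def interior_translation by auto
    moreover have "s + z \<in> (+) s ` interior P"
      using z centre_in_ball[of z \<epsilon>] by blast
    moreover have "s + z - t \<in> ball z \<epsilon>"
      using that(3) by (simp add: dist_norm norm_minus_commute)
    then have "s + z \<in> (+) t ` interior P"
      using z(2) by (intro image_eqI[of _ _ "s + z - t"]) auto
    ultimately show False by blast
  qed
  then show thesis using z(1) that by blast
qed

text \<open>Local finiteness of the tiling in sequential form. The translation vectors of the tiles
  containing the \<open>X n\<close> are bounded, so a subsequence of them converges, and since they are separated it
  is eventually constant. The set \<open>G\<close> is the whole tile or one of its faces in the applications.\<close>

lemma limit_in_common_tile:
  assumes lim: "X \<longlonglongrightarrow> x" and "closed G" "G \<subseteq> P"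
    and X: "\<And>n. \<exists>t\<in>T. X n - t \<in> G"
  obtains t where "t \<in> T" "x - t \<in> G" "\<exists>\<^sub>\<infinity>n. X n - t \<in> G"
proof -
  obtain \<tau> where \<tau>: "\<And>n. \<tau> n \<in> T" "\<And>n. X n - \<tau> n \<in> G"
    using X by metis
  have "bounded (range X)"
    using lim by (rule convergent_imp_bounded)
  then obtain a where a: "\<And>n. norm (X n) \<le> a" by (auto simp: bounded_iff)
  obtain b where b: "\<And>x. x \<in> P \<Longrightarrow> norm x \<le> b"
    using compact compact_imp_bounded by (metis bounded_iff)
  have "norm (\<tau> n) \<le> a + b" for n
    using a[of n] b[of "X n - \<tau> n"] \<tau>(2)[of n] \<open>G \<subseteq> P\<close> norm_triangle_ineq4[of "X n" "X n - \<tau> n"] by force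
  then have "bounded (range \<tau>)" by (auto simp: bounded_iff)
  then obtain l r where r: "strict_mono r" "(\<tau> \<circ> r) \<longlonglongrightarrow> l"
    using bounded_imp_convergent_subsequence by blast
  obtain \<epsilon> where \<epsilon>: "\<epsilon> > 0" "\<And>s t. s \<in> T \<Longrightarrow> t \<in> T \<Longrightarrow> dist s t < \<epsilon> \<Longrightarrow> s = t"
    using translations_separated by blast
  have "Cauchy (\<tau> \<circ> r)"
    using r(2) by (rule LIMSEQ_imp_Cauchy)
  then obtain N where "\<And>m n. m \<ge> N \<Longrightarrow> n \<ge> N \<Longrightarrow> dist ((\<tau> \<circ> r) m) ((\<tau> \<circ> r) n) < \<epsilon>"
    using \<epsilon>(1) unfolding Cauchy_def by blast
  then have N: "\<tau> (r n) = \<tau> (r N)" if "n \<ge> N" for n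
    using \<epsilon>(2) \<tau>(1) that by simp
  let ?t = "\<tau> (r N)"
  have G: "X (r n) - ?t \<in> G" if "n \<ge> N" for n
    using \<tau>(2)[of "r n"] N[OF that] by simp
  have "(\<lambda>n. X (r n) - ?t) \<longlonglongrightarrow> x - ?t"
    by (intro tendsto_intros LIMSEQ_subseq_LIMSEQ[OF lim r(1), unfolded comp_def])
  then have "x - ?t \<in> G"
    using G \<open>closed G\<close> by (intro Lim_in_closed_set[of G _ sequentially]) (auto simp: eventually_sequentially)
  moreover have "\<exists>\<^sub>\<infinity>n. X n - ?t \<in> G"
    unfolding INFM_nat_le
  proof
    fix m
    have "r (max m N) \<ge> m"
      using seq_suble[OF r(1), of "max m N"] by linarith
    then show "\<exists>n\<ge>m. X n - ?t \<in> G" using G[of "max m N"] by auto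
  qed
  ultimately show thesis using that \<tau>(1) by blast
qed

end

locale planar_tiling = translation_tiling P T for P T :: "(real^2) set"
begin

lemma P_nonempty: "P \<noteq> {}"
  using interior interior_subset by blast

lemma face_is_segment:
  assumes "u \<noteq> 0" obtains p q where "face P u = closed_segment p q"
  using face_segment[OF compact convex P_nonempty assms] .

lemma functional_not_constant:
  assumes "n \<noteq> 0" "\<And>x. x \<in> P \<Longrightarrow> n \<bullet> x = c"
  shows False
proof -
  obtain z where z: "z \<in> interior P" using interior by blast
  then obtain e where e: "e > 0" "cball z e \<subseteq> P"
    using mem_interior_cball by blast
  let ?y = "z + (e / norm n) *\<^sub>R n"
  have "?y \<in> P" "z \<in> P" using e assms(1) z interior_subset by (auto simp: dist_norm)
  then have "n \<bullet> ?y = n \<bullet> z" using assms(2) by metis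
  then show False using e assms(1) by (simp add: inner_add_right)
qed

text \<open>The points slightly beyond an edge belong to other tiles, and in the limit one of these contains the
  inner point \<open>x\<close>. A line separating it from the given tile passes through \<open>x\<close> and therefore carries the
  edge, so the neighbour touches the edge with its opposite face.\<close>

lemma neighbour_at_inner_point:
  assumes t0: "t0 \<in> T" and u: "u \<noteq> 0" and F: "face P u = closed_segment p q"
    and x: "x - t0 \<in> open_segment p q"
  obtains t where "t \<in> T" "x - t \<in> face P (- u)"
proof -
  have xF: "x - t0 \<in> face P u"
    using x F segment_open_subset_closed by blast
  define X where "X n = x + inverse (real (Suc n)) *\<^sub>R u" for n
  have "X \<longlonglongrightarrow> x + 0 *\<^sub>R u"
    unfolding X_def by (intro tendsto_intros LIMSEQ_inverse_real_of_nat)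
  then have lim: "X \<longlonglongrightarrow> x" by simp
  have "\<exists>t\<in>T. X n - t \<in> P" for n
  proof -
    have "X n \<in> (\<Union>t\<in>T. (+) t ` P)" using cover by simp
    then show ?thesis by force
  qed
  then obtain t where t: "t \<in> T" "x - t \<in> P" "\<exists>\<^sub>\<infinity>n. X n - t \<in> P"
    using limit_in_common_tile[OF lim compact_imp_closed[OF compact] order_refl] by blast
  then obtain n where n: "X n - t \<in> P"
    using frequently_ex by blast
  have "X n - t0 \<notin> P"
  proof
    assume "X n - t0 \<in> P"
    then have "u \<bullet> (X n - t0) \<le> u \<bullet> (x - t0)" using face_le[OF xF] by blast
    then have "inverse (real (Suc n)) * (u \<bullet> u) \<le> 0"
      by (simp add: X_def inner_diff_right inner_add_right)
    moreover have "inverse (real (Suc n)) * (u \<bullet> u) > 0"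
      using u by (intro mult_pos_pos) auto
    ultimately show False by linarith
  qed
  then have "t \<noteq> t0" using n by blast
  then obtain m \<beta> where m: "m \<noteq> 0" "\<And>y. y \<in> P \<Longrightarrow> m \<bullet> (t0 + y) \<le> \<beta>" "\<And>y. y \<in> P \<Longrightarrow> \<beta> \<le> m \<bullet> (t + y)"
    using separating_functional[OF t0 t(1)] by metis
  have \<beta>: "\<beta> = m \<bullet> x"
    using m(2)[OF face_in[OF xF]] m(3)[OF t(2)] by simp
  have pq: "p \<in> face P u" "q \<in> face P u" "p \<noteq> q" using F x by auto
  \<comment> \<open>Both ends of the edge lie on the same side of the separating line through the inner point \<open>x\<close>.\<close>
  obtain s where s: "0 < s" "s < 1" "x - t0 = (1 - s) *\<^sub>R p + s *\<^sub>R q"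
    using x by (auto simp: in_segment)
  have x_eq: "m \<bullet> x = m \<bullet> t0 + (1 - s) * (m \<bullet> p) + s * (m \<bullet> q)"
    using arg_cong[OF s(3), of "\<lambda>z. m \<bullet> z"] by (simp add: inner_diff_right inner_add_right)
  have le: "m \<bullet> p \<le> m \<bullet> x - m \<bullet> t0" "m \<bullet> q \<le> m \<bullet> x - m \<bullet> t0"
    using m(2)[OF face_in[OF pq(1)]] m(2)[OF face_in[OF pq(2)]] \<beta> by (auto simp: inner_add_right)
  have "m \<bullet> (q - p) = 0"
  proof -
    have "s * (m \<bullet> q - m \<bullet> p) \<ge> 0" "(1 - s) * (m \<bullet> p - m \<bullet> q) \<ge> 0"
      using le x_eq by (auto simp: algebra_simps)
    then have "m \<bullet> q \<ge> m \<bullet> p" "m \<bullet> p \<ge> m \<bullet> q" using s by (auto simp: zero_le_mult_iff)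
    then show ?thesis by (simp add: inner_diff_right)
  qed
  moreover have "u \<bullet> (q - p) = 0"
    using face_eq[OF pq(1,2)] by (simp add: inner_diff_right)
  ultimately obtain c where c: "m = c *\<^sub>R u"
    using parallel_if_orthogonal_to_same[of m "q - p" u] pq(3) u by auto
  have "c > 0"
  proof (rule ccontr)
    assume "\<not> c > 0"
    then have "c < 0" using c m(1) by (cases "c = 0") auto
    have "u \<bullet> y = u \<bullet> (x - t0)" if "y \<in> P" for y
    proof -
      have "c * (u \<bullet> (t0 + y)) \<le> c * (u \<bullet> x)" using m(2)[OF that] \<beta> c by simp
      then have "u \<bullet> x \<le> u \<bullet> (t0 + y)" using \<open>c < 0\<close> by (simp add: mult_le_cancel_left_neg)
      then show ?thesis using face_le[OF xF that] by (simp add: inner_add_right inner_diff_right)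
    qed
    then show False using functional_not_constant u by blast
  qed
  have "x - t \<in> face P (- u)"
    unfolding face_def
  proof (intro CollectI conjI ballI t(2))
    fix y assume "y \<in> P"
    then have "c * (u \<bullet> x) \<le> c * (u \<bullet> (t + y))" using m(3) \<beta> c by simp
    then have "u \<bullet> x \<le> u \<bullet> (t + y)" using \<open>c > 0\<close> by simp
    then show "- u \<bullet> y \<le> - u \<bullet> (x - t)" by (simp add: inner_diff_right inner_add_right)
  qed
  then show thesis using t(1) that by blast
qed

text \<open>A single neighbour reaches from \<open>x\<close> some way along the edge. The point \<open>x\<close> itself may be an end of the
  edge.\<close>

lemma neighbour_along_edge:
  assumes t0: "t0 \<in> T" and u: "u \<noteq> 0" and F: "face P u = closed_segment p q"
    and "e > 0" and seg: "\<And>\<epsilon>. 0 < \<epsilon> \<Longrightarrow> \<epsilon> < e \<Longrightarrow> x + \<epsilon> *\<^sub>R w - t0 \<in> open_segment p q"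
  obtains t \<epsilon> where "t \<in> T" "x - t \<in> face P (- u)" "0 < \<epsilon>" "\<epsilon> < e" "x + \<epsilon> *\<^sub>R w - t \<in> face P (- u)"
proof -
  define X where "X n = x + (e * inverse (real (Suc (Suc n)))) *\<^sub>R w" for n
  have "X \<longlonglongrightarrow> x + (e * 0) *\<^sub>R w"
    unfolding X_def by (intro tendsto_intros LIMSEQ_Suc[OF LIMSEQ_inverse_real_of_nat])
  then have lim: "X \<longlonglongrightarrow> x" by simp
  have small: "0 < e * inverse (real (Suc (Suc n)))" "e * inverse (real (Suc (Suc n))) < e" for n
    using \<open>e > 0\<close> by (auto simp: field_simps intro!: add_pos_nonneg)
  have "\<exists>t\<in>T. X n - t \<in> face P (- u)" for n
    using neighbour_at_inner_point[OF t0 u F seg[OF small]] unfolding X_def by blast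
  then obtain t where t: "t \<in> T" "x - t \<in> face P (- u)" "\<exists>\<^sub>\<infinity>n. X n - t \<in> face P (- u)"
    using limit_in_common_tile[OF lim compact_imp_closed[OF face_compact[OF compact]]] face_in by blast
  then obtain n where "X n - t \<in> face P (- u)"
    using frequently_ex by blast
  then show thesis using that t small unfolding X_def by blast
qed

text \<open>Suppose that the end \<open>q\<close> of an edge lies inside an edge of a tile \<open>t\<close> on the other side. Beyond \<open>q\<close>
  the tile \<open>t\<close> has another neighbour \<open>t2\<close> on the side of \<open>t0\<close>, and its copy of the edge starts at \<open>q\<close> or
  earlier. A functional separating \<open>t0\<close> from \<open>t2\<close> is at most its value at \<open>q\<close> on the first tile and at
  least its value at the copy of \<open>p\<close> on the second one. As both tiles are translates of \<open>P\<close>, this bounds \<open>P\<close> from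
  both sides.\<close>

lemma overhang_imp_strip:
  assumes "t0 \<in> T" "t \<in> T" and u: "u \<noteq> 0"
    and F: "face P u = closed_segment p q" "p \<noteq> q" and F': "face P (- u) = closed_segment r s"
    and q: "t0 + q - t \<in> open_segment r s"
  obtains n where "n \<noteq> 0" "\<And>x. x \<in> P \<Longrightarrow> n \<bullet> p \<le> n \<bullet> x" "\<And>x. x \<in> P \<Longrightarrow> n \<bullet> x \<le> n \<bullet> q"
proof -
  have "r \<noteq> s" using q by auto
  have "u \<bullet> (q - p) = 0" "u \<bullet> (s - r) = 0"
    using face_eq[of p P u q] face_eq[of r P "-u" s] F F' by (auto simp: inner_diff_right)
  then obtain c where c: "q - p = c *\<^sub>R (s - r)"
    using parallel_if_orthogonal_to_same[of "q - p" u "s - r"] \<open>r \<noteq> s\<close> u by (auto simp: inner_commute)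
  obtain a where a: "0 < a" "a < 1" "t0 + q - t = (1 - a) *\<^sub>R r + a *\<^sub>R s"
    using q by (auto simp: in_segment)
  have "c \<noteq> 0" using c F by auto
  define e where "e = min a (1 - a) / \<bar>c\<bar>"
  have "e > 0" using a \<open>c \<noteq> 0\<close> by (auto simp: e_def)
  have seg: "(t0 + q) + \<epsilon> *\<^sub>R (q - p) - t \<in> open_segment r s" if "0 < \<epsilon>" "\<epsilon> < e" for \<epsilon>
  proof -
    have "\<epsilon> * \<bar>c\<bar> < min a (1 - a)"
      using that \<open>c \<noteq> 0\<close> by (simp add: e_def field_simps)
    then have "\<bar>\<epsilon> * c\<bar> < min a (1 - a)" using that by (simp add: abs_mult)
    then have "0 < a + \<epsilon> * c" "a + \<epsilon> * c < 1" by linarith+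
    moreover have "(t0 + q) + \<epsilon> *\<^sub>R (q - p) - t = (t0 + q - t) + \<epsilon> *\<^sub>R (q - p)" by simp
    then have "(t0 + q) + \<epsilon> *\<^sub>R (q - p) - t = (1 - (a + \<epsilon> * c)) *\<^sub>R r + (a + \<epsilon> * c) *\<^sub>R s"
      unfolding a(3) c by (simp add: algebra_simps)
    ultimately show ?thesis using \<open>r \<noteq> s\<close> by (auto simp: in_segment)
  qed
  have "- u \<noteq> 0" using u by simp
  from neighbour_along_edge[OF \<open>t \<in> T\<close> this F' \<open>e > 0\<close> seg]
  obtain t2 \<epsilon> where t2: "t2 \<in> T" "t0 + q - t2 \<in> face P u" "0 < \<epsilon>" "t0 + q + \<epsilon> *\<^sub>R (q - p) - t2 \<in> face P u"
    unfolding minus_minus by blast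
  obtain b where b: "0 \<le> b" "b \<le> 1" "t0 + q - t2 = (1 - b) *\<^sub>R p + b *\<^sub>R q"
    using t2(2) F by (auto simp: in_segment)
  obtain b' where b': "0 \<le> b'" "b' \<le> 1" "t0 + q + \<epsilon> *\<^sub>R (q - p) - t2 = (1 - b') *\<^sub>R p + b' *\<^sub>R q"
    using t2(4) F by (auto simp: in_segment)
  have "t0 + q + \<epsilon> *\<^sub>R (q - p) - t2 = (t0 + q - t2) + \<epsilon> *\<^sub>R (q - p)" by simp
  then have "(b + \<epsilon> - b') *\<^sub>R (q - p) = 0"
    unfolding b(3) b'(3) by (simp add: algebra_simps)
  then have "b' = b + \<epsilon>" using F(2) by simp
  then have "b < 1" using b' t2 by simp
  have t2_eq: "t2 = t0 + (1 - b) *\<^sub>R (q - p)"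
    using b(3) by (simp add: algebra_simps)
  then have "t2 \<noteq> t0" using \<open>b < 1\<close> F(2) by simp
  then obtain n \<beta> where n: "n \<noteq> 0" "\<And>x. x \<in> P \<Longrightarrow> n \<bullet> (t0 + x) \<le> \<beta>" "\<And>x. x \<in> P \<Longrightarrow> \<beta> \<le> n \<bullet> (t2 + x)"
    using separating_functional[OF \<open>t0 \<in> T\<close> \<open>t2 \<in> T\<close>] by metis
  have "p + (1 - b) *\<^sub>R (q - p) \<in> closed_segment p q"
    unfolding in_segment using b by (intro exI[of _ "1 - b"]) (auto simp: algebra_simps)
  then have in_P: "p + (1 - b) *\<^sub>R (q - p) \<in> P" using F face_in by blast
  then have 1: "n \<bullet> (t2 + p) \<le> \<beta>"
    using n(2)[OF in_P] unfolding t2_eq by (simp add: add_ac)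
  have 2: "\<beta> \<le> n \<bullet> (t0 + q)"
    using n(3)[OF face_in[OF t2(2)]] by simp
  show thesis
  proof (rule that[OF n(1)])
    show "n \<bullet> p \<le> n \<bullet> x" if "x \<in> P" for x
      using n(3)[OF that] 1 by (simp add: inner_add_right)
    show "n \<bullet> x \<le> n \<bullet> q" if "x \<in> P" for x
      using n(2)[OF that] 2 by (simp add: inner_add_right)
  qed
qed

text \<open>The neighbour \<open>t\<close> across the beginning of the edge touches a whole piece of it with the opposite face,
  so this face is an edge, too.\<close>

lemma opposite_edge_start:
  assumes t0: "t0 \<in> T" and u: "u \<noteq> 0" and F: "face P u = closed_segment p q" "p \<noteq> q"
  obtains t r b a where "t \<in> T" "face P (- u) = closed_segment r (r + b *\<^sub>R (q - p))"
    "0 \<le> a" "a < b" "t0 + p = t + r + a *\<^sub>R (q - p)"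
proof -
  have "- u \<noteq> 0" using u by simp
  then obtain r' s' where F'': "face P (- u) = closed_segment r' s'"
    using face_is_segment by blast
  have "u \<bullet> (q - p) = 0" "u \<bullet> (s' - r') = 0"
    using face_eq[of p P u q] face_eq[of r' P "-u" s'] F F'' by (auto simp: inner_diff_right)
  then obtain c where c: "s' - r' = c *\<^sub>R (q - p)"
    using parallel_if_orthogonal_to_same[of "s' - r'" u "q - p"] F u by (auto simp: inner_commute)
  obtain r b where F': "face P (- u) = closed_segment r (r + b *\<^sub>R (q - p))" "b \<ge> 0"
  proof (cases "c \<ge> 0")
    case True
    have "s' = r' + c *\<^sub>R (q - p)" using c by (simp add: algebra_simps)
    then show thesis using that[of r' c] True F'' by simp
  next
    case False
    have "r' = s' + (- c) *\<^sub>R (q - p)" using c by (simp add: algebra_simps)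
    then show thesis using that[of s' "- c"] False F'' by (simp add: closed_segment_commute)
  qed
  have seg: "(t0 + p) + \<epsilon> *\<^sub>R (q - p) - t0 \<in> open_segment p q" if "0 < \<epsilon>" "\<epsilon> < 1" for \<epsilon>
    using that F unfolding in_segment by (auto intro!: exI[of _ \<epsilon>] simp: algebra_simps)
  obtain t \<epsilon> where t: "t \<in> T" "t0 + p - t \<in> face P (- u)" "0 < \<epsilon>" "t0 + p + \<epsilon> *\<^sub>R (q - p) - t \<in> face P (- u)"
    using neighbour_along_edge[OF t0 u F(1) zero_less_one seg] by metis
  obtain a where a: "0 \<le> a" "a \<le> 1" "t0 + p - t = (1 - a) *\<^sub>R r + a *\<^sub>R (r + b *\<^sub>R (q - p))"
    using t(2) F' by (auto simp: in_segment)
  obtain a' where a': "0 \<le> a'" "a' \<le> 1" "t0 + p + \<epsilon> *\<^sub>R (q - p) - t = (1 - a') *\<^sub>R r + a' *\<^sub>R (r + b *\<^sub>R (q - p))"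
    using t(4) F' by (auto simp: in_segment)
  have "t0 + p + \<epsilon> *\<^sub>R (q - p) - t = (t0 + p - t) + \<epsilon> *\<^sub>R (q - p)" by simp
  then have "(a * b + \<epsilon> - a' * b) *\<^sub>R (q - p) = 0"
    unfolding a(3) a'(3) by (simp add: algebra_simps)
  then have "a' * b = a * b + \<epsilon>" using F(2) by simp
  moreover have "a' * b \<le> b" using a' F'(2) by (simp add: mult_left_le_one_le)
  ultimately have "a * b < b" using t by simp
  moreover have "t0 + p = t + r + (a * b) *\<^sub>R (q - p)"
    using a(3) by (simp add: algebra_simps)
  ultimately show thesis
    using that[OF t(1) F'(1), of "a * b"] a F'(2) by simp
qed

text \<open>If the opposite edge were shorter, its copy in the neighbour would end above an inner point of the
  given edge. The strip obtained from this overhang is spanned by the opposite edge, so it is too narrow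
  for the given edge.\<close>

lemma opposite_edge_longer:
  assumes t0: "t0 \<in> T" and u: "u \<noteq> 0" and F: "face P u = closed_segment p q" "p \<noteq> q"
    and F': "face P (- u) = closed_segment r (r + b *\<^sub>R (q - p))"
    and t: "t \<in> T" "0 \<le> a" "a < b" "t0 + p = t + r + a *\<^sub>R (q - p)"
  shows "b \<ge> 1"
proof (rule ccontr)
  assume "\<not> b \<ge> 1"
  let ?s = "r + b *\<^sub>R (q - p)"
  have "t + ?s - t0 = (1 - (b - a)) *\<^sub>R p + (b - a) *\<^sub>R q"
    using t(4) by (simp add: algebra_simps)
  then have "t + ?s - t0 \<in> open_segment p q"
    using F(2) t \<open>\<not> b \<ge> 1\<close> unfolding in_segment by (intro conjI exI[of _ "b - a"]) auto
  moreover have "- u \<noteq> 0" "face P (- (- u)) = closed_segment p q" "r \<noteq> ?s"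
    using u F t by auto
  ultimately obtain n where n: "n \<noteq> 0" "\<And>x. x \<in> P \<Longrightarrow> n \<bullet> r \<le> n \<bullet> x" "\<And>x. x \<in> P \<Longrightarrow> n \<bullet> x \<le> n \<bullet> ?s"
    using overhang_imp_strip[OF t(1) t0 _ F'] by metis
  have in_P: "p \<in> P" "q \<in> P" using F face_in by force+
  have "b * (n \<bullet> (q - p)) > 0"
  proof (rule ccontr)
    assume "\<not> b * (n \<bullet> (q - p)) > 0"
    then have "n \<bullet> ?s \<le> n \<bullet> r" by (simp add: inner_add_right)
    then have "n \<bullet> x = n \<bullet> r" if "x \<in> P" for x
      using n(2,3)[OF that] by linarith
    then show False using functional_not_constant[OF n(1)] by blast
  qed
  moreover have "n \<bullet> (q - p) \<le> b * (n \<bullet> (q - p))"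
    using n(2)[OF in_P(1)] n(3)[OF in_P(2)] by (simp add: inner_add_right inner_diff_right algebra_simps)
  ultimately show False
    using \<open>\<not> b \<ge> 1\<close> t by (auto simp: zero_less_mult_iff)
qed

text \<open>Comparing the lengths in both directions shows that they agree. A neighbour covering the beginning
  of the edge then either fits exactly, which is the first alternative, or overhangs, which confines
  \<open>P\<close> to a strip with sides through \<open>p\<close> and \<open>q\<close>.\<close>

lemma opposite_edges:
  assumes t0: "t0 \<in> T" and u: "u \<noteq> 0" and F: "face P u = closed_segment p q" "p \<noteq> q"
  obtains t where "t0 + t \<in> T" "face P (- u) = closed_segment (p - t) (q - t)"
  | r n where "face P (- u) = closed_segment r (r + (q - p))" "n \<noteq> 0"
      "\<And>x. x \<in> P \<Longrightarrow> n \<bullet> q \<le> n \<bullet> x" "\<And>x. x \<in> P \<Longrightarrow> n \<bullet> x \<le> n \<bullet> p"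
proof -
  obtain t r b a where t: "t \<in> T" "face P (- u) = closed_segment r (r + b *\<^sub>R (q - p))"
    "0 \<le> a" "a < b" "t0 + p = t + r + a *\<^sub>R (q - p)"
    using opposite_edge_start[OF t0 u F] by blast
  have "b \<ge> 1"
    using opposite_edge_longer[OF t0 u F t(2,1,3,4,5)] .
  let ?s = "r + b *\<^sub>R (q - p)"
  have nz: "- u \<noteq> 0" "r \<noteq> ?s" using u t F by auto
  obtain t' r' b' a' where t': "t' \<in> T" "face P (- (- u)) = closed_segment r' (r' + b' *\<^sub>R (?s - r))"
    "0 \<le> a'" "a' < b'" "t0 + r = t' + r' + a' *\<^sub>R (?s - r)"
    using opposite_edge_start[OF t0 nz(1) t(2) nz(2)] by blast
  have "b' \<ge> 1"
    using opposite_edge_longer[OF t0 nz(1) t(2) nz(2) t'(2,1,3,4,5)] .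
  have "closed_segment p q = closed_segment r' (r' + (b' * b) *\<^sub>R (q - p))"
    using t'(2) F by (simp add: algebra_simps)
  then have "{p, q} = {r', r' + (b' * b) *\<^sub>R (q - p)}"
    by simp
  then have "norm (q - p) = norm ((b' * b) *\<^sub>R (q - p))"
    unfolding doubleton_eq_iff by (metis norm_minus_commute add_diff_cancel_left')
  then have "b' * b = 1" using F(2) \<open>b \<ge> 1\<close> \<open>b' \<ge> 1\<close> by simp
  then have b: "b = 1"
    using \<open>b \<ge> 1\<close> \<open>b' \<ge> 1\<close> mult_mono[of 1 b' b b] by simp
  show thesis
  proof (cases "a = 0")
    case True
    show thesis
    proof (intro that(1)[of "t - t0"])
      have pq: "p - (t - t0) = r" "q - (t - t0) = r + (q - p)"
        using t(5) True by (simp_all add: algebra_simps)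
      then show "face P (- u) = closed_segment (p - (t - t0)) (q - (t - t0))"
        using t(2) b unfolding pq by simp
    qed (use t in simp)
  next
    case False
    have "t0 + p - t = (1 - a) *\<^sub>R r + a *\<^sub>R ?s"
      using t(5) b by (simp add: algebra_simps)
    then have "t0 + p - t \<in> open_segment r ?s"
      using False t b nz unfolding in_segment by (intro conjI exI[of _ a]) auto
    then obtain n where "n \<noteq> 0" "\<And>x. x \<in> P \<Longrightarrow> n \<bullet> q \<le> n \<bullet> x" "\<And>x. x \<in> P \<Longrightarrow> n \<bullet> x \<le> n \<bullet> p"
      using overhang_imp_strip[OF t0 t(1) u _ _ t(2), of q p] F by (metis closed_segment_commute)
    then show thesis using that(2)[of r n] t(2) b by simp
  qed
qed

end

section \<open>Hexagons in affine coordinates\<close>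

text \<open>The hexagon with vertices \<open>(\<plusminus>1, \<plusminus>1)\<close> and \<open>\<plusminus>(b, k)\<close>, for \<open>\<bar>b\<bar> \<le> 1 \<le> k\<close>; each inequality stands for a
  pair of parallel sides. The side from \<open>(-1, 1)\<close> to \<open>(1, 1)\<close> of the central square is a short diagonal,
  the apex \<open>(b, k)\<close> lies above it, and for \<open>k = 1\<close> the hexagon is the square itself.\<close>

definition hex_coords :: "real \<Rightarrow> real \<Rightarrow> real \<Rightarrow> real \<Rightarrow> bool" where
  "hex_coords b k x y \<longleftrightarrow> \<bar>x\<bar> \<le> 1 \<and> \<bar>(k - 1) * x + (1 - b) * y\<bar> \<le> k - b
     \<and> \<bar>(k - 1) * x - (1 + b) * y\<bar> \<le> k + b"

definition hexagon :: "real^2 \<Rightarrow> real^2 \<Rightarrow> real \<Rightarrow> real \<Rightarrow> (real^2) set" where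
  "hexagon D M b k = {x *\<^sub>R D + y *\<^sub>R M | x y. hex_coords b k x y}"

definition cross2 :: "real^2 \<Rightarrow> real^2 \<Rightarrow> real" where
  "cross2 D M = D$1 * M$2 - D$2 * M$1"

lemma hex_coords_height:
  assumes "hex_coords b k x y" "1 \<le> k"
  shows "\<bar>y\<bar> \<le> k"
proof -
  have "(k - 1) * x + (1 - b) * y \<le> k - b" "(1 + b) * y - (k - 1) * x \<le> k + b"
    "- ((k - 1) * x + (1 - b) * y) \<le> k - b" "(k - 1) * x - (1 + b) * y \<le> k + b"
    using assms unfolding hex_coords_def by linarith+
  then show ?thesis by (simp add: algebra_simps)
qed

lemma hex_coords_minus: "hex_coords b k x y \<Longrightarrow> hex_coords b k (- x) (- y)"
  unfolding hex_coords_def by (simp add: abs_le_iff)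

text \<open>At height \<open>y\<close> the cap above the short diagonal is a convex combination of the diagonal and the apex,
  with weight \<open>\<tau>\<close> for the apex.\<close>

lemma hexagon_cap_subset_convex:
  fixes D M :: "real^2"
  assumes "convex S" "D + M \<in> S" "M - D \<in> S" "b *\<^sub>R D + k *\<^sub>R M \<in> S"
    and "1 \<le> k" and xy: "hex_coords b k x y" "1 \<le> y"
  shows "x *\<^sub>R D + y *\<^sub>R M \<in> S"
proof -
  have comb: "(1 - u) *\<^sub>R v + u *\<^sub>R w \<in> S" if "v \<in> S" "w \<in> S" "0 \<le> u" "u \<le> 1" for u v w
    using \<open>convex S\<close> that unfolding convex_alt by blast
  have top: "\<xi> *\<^sub>R D + M \<in> S" if "\<bar>\<xi>\<bar> \<le> 1" for \<xi>
  proof -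
    have "(1 - (1 - \<xi>) / 2) *\<^sub>R (D + M) + ((1 - \<xi>) / 2) *\<^sub>R (M - D) \<in> S"
      using that assms by (intro comb) auto
    moreover have "(1 - (1 - \<xi>) / 2) *\<^sub>R (D + M) + ((1 - \<xi>) / 2) *\<^sub>R (M - D) = \<xi> *\<^sub>R D + M"
      by (simp add: vec_eq_iff forall_2 algebra_simps diff_divide_distrib add_divide_distrib)
    ultimately show ?thesis by simp
  qed
  show ?thesis
  proof (cases "y = 1")
    case True
    then show ?thesis using top[of x] xy by (simp add: hex_coords_def)
  next
    case False
    have "y \<le> k" using hex_coords_height[OF xy(1) \<open>1 \<le> k\<close>] by simp
    then have "k > 1" using False xy by simp
    define \<tau> where "\<tau> = (y - 1) / (k - 1)"
    have "\<tau> * (k - 1) = y - 1" using \<open>k > 1\<close> by (simp add: \<tau>_def)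
    then have "y = (1 - \<tau>) + \<tau> * k" by (simp add: algebra_simps)
    then have \<tau>: "0 \<le> \<tau>" "\<tau> \<le> 1" "y = (1 - \<tau>) + \<tau> * k"
      using False xy \<open>y \<le> k\<close> \<open>k > 1\<close> by (auto simp: \<tau>_def)
    have "(k - 1) * x + (1 - b) * y \<le> k - b" "(1 + b) * y - (k - 1) * x \<le> k + b"
      using xy(1) by (auto simp: hex_coords_def abs_le_iff)
    then have "(k - 1) * (x - b * \<tau>) \<le> (k - 1) * (1 - \<tau>)" "(k - 1) * - (1 - \<tau>) \<le> (k - 1) * (x - b * \<tau>)"
      unfolding \<tau>(3) by (simp_all add: algebra_simps)
    then have bd: "\<bar>x - b * \<tau>\<bar> \<le> 1 - \<tau>"
      using \<open>k > 1\<close> by (simp only: mult_le_cancel_left_pos diff_gt_0_iff_gt abs_le_iff) simp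
    show ?thesis
    proof (cases "\<tau> = 1")
      case True
      then show ?thesis using bd \<tau>(3) assms by simp
    next
      case \<tau>1: False
      define \<xi> where "\<xi> = (x - b * \<tau>) / (1 - \<tau>)"
      have "\<bar>\<xi>\<bar> \<le> 1" using bd \<tau> \<tau>1 by (simp add: \<xi>_def abs_div)
      then have "(1 - \<tau>) *\<^sub>R (\<xi> *\<^sub>R D + M) + \<tau> *\<^sub>R (b *\<^sub>R D + k *\<^sub>R M) \<in> S"
        using top \<tau> assms by (intro comb) auto
      moreover have "x = (1 - \<tau>) * \<xi> + \<tau> * b" using \<tau>1 by (simp add: \<xi>_def)
      moreover have "(1 - \<tau>) *\<^sub>R (\<xi> *\<^sub>R D + M) + \<tau> *\<^sub>R (b *\<^sub>R D + k *\<^sub>R M)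
          = ((1 - \<tau>) * \<xi> + \<tau> * b) *\<^sub>R D + ((1 - \<tau>) + \<tau> * k) *\<^sub>R M"
        by (simp add: scaleR_add_left scaleR_add_right)
      ultimately show ?thesis using \<tau>(3) by metis
    qed
  qed
qed

lemma upper_hexagon_subset_convex:
  fixes D M :: "real^2"
  assumes S: "convex S" "D + M \<in> S" "M - D \<in> S" "- D - M \<in> S" "D - M \<in> S" "b *\<^sub>R D + k *\<^sub>R M \<in> S"
    and "1 \<le> k" and xy: "hex_coords b k x y" "0 \<le> y"
  shows "x *\<^sub>R D + y *\<^sub>R M \<in> S"
proof (cases "y \<le> 1")
  case True
  have comb: "(1 - u) *\<^sub>R v + u *\<^sub>R w \<in> S" if "v \<in> S" "w \<in> S" "0 \<le> u" "u \<le> 1" for u v w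
    using \<open>convex S\<close> that unfolding convex_alt by blast
  have x: "\<bar>x\<bar> \<le> 1" using xy by (simp add: hex_coords_def)
  have "(1 - (1 - x) / 2) *\<^sub>R (D + M) + ((1 - x) / 2) *\<^sub>R (M - D) \<in> S"
    "(1 - (1 - x) / 2) *\<^sub>R (D - M) + ((1 - x) / 2) *\<^sub>R (- D - M) \<in> S"
    using x S by (auto intro!: comb)
  then have "(1 - (1 - y) / 2) *\<^sub>R ((1 - (1 - x) / 2) *\<^sub>R (D + M) + ((1 - x) / 2) *\<^sub>R (M - D))
      + ((1 - y) / 2) *\<^sub>R ((1 - (1 - x) / 2) *\<^sub>R (D - M) + ((1 - x) / 2) *\<^sub>R (- D - M)) \<in> S"
    using True xy by (intro comb[where u = "(1 - y) / 2"]) simp_all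
  moreover have "(1 - (1 - y) / 2) *\<^sub>R ((1 - (1 - x) / 2) *\<^sub>R (D + M) + ((1 - x) / 2) *\<^sub>R (M - D))
      + ((1 - y) / 2) *\<^sub>R ((1 - (1 - x) / 2) *\<^sub>R (D - M) + ((1 - x) / 2) *\<^sub>R (- D - M)) = x *\<^sub>R D + y *\<^sub>R M"
    by (simp add: vec_eq_iff forall_2 algebra_simps diff_divide_distrib add_divide_distrib)
  ultimately show ?thesis by simp
next
  case False
  then show ?thesis using hexagon_cap_subset_convex[OF S(1-3,6) \<open>1 \<le> k\<close> xy(1)] by simp
qed

lemma hexagon_subset_convex:
  assumes S: "convex S" "D + M \<in> S" "M - D \<in> S" "- D - M \<in> S" "D - M \<in> S"
      "b *\<^sub>R D + k *\<^sub>R M \<in> S" "- (b *\<^sub>R D + k *\<^sub>R M) \<in> S"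
    and k: "1 \<le> k"
  shows "hexagon D M b k \<subseteq> S"
proof
  fix z assume "z \<in> hexagon D M b k"
  then obtain x y where z: "z = x *\<^sub>R D + y *\<^sub>R M" and xy: "hex_coords b k x y"
    by (auto simp: hexagon_def)
  show "z \<in> S"
  proof (cases "0 \<le> y")
    case True
    then show ?thesis
      using upper_hexagon_subset_convex[OF S(1-6) k xy] z by simp
  next
    case False
    have *: "hex_coords b k (- x) (- y)"
      using xy by (rule hex_coords_minus)
    have "- D + - M \<in> S" "- M - - D \<in> S" "- (- D) - - M \<in> S" "- D - - M \<in> S"
      "b *\<^sub>R (- D) + k *\<^sub>R (- M) \<in> S"
      using S by (simp_all add: add.commute)
    then have "(- x) *\<^sub>R (- D) + (- y) *\<^sub>R (- M) \<in> S"
      using False by (intro upper_hexagon_subset_convex[OF S(1) _ _ _ _ _ k *]) auto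
    then show ?thesis using z by simp
  qed
qed

lemma coordinates_cross2:
  assumes "cross2 D M \<noteq> 0"
  shows "z = (cross2 z M / cross2 D M) *\<^sub>R D + (cross2 D z / cross2 D M) *\<^sub>R M"
proof -
  have "cross2 D M *\<^sub>R z = cross2 z M *\<^sub>R D + cross2 D z *\<^sub>R M"
    by (simp add: vec_eq_iff forall_2 cross2_def algebra_simps)
  then have "inverse (cross2 D M) *\<^sub>R (cross2 D M *\<^sub>R z) = inverse (cross2 D M) *\<^sub>R (cross2 z M *\<^sub>R D + cross2 D z *\<^sub>R M)"
    by simp
  then show ?thesis using assms by (simp add: scaleR_add_right divide_inverse_commute)
qed

lemma cross2_nonzero:
  assumes "n \<bullet> M = 0" "n \<bullet> D \<noteq> 0" "M \<noteq> 0"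
  shows "cross2 D M \<noteq> 0"
proof
  assume "cross2 D M = 0"
  moreover have "(n \<bullet> D) *\<^sub>R M = cross2 D M *\<^sub>R vector [- n$2, n$1] + (n \<bullet> M) *\<^sub>R D"
    by (simp add: vec_eq_iff forall_2 cross2_def inner_real2 algebra_simps)
  ultimately show False using assms by simp
qed

lemma hexagon_eqI:
  assumes "convex P" and k: "1 \<le> k" and D: "cross2 D M \<noteq> 0"
    and P: "c + (D + M) \<in> P" "c + (M - D) \<in> P" "c + (- D - M) \<in> P" "c + (D - M) \<in> P"
      "c + (b *\<^sub>R D + k *\<^sub>R M) \<in> P" "c - (b *\<^sub>R D + k *\<^sub>R M) \<in> P"
    and bound: "\<And>x y. c + (x *\<^sub>R D + y *\<^sub>R M) \<in> P \<Longrightarrow> hex_coords b k x y"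
  shows "P = (+) c ` hexagon D M b k"
proof
  have mem: "v \<in> (+) (- c) ` P \<longleftrightarrow> c + v \<in> P" for v
    by (metis (no_types, lifting) add_minus_cancel image_iff minus_add_cancel)
  have "hexagon D M b k \<subseteq> (+) (- c) ` P"
    by (rule hexagon_subset_convex[OF _ _ _ _ _ _ _ k])
      (use \<open>convex P\<close> P in \<open>simp_all only: mem convex_translation_eq add_uminus_conv_diff\<close>)
  then show "(+) c ` hexagon D M b k \<subseteq> P" by force
  show "P \<subseteq> (+) c ` hexagon D M b k"
  proof
    fix p assume "p \<in> P"
    obtain x y where xy: "p - c = x *\<^sub>R D + y *\<^sub>R M"
      using coordinates_cross2[OF D] by blast
    then have "p = c + (x *\<^sub>R D + y *\<^sub>R M)" by (simp add: algebra_simps)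
    moreover from this have "hex_coords b k x y" using bound \<open>p \<in> P\<close> by simp
    ultimately show "p \<in> (+) c ` hexagon D M b k" unfolding hexagon_def by blast
  qed
qed

lemma parallelogram_eqI:
  assumes "convex P"
    and P: "c + (D + M) \<in> P" "c + (M - D) \<in> P" "c + (- D - M) \<in> P" "c + (D - M) \<in> P"
    and f: "f \<bullet> D = 0" "f \<bullet> M > 0" "\<And>x. x \<in> P \<Longrightarrow> \<bar>f \<bullet> (x - c)\<bar> \<le> f \<bullet> M"
    and g: "g \<bullet> M = 0" "g \<bullet> D > 0" "\<And>x. x \<in> P \<Longrightarrow> \<bar>g \<bullet> (x - c)\<bar> \<le> g \<bullet> D"
  shows "cross2 D M \<noteq> 0" "P = (+) c ` hexagon D M 0 1"
proof -
  show D: "cross2 D M \<noteq> 0"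
    using f(2) g(1,2) by (intro cross2_nonzero[of g]) auto
  have comb: "(1/2) *\<^sub>R v + (1/2) *\<^sub>R w \<in> P" if "v \<in> P" "w \<in> P" for v w
    using \<open>convex P\<close> that by (intro convexD) auto
  have "c + M \<in> P"
    using comb[OF P(1,2)] by (simp add: algebra_simps flip: scaleR_add_left)
  moreover have "c - M \<in> P"
    using comb[OF P(3,4)] by (simp add: algebra_simps flip: scaleR_add_left)
  ultimately show "P = (+) c ` hexagon D M 0 1"
  proof (intro hexagon_eqI[OF \<open>convex P\<close> _ D P])
    fix x y assume *: "c + (x *\<^sub>R D + y *\<^sub>R M) \<in> P"
    have "\<bar>x\<bar> * (g \<bullet> D) \<le> g \<bullet> D" "\<bar>y\<bar> * (f \<bullet> M) \<le> f \<bullet> M"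
      using f(1,2) g(1,2) f(3)[OF *] g(3)[OF *] by (simp_all add: inner_add_right abs_mult)
    then show "hex_coords 0 1 x y" using f(2) g(2) by (simp add: hex_coords_def)
  qed auto
qed

lemma hex_coords_vertices:
  assumes "1 \<le> k" "\<bar>b\<bar> \<le> 1"
  shows "hex_coords b k 1 1" "hex_coords b k (-1) 1" "hex_coords b k (-1) (-1)" "hex_coords b k 1 (-1)"
    "hex_coords b k b k" "hex_coords b k (-b) (-k)"
proof -
  have *: "\<bar>(k - 1) * b + (1 - b) * k\<bar> \<le> k - b" "\<bar>(k - 1) * b - (1 + b) * k\<bar> \<le> k + b"
  proof -
    have e: "(k - 1) * b + (1 - b) * k = k - b" "(k - 1) * b - (1 + b) * k = - (k + b)" by algebra+
    have "0 \<le> k - b" "0 \<le> k + b" using assms by linarith+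
    then show "\<bar>(k - 1) * b + (1 - b) * k\<bar> \<le> k - b" "\<bar>(k - 1) * b - (1 + b) * k\<bar> \<le> k + b"
      unfolding e by simp_all
  qed
  then show "hex_coords b k b k" using assms by (simp add: hex_coords_def)
  then show "hex_coords b k (-b) (-k)" by (rule hex_coords_minus)
  have "b \<le> 1" "- 1 \<le> b" using assms by linarith+
  then show "hex_coords b k 1 1" "hex_coords b k (-1) 1" "hex_coords b k (-1) (-1)" "hex_coords b k 1 (-1)"
    using assms(1) by (simp_all add: hex_coords_def)
qed

lemma convex_hexagon: "convex (hexagon D M b k)"
proof (rule convexI)
  fix p q and u v :: real
  assume "p \<in> hexagon D M b k" "q \<in> hexagon D M b k" and uv: "0 \<le> u" "0 \<le> v" "u + v = 1"
  then obtain x y x' y' where p: "p = x *\<^sub>R D + y *\<^sub>R M" "hex_coords b k x y"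
    and q: "q = x' *\<^sub>R D + y' *\<^sub>R M" "hex_coords b k x' y'"
    by (auto simp: hexagon_def)
  have comb: "\<bar>u * s + v * t\<bar> \<le> c" if "\<bar>s\<bar> \<le> c" "\<bar>t\<bar> \<le> c" for s t c :: real
  proof -
    have "\<bar>u * s + v * t\<bar> \<le> u * \<bar>s\<bar> + v * \<bar>t\<bar>"
      using abs_triangle_ineq[of "u * s" "v * t"] uv by (simp add: abs_mult)
    also have "\<dots> \<le> c" using convex_bound_le[OF that uv] .
    finally show ?thesis .
  qed
  have "hex_coords b k (u * x + v * x') (u * y + v * y')"
  proof -
    have "(k - 1) * (u * x + v * x') + (1 - b) * (u * y + v * y')
        = u * ((k - 1) * x + (1 - b) * y) + v * ((k - 1) * x' + (1 - b) * y')"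
      "(k - 1) * (u * x + v * x') - (1 + b) * (u * y + v * y')
        = u * ((k - 1) * x - (1 + b) * y) + v * ((k - 1) * x' - (1 + b) * y')"
      by algebra+
    then show ?thesis
      using p(2) q(2) unfolding hex_coords_def by (simp only: comb)
  qed
  moreover have "u *\<^sub>R p + v *\<^sub>R q = (u * x + v * x') *\<^sub>R D + (u * y + v * y') *\<^sub>R M"
    unfolding p(1) q(1) by (simp add: algebra_simps)
  ultimately show "u *\<^sub>R p + v *\<^sub>R q \<in> hexagon D M b k" unfolding hexagon_def by blast
qed

lemma hexagon_eq_hull:
  assumes k: "1 \<le> k" "\<bar>b\<bar> \<le> 1"
  shows "hexagon D M b k = convex hull {D + M, M - D, - D - M, D - M, b *\<^sub>R D + k *\<^sub>R M, - (b *\<^sub>R D + k *\<^sub>R M)}"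
    (is "_ = convex hull ?V")
proof
  show "hexagon D M b k \<subseteq> convex hull ?V"
    by (rule hexagon_subset_convex[OF convex_convex_hull _ _ _ _ _ _ k(1)]) (auto intro: hull_inc)
  have "p \<in> hexagon D M b k" if "hex_coords b k x y" "p = x *\<^sub>R D + y *\<^sub>R M" for p x y
    using that by (auto simp: hexagon_def)
  from this[OF hex_coords_vertices(1)[OF k]] this[OF hex_coords_vertices(2)[OF k]] this[OF hex_coords_vertices(3)[OF k]]
    this[OF hex_coords_vertices(4)[OF k]] this[OF hex_coords_vertices(5)[OF k]] this[OF hex_coords_vertices(6)[OF k]]
  have "?V \<subseteq> hexagon D M b k" by simp
  then show "convex hull ?V \<subseteq> hexagon D M b k"
    by (rule hull_minimal) (rule convex_hexagon)
qed

lemma polytope_hexagon: "1 \<le> k \<Longrightarrow> \<bar>b\<bar> \<le> 1 \<Longrightarrow> polytope (hexagon D M b k)"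
  unfolding hexagon_eq_hull by (intro polytope_convex_hull) simp

lemma compact_hexagon: "1 \<le> k \<Longrightarrow> \<bar>b\<bar> \<le> 1 \<Longrightarrow> compact (hexagon D M b k)"
  by (simp add: polytope_hexagon polytope_imp_compact)

lemma mem_hexagon_iff:
  assumes "cross2 D M \<noteq> 0"
  shows "x *\<^sub>R D + y *\<^sub>R M \<in> hexagon D M b k \<longleftrightarrow> hex_coords b k x y"
proof
  assume "x *\<^sub>R D + y *\<^sub>R M \<in> hexagon D M b k"
  then obtain x' y' where eq: "x *\<^sub>R D + y *\<^sub>R M = x' *\<^sub>R D + y' *\<^sub>R M" and h: "hex_coords b k x' y'"
    by (auto simp: hexagon_def)
  have c: "cross2 (s *\<^sub>R D + t *\<^sub>R M) M = s * cross2 D M" "cross2 D (s *\<^sub>R D + t *\<^sub>R M) = t * cross2 D M" for s t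
    by (simp_all add: cross2_def algebra_simps)
  have "x * cross2 D M = x' * cross2 D M" "y * cross2 D M = y' * cross2 D M"
    using c[of x y] c[of x' y'] eq by metis+
  then show "hex_coords b k x y" using h assms by simp
qed (auto simp: hexagon_def)

section \<open>Tiles are centrally symmetric hexagons\<close>

lemma finite_minimizer:
  fixes f :: "'a \<Rightarrow> real"
  assumes "finite B" "B \<noteq> {}"
  obtains w where "w \<in> B" "\<And>x. x \<in> B \<Longrightarrow> f w \<le> f x"
proof -
  have "Min (f ` B) \<in> f ` B" using assms by (intro Min_in) auto
  then obtain w where w: "w \<in> B" "Min (f ` B) = f w" by auto
  then show thesis using that[OF w(1)] assms by (metis Min_le finite_imageI imageI)
qed

context planar_tiling
begin

lemma farthest_point_unique_maximizer:
  assumes "\<And>x. x \<in> P \<Longrightarrow> norm x \<le> norm v" "x \<in> P" "x \<noteq> v"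
  shows "v \<bullet> x < v \<bullet> v"
proof -
  have "0 < (v - x) \<bullet> (v - x)" using assms by simp
  then have "2 * (v \<bullet> x) < v \<bullet> v + x \<bullet> x"
    by (simp add: inner_diff_left inner_diff_right inner_commute)
  moreover have "x \<bullet> x \<le> v \<bullet> v"
    using assms(1)[OF assms(2)] by (simp add: norm_le)
  ultimately show ?thesis by linarith
qed

lemma edge_at_exposed_vertex:
  assumes w: "w \<noteq> 0" and v: "v \<in> face P w" and a: "a \<in> face P w" "a \<noteq> v"
    and u: "\<And>x. x \<in> P \<Longrightarrow> x \<noteq> v \<Longrightarrow> u \<bullet> x < u \<bullet> v"
  obtains v' where "face P w = closed_segment v' v" "v' \<noteq> v"
proof -
  obtain p q where pq: "face P w = closed_segment p q"
    using face_is_segment w by blast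
  have "p = v \<or> q = v"
  proof (rule ccontr)
    assume "\<not> (p = v \<or> q = v)"
    moreover have "p \<in> P" "q \<in> P" using pq face_in ends_in_segment by metis+
    ultimately have lt: "u \<bullet> p < u \<bullet> v" "u \<bullet> q < u \<bullet> v"
      using u by blast+
    obtain s where s: "0 \<le> s" "s \<le> 1" "v = (1 - s) *\<^sub>R p + s *\<^sub>R q"
      using v pq by (auto simp: in_segment)
    have "u \<bullet> v = (1 - s) * (u \<bullet> p) + s * (u \<bullet> q)"
      using arg_cong[OF s(3), of "\<lambda>z. u \<bullet> z"] by (simp add: inner_add_right)
    moreover have "(1 - s) * (u \<bullet> p) + s * (u \<bullet> q) < u \<bullet> v"
      using convex_bound_lt[OF lt] s(1,2) by simp
    ultimately show False by simp
  qed
  then obtain v' where v': "face P w = closed_segment v' v"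
    using pq closed_segment_commute by metis
  then have "v' \<noteq> v" using a by auto
  then show thesis using that v' by blast
qed

text \<open>Let \<open>v\<close> be a vertex farthest from the origin; it is exposed by \<open>v\<close> as a functional. Turning this
  functional to either side until another vertex also attains the maximum gives the two edges at \<open>v\<close>. The
  angle at which a vertex \<open>w\<close> is reached is measured by the slope \<open>\<sigma> w\<close> of \<open>v - w\<close>.\<close>

lemma vertex_with_two_edges:
  assumes W: "finite W" "P = convex hull W"
  obtains v0 v1 v2 u1 u2 where "u1 \<noteq> 0" "u2 \<noteq> 0"
    "face P u1 = closed_segment v0 v1" "face P u2 = closed_segment v1 v2" "v0 \<noteq> v1" "v1 \<noteq> v2"
    "\<And>x. x \<in> P \<Longrightarrow> u1 \<bullet> x = u1 \<bullet> v1 \<Longrightarrow> u2 \<bullet> x = u2 \<bullet> v1 \<Longrightarrow> x = v1"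
proof -
  have "W \<noteq> {}" using P_nonempty W by auto
  obtain v where v: "v \<in> W" "\<And>w. w \<in> W \<Longrightarrow> norm w \<le> norm v"
    using finite_minimizer[OF W(1) \<open>W \<noteq> {}\<close>, of "\<lambda>w. - norm w"] by auto
  have "convex hull W \<subseteq> cball 0 (norm v)"
    by (rule hull_minimal) (use v in auto)
  then have far: "norm x \<le> norm v" if "x \<in> P" for x
    using that W by auto
  have strict: "v \<bullet> x < v \<bullet> v" if "x \<in> P" "x \<noteq> v" for x
    using farthest_point_unique_maximizer[OF far that] by blast
  have "v \<in> P" using v(1) W hull_inc by metis
  let ?W = "W - {v}"
  have W_in: "w \<in> P" if "w \<in> ?W" for w using that W hull_inc by (metis DiffD1)
  have "?W \<noteq> {}"
  proof
    assume "?W = {}"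
    then have "P = {v}" using v(1) W by (metis Diff_eq_empty_iff \<open>W \<noteq> {}\<close> convex_hull_singleton subset_singletonD)
    then show False
      by (intro functional_not_constant[of "axis 1 1" "axis 1 1 \<bullet> v"]) (simp_all add: axis_eq_0_iff)
  qed
  have pos: "v \<bullet> (v - w) > 0" if "w \<in> P" "w \<noteq> v" for w
    using strict[OF that] by (simp add: inner_diff_right)
  then have "v \<noteq> 0" using W_in \<open>?W \<noteq> {}\<close> by fastforce
  define J :: "real^2" where "J = vector [- v$2, v$1]"
  have J: "J \<bullet> v = 0" "J \<noteq> 0"
    using \<open>v \<noteq> 0\<close> by (auto simp: J_def inner_real2 vec_eq_iff forall_2)
  define \<sigma> where "\<sigma> w = (J \<bullet> (v - w)) / (v \<bullet> (v - w))" for w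
  have \<sigma>: "J \<bullet> (v - w) = \<sigma> w * (v \<bullet> (v - w))" if "w \<in> ?W" for w
    using pos W_in that by (force simp: \<sigma>_def)
  have fin: "finite ?W" using W by simp
  obtain a where a: "a \<in> ?W" "\<And>w. w \<in> ?W \<Longrightarrow> \<sigma> w \<le> \<sigma> a"
    using finite_minimizer[OF fin \<open>?W \<noteq> {}\<close>, of "\<lambda>w. - \<sigma> w"] by auto
  obtain b where b: "b \<in> ?W" "\<And>w. w \<in> ?W \<Longrightarrow> \<sigma> b \<le> \<sigma> w"
    using finite_minimizer[OF fin \<open>?W \<noteq> {}\<close>, of \<sigma>] by blast
  define u1 where "u1 = \<sigma> a *\<^sub>R v - J"
  define u2 where "u2 = J - \<sigma> b *\<^sub>R v"
  have u1: "u1 \<bullet> (v - w) = (\<sigma> a - \<sigma> w) * (v \<bullet> (v - w))" if "w \<in> ?W" for w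
    unfolding u1_def inner_diff_left inner_scaleR_left using \<sigma>[OF that] by (simp add: algebra_simps)
  have u2: "u2 \<bullet> (v - w) = (\<sigma> w - \<sigma> b) * (v \<bullet> (v - w))" if "w \<in> ?W" for w
    unfolding u2_def inner_diff_left inner_scaleR_left using \<sigma>[OF that] by (simp add: algebra_simps)
  have "u1 \<bullet> J \<noteq> 0" "u2 \<bullet> J \<noteq> 0"
    using J by (simp_all add: u1_def u2_def inner_diff_left inner_commute[of v])
  then have nz: "u1 \<noteq> 0" "u2 \<noteq> 0" by auto
  have in_face: "v \<in> face P u" if "\<And>w. w \<in> ?W \<Longrightarrow> u \<bullet> (v - w) \<ge> 0" for u
  proof -
    have "convex hull W \<subseteq> {x. u \<bullet> x \<le> u \<bullet> v}"
      by (rule hull_minimal) (use that in \<open>auto simp: convex_halfspace_le inner_diff_right\<close>)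
    then show ?thesis using \<open>v \<in> P\<close> W by (auto simp: face_def)
  qed
  have ge0: "u1 \<bullet> (v - w) \<ge> 0" "u2 \<bullet> (v - w) \<ge> 0" if "w \<in> ?W" for w
    using u1[OF that] u2[OF that] a(2)[OF that] b(2)[OF that] pos[OF W_in[OF that]] that by simp_all
  then have v_face: "v \<in> face P u1" "v \<in> face P u2" using in_face by blast+
  have "u1 \<bullet> (v - a) = 0" "u2 \<bullet> (v - b) = 0" using u1[OF a(1)] u2[OF b(1)] by auto
  then have "a \<in> face P u1" "b \<in> face P u2"
    using v_face W_in a b by (auto intro!: faceI[of v] simp: inner_diff_right)
  then obtain v0 v2 where v02: "face P u1 = closed_segment v0 v" "v0 \<noteq> v" "face P u2 = closed_segment v2 v" "v2 \<noteq> v"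
    using edge_at_exposed_vertex[OF nz(1) v_face(1) _ _ strict] edge_at_exposed_vertex[OF nz(2) v_face(2) _ _ strict] a b
    by (metis DiffD2 singletonI)
  have "\<sigma> b \<noteq> \<sigma> a"
  proof
    assume "\<sigma> b = \<sigma> a"
    then have "u1 \<bullet> w = u1 \<bullet> v" if "w \<in> W" for w
      using u1[of w] a(2)[of w] b(2)[of w] that by (cases "w = v") (auto simp: inner_diff_right)
    then have "convex hull W \<subseteq> {x. u1 \<bullet> x = u1 \<bullet> v}"
      by (intro hull_minimal) (auto simp: convex_hyperplane)
    then show False using functional_not_constant[OF nz(1)] W by blast
  qed
  have "x = v" if x: "x \<in> P" "u1 \<bullet> x = u1 \<bullet> v" "u2 \<bullet> x = u2 \<bullet> v" for x
  proof (rule ccontr)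
    assume "x \<noteq> v"
    have "(u1 + u2) \<bullet> (v - x) = 0" using x by (simp add: inner_diff_right inner_add_left)
    moreover have "u1 + u2 = (\<sigma> a - \<sigma> b) *\<^sub>R v" by (simp add: u1_def u2_def algebra_simps)
    ultimately show False using pos[OF x(1) \<open>x \<noteq> v\<close>] \<open>\<sigma> b \<noteq> \<sigma> a\<close> by simp
  qed
  then show thesis
    using that[OF nz v02(1), of v2] v02 by (metis closed_segment_commute)
qed

lemma opposite_face_nontrivial:
  assumes "u \<noteq> 0" "x \<in> face P (- u)" "y \<in> face P (- u)" "x \<noteq> y"
  obtains x' y' where "x' \<in> face P u" "y' \<in> face P u" "x' \<noteq> y'"
proof -
  have "-u \<noteq> 0" using assms by simp
  then obtain p q where pq: "face P (- u) = closed_segment p q"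
    using face_is_segment by blast
  have "p \<noteq> q" using assms pq by auto
  obtain t0 where "t0 \<in> T" using cover by auto
  have "\<exists>r. face P u = closed_segment r (r + (q - p))"
  proof (rule opposite_edges[OF \<open>t0 \<in> T\<close> \<open>-u \<noteq> 0\<close> pq \<open>p \<noteq> q\<close>])
    fix t assume "face P (- (- u)) = closed_segment (p - t) (q - t)"
    then show ?thesis by (intro exI[of _ "p - t"]) simp
  qed auto
  then obtain r where "face P u = closed_segment r (r + (q - p))" by blast
  then show thesis using that[of r "r + (q - p)"] \<open>p \<noteq> q\<close> by simp
qed

text \<open>Let \<open>y\<close> be the end of the first opposite edge that is extreme for the second functional, and suppose
  that it does not lie on the second opposite edge. Turning \<open>- u1\<close> towards \<open>- u2\<close> reaches a functional \<open>- u\<close> that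
  is maximal both at \<open>y\<close> and at another vertex, so it exposes an edge. But \<open>u\<close> is a positive combination of
  \<open>u1\<close> and \<open>u2\<close> and exposes only \<open>v\<close>, so this edge has no opposite edge, which is impossible.\<close>

lemma opposite_edges_meet:
  assumes W: "finite W" "P = convex hull W"
    and v: "v \<in> face P u1" "v \<in> face P u2"
    and u12: "u1 \<noteq> 0" "u2 \<noteq> 0"
    and only: "\<And>x. x \<in> P \<Longrightarrow> u1 \<bullet> x = u1 \<bullet> v \<Longrightarrow> u2 \<bullet> x = u2 \<bullet> v \<Longrightarrow> x = v"
  obtains y where "y \<in> face P (- u1)" "y \<in> face P (- u2)"
proof -
  have "continuous_on (face P (- u1)) (\<lambda>x. u2 \<bullet> x)" by (intro continuous_intros)
  then obtain y where y: "y \<in> face P (- u1)" "\<And>x. x \<in> face P (- u1) \<Longrightarrow> u2 \<bullet> y \<le> u2 \<bullet> x"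
    using continuous_attains_inf[OF face_compact[OF compact] face_nonempty[OF compact P_nonempty]] by metis
  have W_in: "w \<in> P" if "w \<in> W" for w using that W hull_inc by metis
  have "y \<in> face P (- u2)"
  proof (rule ccontr)
    assume not: "y \<notin> face P (- u2)"
    let ?B = "{w\<in>W. u2 \<bullet> w < u2 \<bullet> y}"
    have "?B \<noteq> {}"
    proof
      assume "?B = {}"
      then have "convex hull W \<subseteq> {x. u2 \<bullet> x \<ge> u2 \<bullet> y}"
        by (intro hull_minimal) (auto simp: convex_halfspace_ge not_less)
      then have "y \<in> face P (- u2)"
        using face_in[OF y(1)] W by (auto simp: face_def)
      then show False using not by blast
    qed
    define \<rho> where "\<rho> w = (u1 \<bullet> w - u1 \<bullet> y) / (u2 \<bullet> y - u2 \<bullet> w)" for w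
    have "finite ?B" using W by simp
    from finite_minimizer[OF this \<open>?B \<noteq> {}\<close>, of \<rho>]
    obtain w0 where w0: "w0 \<in> ?B" "\<And>w. w \<in> ?B \<Longrightarrow> \<rho> w0 \<le> \<rho> w" by blast
    have u1_ge: "u1 \<bullet> w \<ge> u1 \<bullet> y" if "w \<in> W" for w
      using face_le[OF y(1) W_in[OF that]] by simp
    have u1_gt: "u1 \<bullet> w > u1 \<bullet> y" if "w \<in> ?B" for w
    proof (rule ccontr)
      assume "\<not> u1 \<bullet> w > u1 \<bullet> y"
      then have "w \<in> face P (- u1)" using W_in that by (intro faceI[OF y(1)]) auto
      then show False using y(2)[of w] that by simp
    qed
    define u where "u = u1 + \<rho> w0 *\<^sub>R u2"
    have "\<rho> w0 > 0" using u1_gt[OF w0(1)] w0(1) by (simp add: \<rho>_def)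
    have u_diff: "u \<bullet> w - u \<bullet> y = (u1 \<bullet> w - u1 \<bullet> y) - \<rho> w0 * (u2 \<bullet> y - u2 \<bullet> w)" for w
      by (simp add: u_def inner_add_left algebra_simps)
    have u_ge: "u \<bullet> w \<ge> u \<bullet> y" if "w \<in> W" for w
    proof (cases "w \<in> ?B")
      case True
      then have "\<rho> w0 * (u2 \<bullet> y - u2 \<bullet> w) \<le> \<rho> w * (u2 \<bullet> y - u2 \<bullet> w)"
        using w0(2)[OF True] by (intro mult_right_mono) auto
      also have "\<dots> = u1 \<bullet> w - u1 \<bullet> y" using True by (simp add: \<rho>_def)
      finally show ?thesis using u_diff[of w] by linarith
    next
      case False
      then have "\<rho> w0 * (u2 \<bullet> y - u2 \<bullet> w) \<le> 0"
        using that \<open>\<rho> w0 > 0\<close> by (simp add: mult_le_0_iff)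
      then show ?thesis using u_diff[of w] u1_ge[OF that] by linarith
    qed
    have "u \<bullet> w0 = u \<bullet> y"
      using u_diff[of w0] w0(1) by (simp add: \<rho>_def)
    have "convex hull W \<subseteq> {x. u \<bullet> x \<ge> u \<bullet> y}"
      by (intro hull_minimal) (use u_ge in \<open>auto simp: convex_halfspace_ge\<close>)
    then have y_face: "y \<in> face P (- u)"
      using face_in[OF y(1)] W by (auto simp: face_def)
    moreover have "w0 \<in> face P (- u)"
      using y_face W_in w0(1) \<open>u \<bullet> w0 = u \<bullet> y\<close> by (intro faceI[OF y_face]) auto
    moreover have "w0 \<noteq> y" using w0(1) by auto
    moreover have v_in: "v \<in> P" using v face_in by blast
    have v_only: "x = v" if x: "x \<in> face P u" for x
    proof -
      have "u \<bullet> v \<le> u \<bullet> x" using face_le[OF x v_in] .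
      moreover have *: "u1 \<bullet> x \<le> u1 \<bullet> v" "u2 \<bullet> x \<le> u2 \<bullet> v"
        using face_le v face_in[OF x] by blast+
      moreover have "\<rho> w0 * (u2 \<bullet> x) \<le> \<rho> w0 * (u2 \<bullet> v)"
        using * \<open>\<rho> w0 > 0\<close> by simp
      ultimately have "u1 \<bullet> x = u1 \<bullet> v" "\<rho> w0 * (u2 \<bullet> x) = \<rho> w0 * (u2 \<bullet> v)"
        unfolding u_def inner_add_left inner_scaleR_left by linarith+
      then show ?thesis using only[OF face_in[OF x]] \<open>\<rho> w0 > 0\<close> by simp
    qed
    have "u \<noteq> 0"
    proof
      assume "u = 0"
      then have "face P u = P" by (simp add: face_def)
      then have "P = {v}" using v_only v_in by blast
      then show False by (intro functional_not_constant[OF u12(1), of "u1 \<bullet> v"]) simp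
    qed
    ultimately show False
      using opposite_face_nontrivial[OF \<open>u \<noteq> 0\<close>] v_only by metis
  qed
  then show thesis using that y(1) by blast
qed

end

definition hexagonal :: "(real^2) set \<Rightarrow> bool" where
  "hexagonal P \<longleftrightarrow> (\<exists>c D M b k. cross2 D M \<noteq> 0 \<and> 1 \<le> k \<and> \<bar>b\<bar> \<le> 1 \<and> P = (+) c ` hexagon D M b k)"

text \<open>The boundary lines of the three strips join neighbours among the points \<open>c \<plusminus> a0\<close>, \<open>c \<plusminus> a1\<close> and
  \<open>c \<plusminus> a2\<close>, so that the strips bound exactly the hull of these points. In the coordinates in which \<open>a0\<close> and \<open>a2\<close> are
  \<open>(1, 1)\<close> and \<open>(-1, 1)\<close>, the strips are the inequalities of \<open>hex_coords\<close>. These coordinates degenerate if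
  \<open>a2 = - a0\<close>; in that case \<open>P\<close> is a parallelogram with vertices \<open>c \<plusminus> a0\<close> and \<open>c \<plusminus> a1\<close>.\<close>

lemma hexagonal_if_supporting_strips:
  assumes "convex P"
    and a0: "c + a0 \<in> P" "c - a0 \<in> P" and a1: "c + a1 \<in> P" "c - a1 \<in> P"
    and a2: "c + a2 \<in> P" "c - a2 \<in> P"
    and u1: "\<And>x. c + x \<in> P \<Longrightarrow> \<bar>u1 \<bullet> x\<bar> \<le> u1 \<bullet> a1" "u1 \<bullet> a0 = u1 \<bullet> a1" "u1 \<bullet> a2 < u1 \<bullet> a1" "u1 \<bullet> a1 > 0"
    and u2: "\<And>x. c + x \<in> P \<Longrightarrow> \<bar>u2 \<bullet> x\<bar> \<le> u2 \<bullet> a1" "u2 \<bullet> a2 = u2 \<bullet> a1" "u2 \<bullet> a0 < u2 \<bullet> a1" "u2 \<bullet> a1 > 0"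
    and n: "\<And>x. c + x \<in> P \<Longrightarrow> \<bar>n \<bullet> x\<bar> \<le> n \<bullet> a2" "n \<bullet> a0 = - (n \<bullet> a2)" "n \<bullet> a2 > 0"
  shows "hexagonal P"
proof -
  define D where "D = (1/2) *\<^sub>R (a0 - a2)"
  define M where "M = (1/2) *\<^sub>R (a0 + a2)"
  have a0_eq: "D + M = a0" and a2_eq: "M - D = a2"
    unfolding D_def M_def by (simp_all add: vec_eq_iff algebra_simps)
  show ?thesis
  proof (cases "M = 0")
    case True
    then have a2_neg: "a2 = - a0" unfolding M_def by (simp add: eq_neg_iff_add_eq_0 add.commute)
    define D' where "D' = (1/2) *\<^sub>R (a0 - a1)"
    define M' where "M' = (1/2) *\<^sub>R (a0 + a1)"
    have eqs: "D' + M' = a0" "M' - D' = a1" "- D' - M' = - a0" "D' - M' = - a1"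
      unfolding D'_def M'_def by (simp_all add: vec_eq_iff algebra_simps)
    have "cross2 D' M' \<noteq> 0" "P = (+) c ` hexagon D' M' 0 1"
    proof (atomize (full), intro conjI)
      have f: "u1 \<bullet> D' = 0" "u1 \<bullet> M' = u1 \<bullet> a1" and g: "(- u2) \<bullet> M' = 0" "(- u2) \<bullet> D' = u2 \<bullet> a1"
        using u1(2) u2(2) by (auto simp: D'_def M'_def a2_neg inner_add_right inner_diff_right)
      note * = parallelogram_eqI[OF \<open>convex P\<close>, of c D' M' u1 "- u2", unfolded eqs f g]
      show "cross2 D' M' \<noteq> 0" "P = (+) c ` hexagon D' M' 0 1"
        using *(1) *(2) a0 a1 u1(1)[of "_ - c"] u1(4) u2(1)[of "_ - c"] u2(4) by auto
    qed
    then show ?thesis unfolding hexagonal_def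
      by (intro exI[of _ c] exI[of _ D'] exI[of _ M'] exI[of _ 0] exI[of _ 1]) auto
  next
    case False
    have nM: "n \<bullet> M = 0" and nD: "n \<bullet> D = - (n \<bullet> a2)"
      using n(2) by (auto simp: M_def D_def inner_add_right inner_diff_right)
    then have cross: "cross2 D M \<noteq> 0" using False n(3) by (intro cross2_nonzero[of n]) auto
    obtain b k where bk: "a1 = b *\<^sub>R D + k *\<^sub>R M"
      using coordinates_cross2[OF cross] by blast
    have "\<bar>n \<bullet> a1\<bar> = \<bar>b\<bar> * (n \<bullet> a2)"
      unfolding bk inner_add_right inner_scaleR_right nM nD using n(3) by (simp add: abs_mult)
    then have b: "\<bar>b\<bar> \<le> 1" using n(1)[OF a1(1)] n(3) by simp
    define d1 where "d1 = u1 \<bullet> D" define m1 where "m1 = u1 \<bullet> M"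
    define d2 where "d2 = - (u2 \<bullet> D)" define m2 where "m2 = u2 \<bullet> M"
    note coord = d1_def m1_def d2_def m2_def inner_add_right inner_diff_right
    have c1: "d1 + m1 = u1 \<bullet> a1" and c2: "d2 + m2 = u2 \<bullet> a1"
      using u1(2) u2(2) by (simp_all add: coord flip: a0_eq a2_eq)
    have e1: "b * d1 + k * m1 = u1 \<bullet> a1" and e2: "k * m2 - b * d2 = u2 \<bullet> a1"
      by (simp_all add: bk d1_def m1_def d2_def m2_def inner_add_right)
    have "d1 > 0" "d2 > 0"
      using u1(3) u2(3) c1 c2 by (simp_all add: coord flip: a0_eq a2_eq)
    have "m1 \<ge> 0" "m2 \<ge> 0"
      using u1(1)[OF a2(1)] u2(1)[OF a0(1)] c1 c2 by (simp_all add: coord flip: a0_eq a2_eq)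
    have k1: "(k - 1) * m1 = (1 - b) * d1" and k2: "(k - 1) * m2 = (1 + b) * d2"
      using c1 c2 e1 e2 by (simp_all add: algebra_simps)
    have "k \<ge> 1"
    proof (rule ccontr)
      assume "\<not> k \<ge> 1"
      then have "(k - 1) * m1 \<le> 0" "(k - 1) * m2 \<le> 0"
        using \<open>m1 \<ge> 0\<close> \<open>m2 \<ge> 0\<close> by (simp_all add: mult_le_0_iff)
      then have "1 - b \<le> 0" "1 + b \<le> 0"
        unfolding k1 k2 using \<open>d1 > 0\<close> \<open>d2 > 0\<close> by (simp_all add: mult_le_0_iff)
      then show False by linarith
    qed
    have "P = (+) c ` hexagon D M b k"
    proof (rule hexagon_eqI[OF \<open>convex P\<close> \<open>k \<ge> 1\<close> cross])
      show "c + (D + M) \<in> P" "c + (M - D) \<in> P" "c + (b *\<^sub>R D + k *\<^sub>R M) \<in> P" "c - (b *\<^sub>R D + k *\<^sub>R M) \<in> P"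
        using a0 a1 a2 by (simp_all add: a0_eq a2_eq flip: bk)
      have "- D - M = - a0" "D - M = - a2" unfolding a0_eq[symmetric] a2_eq[symmetric] by simp_all
      then show "c + (- D - M) \<in> P" "c + (D - M) \<in> P"
        using a0 a2 by simp_all
      fix x y assume xy: "c + (x *\<^sub>R D + y *\<^sub>R M) \<in> P"
      have "\<bar>x\<bar> * (n \<bullet> a2) \<le> 1 * (n \<bullet> a2)"
        using n(1)[OF xy] n(3) by (simp add: inner_add_right nM nD abs_mult)
      then have "\<bar>x\<bar> \<le> 1" using n(3) by (simp only: mult_le_cancel_right_pos)
      have "\<bar>(k - 1) * x + (1 - b) * y\<bar> * d1 = \<bar>((k - 1) * x + (1 - b) * y) * d1\<bar>"
        using \<open>d1 > 0\<close> by (simp add: abs_mult)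
      also have "((k - 1) * x + (1 - b) * y) * d1 = (k - 1) * (x * d1 + y * m1)"
        using k1 by algebra
      also have "\<bar>\<dots>\<bar> \<le> (k - 1) * (d1 + m1)"
        using u1(1)[OF xy] c1 \<open>k \<ge> 1\<close> by (simp add: abs_mult inner_add_right d1_def m1_def mult_left_mono)
      also have "\<dots> = (k - b) * d1" using k1 by algebra
      finally have 1: "\<bar>(k - 1) * x + (1 - b) * y\<bar> \<le> k - b"
        using \<open>d1 > 0\<close> by (simp only: mult_le_cancel_right_pos)
      have "\<bar>(k - 1) * x - (1 + b) * y\<bar> * d2 = \<bar>((k - 1) * x - (1 + b) * y) * d2\<bar>"
        using \<open>d2 > 0\<close> by (simp add: abs_mult)
      also have "((k - 1) * x - (1 + b) * y) * d2 = - (k - 1) * (x * - d2 + y * m2)"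
        using k2 by algebra
      also have "\<bar>\<dots>\<bar> = (k - 1) * \<bar>x * - d2 + y * m2\<bar>"
        using \<open>k \<ge> 1\<close> by (simp add: abs_mult)
      also have "\<dots> \<le> (k - 1) * (d2 + m2)"
        using u2(1)[OF xy] c2 \<open>k \<ge> 1\<close> by (simp add: inner_add_right d2_def m2_def mult_left_mono)
      also have "\<dots> = (k + b) * d2" using k2 by algebra
      finally have "\<bar>(k - 1) * x - (1 + b) * y\<bar> \<le> k + b"
        using \<open>d2 > 0\<close> by (simp only: mult_le_cancel_right_pos)
      then show "hex_coords b k x y" using 1 \<open>\<bar>x\<bar> \<le> 1\<close> by (simp add: hex_coords_def)
    qed
    then show ?thesis unfolding hexagonal_def using cross \<open>k \<ge> 1\<close> b by blast
  qed
qed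

context planar_tiling
begin

text \<open>The strip of an overhang is as wide as both parallel edges, so together with the strip between
  these edges it cuts out the parallelogram that they span.\<close>

lemma hexagonal_if_overhang:
  assumes F: "face P u = closed_segment p q" "face P (- u) = closed_segment r (r + (q - p))"
    and "u \<noteq> 0" "n \<noteq> 0" and n: "\<And>x. x \<in> P \<Longrightarrow> n \<bullet> q \<le> n \<bullet> x" "\<And>x. x \<in> P \<Longrightarrow> n \<bullet> x \<le> n \<bullet> p"
  shows "hexagonal P"
proof -
  let ?s = "r + (q - p)"
  have in_face: "p \<in> face P u" "q \<in> face P u" "r \<in> face P (- u)" "?s \<in> face P (- u)" using F by auto
  then have in_P: "p \<in> P" "q \<in> P" "r \<in> P" "?s \<in> P" using face_in by blast+
  have up: "u \<bullet> x \<le> u \<bullet> p" and ur: "u \<bullet> r \<le> u \<bullet> x" if "x \<in> P" for x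
    using face_le[OF in_face(1) that] face_le[OF in_face(3) that] by simp_all
  have uq: "u \<bullet> q = u \<bullet> p" using face_eq in_face by blast
  have nr: "n \<bullet> r = n \<bullet> p"
    using n(1)[OF in_P(4)] n(2)[OF in_P(3)] by (simp add: inner_add_right inner_diff_right)
  have lt: "u \<bullet> r < u \<bullet> p"
  proof (rule ccontr)
    assume "\<not> u \<bullet> r < u \<bullet> p"
    then have "u \<bullet> x = u \<bullet> p" if "x \<in> P" for x using up[OF that] ur[OF that] by linarith
    then show False using functional_not_constant[OF \<open>u \<noteq> 0\<close>] by blast
  qed
  have lt': "n \<bullet> q < n \<bullet> p"
  proof (rule ccontr)
    assume "\<not> n \<bullet> q < n \<bullet> p"
    then have "n \<bullet> x = n \<bullet> p" if "x \<in> P" for x using n(1,2)[OF that] by linarith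
    then show False using functional_not_constant[OF \<open>n \<noteq> 0\<close>] by blast
  qed
  define c where "c = (1/2) *\<^sub>R (q + r)"
  define D where "D = (1/2) *\<^sub>R (p - q)"
  define M where "M = (1/2) *\<^sub>R (p - r)"
  have eqs: "c + (D + M) = p" "c + (M - D) = q" "c + (- D - M) = ?s" "c + (D - M) = r"
    by (simp_all add: c_def D_def M_def vec_eq_iff algebra_simps)
  have "cross2 D M \<noteq> 0" "P = (+) c ` hexagon D M 0 1"
  proof (atomize (full), intro conjI)
    have fg: "u \<bullet> D = 0" "n \<bullet> M = 0" by (simp_all add: D_def M_def inner_diff_right uq nr)
    have uM: "u \<bullet> M = (u \<bullet> p - u \<bullet> r) / 2" "u \<bullet> c = (u \<bullet> p + u \<bullet> r) / 2"
      "n \<bullet> D = (n \<bullet> p - n \<bullet> q) / 2" "n \<bullet> c = (n \<bullet> q + n \<bullet> p) / 2"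
      by (simp_all add: c_def D_def M_def inner_diff_right inner_add_right uq nr)
    have f: "\<bar>u \<bullet> (x - c)\<bar> \<le> u \<bullet> M" and g: "\<bar>n \<bullet> (x - c)\<bar> \<le> n \<bullet> D" if "x \<in> P" for x
      unfolding inner_diff_right uM abs_le_iff using up[OF that] ur[OF that] n[OF that] by (simp_all add: field_simps)
    have pos: "u \<bullet> M > 0" "n \<bullet> D > 0" using uM lt lt' by simp_all
    note * = parallelogram_eqI[OF convex, of c D M u n, unfolded eqs, OF in_P(1,2,4,3) fg(1) pos(1) f fg(2) pos(2) g]
    show "cross2 D M \<noteq> 0" "P = (+) c ` hexagon D M 0 1"
      using *(1) *(2) by auto
  qed
  then show ?thesis unfolding hexagonal_def
    by (intro exI[of _ c] exI[of _ D] exI[of _ M] exI[of _ 0] exI[of _ 1]) auto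
qed

text \<open>Let \<open>v0 v1\<close> and \<open>v1 v2\<close> be adjacent edges whose neighbours \<open>t1\<close> and \<open>t2\<close> are glued along full edges.
  The opposite edges meet in a vertex \<open>y\<close>, and the reflection in \<open>c = (v1 + y) / 2\<close> maps the two edges to their
  opposite edges. The two neighbours meet in \<open>v1\<close>. A functional \<open>n\<close> separating them is maximal on \<open>P\<close> at the
  reflection of \<open>v0\<close> and minimal at the reflection of \<open>v2\<close>; comparing with its values at \<open>v2\<close> and \<open>v0\<close> shows that
  the segments from these points to \<open>v2\<close> and \<open>v0\<close>, respectively, lie on the boundary. This is the third pair of
  sides.\<close>

theorem hexagonal_if_tiling:
  assumes "polytope P" shows "hexagonal P"
proof -
  obtain W where W: "finite W" "P = convex hull W" using assms by (auto simp: polytope_def)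
  obtain t0 where t0: "t0 \<in> T" using cover by auto
  obtain v0 v1 v2 u1 u2 where u: "u1 \<noteq> 0" "u2 \<noteq> 0"
    and F1: "face P u1 = closed_segment v0 v1" "v0 \<noteq> v1" and F2: "face P u2 = closed_segment v1 v2" "v1 \<noteq> v2"
    and only: "\<And>x. x \<in> P \<Longrightarrow> u1 \<bullet> x = u1 \<bullet> v1 \<Longrightarrow> u2 \<bullet> x = u2 \<bullet> v1 \<Longrightarrow> x = v1"
    using vertex_with_two_edges[OF W] by metis
  show ?thesis
  proof (rule opposite_edges[OF t0 u(1) F1])
    fix r n assume "face P (- u1) = closed_segment r (r + (v1 - v0))" "n \<noteq> 0"
      "\<And>x. x \<in> P \<Longrightarrow> n \<bullet> v1 \<le> n \<bullet> x" "\<And>x. x \<in> P \<Longrightarrow> n \<bullet> x \<le> n \<bullet> v0"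
    then show ?thesis by (rule hexagonal_if_overhang[OF F1(1) _ u(1)])
  next
    fix t1 assume t1: "t0 + t1 \<in> T" "face P (- u1) = closed_segment (v0 - t1) (v1 - t1)"
    show ?thesis
    proof (rule opposite_edges[OF t0 u(2) F2])
      fix r n assume "face P (- u2) = closed_segment r (r + (v2 - v1))" "n \<noteq> 0"
        "\<And>x. x \<in> P \<Longrightarrow> n \<bullet> v2 \<le> n \<bullet> x" "\<And>x. x \<in> P \<Longrightarrow> n \<bullet> x \<le> n \<bullet> v1"
      then show ?thesis by (rule hexagonal_if_overhang[OF F2(1) _ u(2)])
    next
      fix t2 assume t2: "t0 + t2 \<in> T" "face P (- u2) = closed_segment (v1 - t2) (v2 - t2)"
      have faces: "v0 \<in> face P u1" "v1 \<in> face P u1" "v1 \<in> face P u2" "v2 \<in> face P u2"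
        using F1 F2 by auto
      have in_P: "v0 \<in> P" "v1 \<in> P" "v2 \<in> P" using faces face_in by blast+
      have eq1: "u1 \<bullet> v0 = u1 \<bullet> v1" and eq2: "u2 \<bullet> v2 = u2 \<bullet> v1"
        using faces face_eq by blast+
      have lt2: "u2 \<bullet> v0 < u2 \<bullet> v1"
        using only[OF in_P(1) eq1] F1(2) face_le[OF faces(3) in_P(1)] by fastforce
      have lt1: "u1 \<bullet> v2 < u1 \<bullet> v1"
        using only[OF in_P(3) _ eq2] F2(2) face_le[OF faces(2) in_P(3)] by fastforce
      obtain y where y: "y \<in> face P (- u1)" "y \<in> face P (- u2)"
        using opposite_edges_meet[OF W faces(2,3) u only] by blast
      have y1: "y = v0 - t1"
      proof -
        obtain s where s: "0 \<le> s" "s \<le> 1" "y = (1 - s) *\<^sub>R (v0 - t1) + s *\<^sub>R (v1 - t1)"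
          using y(1) t1 by (auto simp: in_segment)
        have "v0 - t1 \<in> P" using t1(2) face_in by (metis ends_in_segment(1))
        then have "u2 \<bullet> y \<le> u2 \<bullet> (v0 - t1)" using face_le[OF y(2)] by fastforce
        then have "s * (u2 \<bullet> v1 - u2 \<bullet> v0) \<le> 0"
          unfolding s(3) by (simp add: inner_add_right inner_diff_right algebra_simps)
        then have "s = 0" using s lt2 by (simp add: mult_le_0_iff)
        then show ?thesis using s(3) by simp
      qed
      have y2: "y = v2 - t2"
      proof -
        obtain s where s: "0 \<le> s" "s \<le> 1" "y = (1 - s) *\<^sub>R (v1 - t2) + s *\<^sub>R (v2 - t2)"
          using y(2) t2 by (auto simp: in_segment)
        have "v2 - t2 \<in> P" using t2(2) face_in by (metis ends_in_segment(2))
        then have "u1 \<bullet> y \<le> u1 \<bullet> (v2 - t2)" using face_le[OF y(1)] by fastforce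
        then have "(1 - s) * (u1 \<bullet> v1 - u1 \<bullet> v2) \<le> 0"
          unfolding s(3) by (simp add: inner_add_right inner_diff_right algebra_simps)
        then have "s = 1" using s lt1 by (simp add: mult_le_0_iff)
        then show ?thesis using s(3) by simp
      qed
      define c where "c = (1/2) *\<^sub>R (v1 + y)"
      have c2: "2 *\<^sub>R c = v1 + y" by (simp add: c_def)
      have opp0: "v1 - t1 = 2 *\<^sub>R c - v0" and opp2: "v1 - t2 = 2 *\<^sub>R c - v2"
        unfolding c2 by (simp add: y1, simp add: y2)
      have opp_in: "v1 - t1 \<in> P" "v1 - t2 \<in> P" "y \<in> P"
        using t1(2) t2(2) face_in y by (metis ends_in_segment)+
      have "t0 + t1 \<noteq> t0 + t2" using y1 y2 lt2 eq2 by auto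
      then obtain n \<beta> where n: "n \<noteq> 0" "\<And>x. x \<in> P \<Longrightarrow> n \<bullet> (t0 + t1 + x) \<le> \<beta>" "\<And>x. x \<in> P \<Longrightarrow> \<beta> \<le> n \<bullet> (t0 + t2 + x)"
        using separating_functional[OF t1(1) t2(1)] by metis
      have \<beta>: "\<beta> = n \<bullet> (t0 + v1)"
        using n(2)[OF opp_in(1)] n(3)[OF opp_in(2)] by simp
      have n_le: "n \<bullet> x \<le> n \<bullet> (2 *\<^sub>R c - v0)" and n_ge: "n \<bullet> (2 *\<^sub>R c - v2) \<le> n \<bullet> x" if "x \<in> P" for x
        using n(2,3)[OF that] \<beta> unfolding opp0[symmetric] opp2[symmetric] by (simp_all add: inner_add_right inner_diff_right)
      have n02: "n \<bullet> (v0 - c) = - (n \<bullet> (v2 - c))"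
        using n_le[OF in_P(3)] n_ge[OF in_P(1)] by (simp add: inner_diff_right)
      have n_bound: "\<bar>n \<bullet> x\<bar> \<le> n \<bullet> (v2 - c)" if "c + x \<in> P" for x
        using n_le[OF that] n_ge[OF that] n02 by (simp add: inner_diff_right inner_add_right)
      have pos: "0 < m \<bullet> a" if m: "m \<noteq> 0" "\<And>x. c + x \<in> P \<Longrightarrow> \<bar>m \<bullet> x\<bar> \<le> m \<bullet> a" for m a
      proof (rule ccontr)
        assume "\<not> 0 < m \<bullet> a"
        have "m \<bullet> x = m \<bullet> c" if "x \<in> P" for x
          using m(2)[of "x - c"] that \<open>\<not> 0 < m \<bullet> a\<close> by (simp add: inner_diff_right)
        then show False using functional_not_constant[OF m(1)] by blast
      qed
      have bound: "\<bar>w \<bullet> x\<bar> \<le> w \<bullet> (v1 - c)" if w: "v1 \<in> face P w" "y \<in> face P (- w)" and x: "c + x \<in> P" for w x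
      proof -
        have "w \<bullet> c = (w \<bullet> v1 + w \<bullet> y) / 2" by (simp add: c_def inner_add_right)
        then show ?thesis
          using face_le[OF w(1) x] face_le[OF w(2) x] by (simp add: inner_add_right inner_diff_right abs_le_iff field_simps)
      qed
      have c_y: "c - (v1 - c) = y" using c2 by (simp add: scaleR_2 algebra_simps)
      have c_0: "c - (v0 - c) \<in> P" "c - (v2 - c) \<in> P"
        using opp_in opp0 opp2 by (simp_all add: scaleR_2)
      show ?thesis
        by (rule hexagonal_if_supporting_strips[OF convex, where c = c and ?a0.0 = "v0 - c" and ?a1.0 = "v1 - c"
              and ?a2.0 = "v2 - c" and ?u1.0 = u1 and ?u2.0 = u2 and n = n])
          (use in_P opp_in(3) c_0 c_y bound faces y n_bound n02 pos[OF n(1) n_bound] pos[OF u(1) bound[OF faces(2) y(1)]]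
            pos[OF u(2) bound[OF faces(3) y(2)]] eq1 eq2 lt1 lt2 in \<open>simp_all add: inner_diff_right\<close>)
    qed
  qed
qed

end

theorem tile_is_hexagonal:
  assumes "P \<in> tiles" shows "hexagonal P"
proof -
  obtain T where T: "(\<Union>t\<in>T. (+) t ` P) = UNIV"
      "pairwise (\<lambda>s t. interior ((+) s ` P) \<inter> interior ((+) t ` P) = {}) T"
    and P: "polytope P" "interior P \<noteq> {}"
    using assms unfolding tiles_def tessellates_by_translations_def by blast
  interpret planar_tiling P T
    by unfold_locales (use T P in \<open>auto simp: polytope_imp_convex polytope_imp_compact\<close>)
  show ?thesis using hexagonal_if_tiling P by blast
qed

section \<open>Steiner symmetrization of convex sets\<close>

text \<open>Under the orthogonal projection \<open>g\<close> to the line, which does not increase distances, each covering set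
  goes into an interval no longer than its diameter. These intervals cover an interval of length
  \<open>dist p q\<close>, so the claim is the countable subadditivity of Lebesgue measure.\<close>

lemma hausdorff_measure1_segment_ge:
  fixes p q :: "'a::euclidean_space"
  shows "ennreal (dist p q) \<le> hausdorff_measure1 (closed_segment p q)"
proof (cases "p = q")
  case False
  define g where "g x = ((x - p) \<bullet> (q - p)) / norm (q - p)" for x
  have "norm (q - p) > 0" using False by simp
  have lip: "g x - g y \<le> dist x y" for x y
  proof -
    have "g x - g y = ((x - y) \<bullet> (q - p)) / norm (q - p)"
      by (simp add: g_def inner_diff_left diff_divide_distrib)
    also have "\<dots> \<le> norm (x - y) * norm (q - p) / norm (q - p)"
      by (intro divide_right_mono norm_cauchy_schwarz) simp
    finally show ?thesis using \<open>norm (q - p) > 0\<close> by (simp add: dist_norm)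
  qed
  have onto: "{0..dist p q} \<subseteq> g ` closed_segment p q"
  proof
    fix t assume t: "t \<in> {0..dist p q}"
    let ?x = "(1 - t / norm (q - p)) *\<^sub>R p + (t / norm (q - p)) *\<^sub>R q"
    have "?x - p = (t / norm (q - p)) *\<^sub>R (q - p)" by (simp add: algebra_simps)
    then have "g ?x = t" using \<open>norm (q - p) > 0\<close> by (simp add: g_def dot_square_norm power2_eq_square)
    moreover have "?x \<in> closed_segment p q"
      unfolding in_segment using t False
      by (intro exI[of _ "t / norm (q - p)"]) (auto simp: dist_norm norm_minus_commute)
    ultimately show "t \<in> g ` closed_segment p q" by (metis imageI)
  qed
  have "ennreal (dist p q) \<le> (\<Sum>i. ennreal (diameter (C i)))"
    if C: "closed_segment p q \<subseteq> (\<Union>i. C i)" "\<And>i. bounded (C i)" for C :: "nat \<Rightarrow> 'a set"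
  proof -
    define I where "I i = (if C i = {} then {} else {Inf (g ` C i)..Sup (g ` C i)})" for i
    have bdd: "bdd_above (g ` C i)" "bdd_below (g ` C i)" for i
    proof -
      have "g x - g y \<le> diameter (C i)" if "x \<in> C i" "y \<in> C i" for x y
        using lip[of x y] diameter_bounded_bound[OF C(2) that] by linarith
      then have "g x \<le> g y + diameter (C i)" "g y - diameter (C i) \<le> g x" if "x \<in> C i" "y \<in> C i" for x y
        using that by (smt (verit))+
      then show "bdd_above (g ` C i)" "bdd_below (g ` C i)"
        by (metis bdd_above.I2 image_is_empty bdd_above_empty equals0I,
            metis bdd_below.I2 image_is_empty bdd_below_empty equals0I)
    qed
    have gI: "g ` C i \<subseteq> I i" for i
      using bdd by (auto simp: I_def intro!: cINF_lower[OF bdd(2)] cSUP_upper[OF _ bdd(1)])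
    have "g ` closed_segment p q \<subseteq> (\<Union>i. g ` C i)" using C(1) by blast
    also have "\<dots> \<subseteq> (\<Union>i. I i)" using gI by (rule UN_mono[OF order_refl])
    finally have sub: "{0..dist p q} \<subseteq> (\<Union>i. I i)" using onto by (rule order_trans[rotated])
    have meas: "emeasure lborel (I i) \<le> ennreal (diameter (C i))" for i
    proof (cases "C i = {}")
      case False
      have "g x - diameter (C i) \<le> g y" if "x \<in> C i" "y \<in> C i" for x y
        using lip[of x y] diameter_bounded_bound[OF C(2) that] by linarith
      then have "g x - diameter (C i) \<le> Inf (g ` C i)" if "x \<in> C i" for x
        using that False by (intro cINF_greatest) auto
      then have "Sup (g ` C i) \<le> Inf (g ` C i) + diameter (C i)"
        using False by (intro cSUP_least) (auto simp: algebra_simps)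
      moreover have "Inf (g ` C i) \<le> Sup (g ` C i)"
        using False bdd by (meson cINF_lower cSUP_upper ex_in_conv order_trans)
      ultimately show ?thesis using False by (simp add: I_def ennreal_leI)
    qed (simp add: I_def)
    have "ennreal (dist p q) = emeasure lborel {0..dist p q}" by simp
    also have "\<dots> \<le> emeasure lborel (\<Union>i. I i)"
      using sub by (intro emeasure_mono) (auto simp: I_def)
    also have "\<dots> \<le> (\<Sum>i. emeasure lborel (I i))"
      by (intro emeasure_subadditive_countably) (auto simp: I_def)
    also have "\<dots> \<le> (\<Sum>i. ennreal (diameter (C i)))"
      by (intro suminf_le meas) auto
    finally show ?thesis .
  qed
  then show ?thesis
    unfolding hausdorff_measure1_def
    by (intro SUP_upper2[of 1] INF_greatest) auto
qed simp

text \<open>Cut the segment into \<open>N\<close> equal pieces of length at most \<open>\<delta>\<close>.\<close>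

lemma hausdorff_measure1_segment_le:
  fixes p q :: "'a::real_normed_vector"
  shows "hausdorff_measure1 (closed_segment p q) \<le> ennreal (dist p q)"
  unfolding hausdorff_measure1_def
proof (rule SUP_least)
  fix \<delta> :: real assume "\<delta> \<in> {0<..}"
  then have "\<delta> > 0" by simp
  obtain n where n: "dist p q / \<delta> < real n" using reals_Archimedean2 by blast
  \<comment> \<open>a successor, so that there is at least one piece even if \<open>p = q\<close>\<close>
  define N where "N = Suc n"
  have "dist p q / \<delta> \<le> real N" using n by (simp add: N_def)
  then have N: "dist p q / real N \<le> \<delta>" "N > 0"
    using \<open>\<delta> > 0\<close> by (auto simp: N_def field_simps)
  define C where "C i = (if i < N then (\<lambda>s. (1 - s) *\<^sub>R p + s *\<^sub>R q) ` {real i / N..(real i + 1) / N} else {})" for i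
  have diam: "diameter (C i) \<le> dist p q / N" for i
  proof (rule diameter_le)
    fix x y assume "x \<in> C i" "y \<in> C i"
    then obtain s t where st: "s \<in> {real i / N..(real i + 1) / N}" "t \<in> {real i / N..(real i + 1) / N}"
      "x = (1 - s) *\<^sub>R p + s *\<^sub>R q" "y = (1 - t) *\<^sub>R p + t *\<^sub>R q"
      unfolding C_def by (auto split: if_splits)
    have "x - y = (s - t) *\<^sub>R (q - p)" unfolding st(3,4) by (simp add: algebra_simps)
    then have "norm (x - y) = \<bar>s - t\<bar> * dist p q" by (simp add: dist_norm norm_minus_commute)
    also have "\<bar>s - t\<bar> \<le> 1 / N" using st(1,2) by (auto simp: add_divide_distrib)
    finally show "norm (x - y) \<le> dist p q / N" by (simp add: mult_right_mono)
  qed simp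
  have "closed_segment p q \<subseteq> (\<Union>i. C i)"
  proof
    fix x assume "x \<in> closed_segment p q"
    then obtain s where s: "0 \<le> s" "s \<le> 1" "x = (1 - s) *\<^sub>R p + s *\<^sub>R q" by (auto simp: in_segment)
    \<comment> \<open>the minimum puts the end point \<open>s = 1\<close> into the last piece\<close>
    define i where "i = min (nat \<lfloor>s * N\<rfloor>) n"
    have sN: "0 \<le> s * N" "s * N \<le> real n + 1"
    proof -
      have "s * real N \<le> real N" using s by (intro mult_left_le_one_le) auto
      also have "real N = real n + 1" by (simp add: N_def)
      finally show "s * N \<le> real n + 1" .
    qed (use s in simp)
    have "real i \<le> s * N" "s * N \<le> real i + 1"
      using of_nat_floor[OF sN(1)] sN by (cases "nat \<lfloor>s * N\<rfloor> \<le> n"; simp add: i_def; linarith)+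
    then have "s \<in> {real i / N..(real i + 1) / N}" using N(2) by (simp add: field_simps)
    moreover have "i < N" by (simp add: i_def N_def)
    ultimately have "x \<in> C i" using s(3) by (simp add: C_def)
    then show "x \<in> (\<Union>i. C i)" by blast
  qed
  moreover have "bounded (C i)" for i
    unfolding C_def by (auto intro!: compact_imp_bounded compact_continuous_image continuous_intros)
  ultimately have "C \<in> {C. closed_segment p q \<subseteq> (\<Union>i. C i) \<and> (\<forall>i. bounded (C i) \<and> diameter (C i) \<le> \<delta>)}"
    using diam N(1) order_trans by blast
  moreover have "(\<Sum>i. ennreal (diameter (C i))) \<le> ennreal (dist p q)"
  proof -
    have "(\<Sum>i. ennreal (diameter (C i))) = (\<Sum>i<N. ennreal (diameter (C i)))"
      by (intro suminf_finite) (auto simp: C_def)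
    also have "\<dots> \<le> (\<Sum>i<N. ennreal (dist p q / N))"
      by (intro sum_mono ennreal_leI diam)
    also have "\<dots> = ennreal (dist p q)"
      using N(2) by (simp add: sum_ennreal ennreal_of_nat_eq_real_of_nat flip: ennreal_mult')
    finally show ?thesis .
  qed
  ultimately show "(INF C\<in>{C. closed_segment p q \<subseteq> (\<Union>i. C i) \<and> (\<forall>i. bounded (C i) \<and> diameter (C i) \<le> \<delta>)}.
      \<Sum>i. ennreal (diameter (C i))) \<le> ennreal (dist p q)"
    by (rule INF_lower2[of C])
qed

lemma hausdorff_measure1_segment:
  fixes p q :: "'a::euclidean_space"
  shows "hausdorff_measure1 (closed_segment p q) = ennreal (dist p q)"
  using hausdorff_measure1_segment_ge hausdorff_measure1_segment_le by (rule antisym[rotated])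

lemma line_section:
  assumes E: "compact E" "convex E" and v: "norm v = 1" and ne: "E \<inter> normal_line v x \<noteq> {}"
  obtains a b where "a \<le> b" "hausdorff_measure1 (E \<inter> normal_line v x) = ennreal (b - a)"
    "\<And>t. x + t *\<^sub>R v \<in> E \<longleftrightarrow> a \<le> t \<and> t \<le> b"
proof -
  have vv: "v \<bullet> v = 1" using v by (simp add: dot_square_norm)
  have line: "y \<in> normal_line v x \<longleftrightarrow> x + ((y - x) \<bullet> v) *\<^sub>R v = y" for y
  proof
    assume "y \<in> normal_line v x"
    then obtain t where "y = x + t *\<^sub>R v" by (auto simp: normal_line_def)
    then show "x + ((y - x) \<bullet> v) *\<^sub>R v = y" using vv by simp
  next
    assume "x + ((y - x) \<bullet> v) *\<^sub>R v = y"
    then show "y \<in> normal_line v x" unfolding normal_line_def by (intro CollectI exI[of _ "(y - x) \<bullet> v"]) simp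
  qed
  let ?L = "E \<inter> normal_line v x"
  have "closed (normal_line v x)"
  proof -
    have "normal_line v x = {y. x + ((y - x) \<bullet> v) *\<^sub>R v = y}" using line by blast
    then show ?thesis by (simp add: closed_Collect_eq continuous_intros)
  qed
  then have L: "compact ?L" by (rule compact_Int_closed[OF E(1)])
  have cont: "continuous_on ?L (\<lambda>y. (y - x) \<bullet> v)" by (intro continuous_intros)
  obtain p where p: "p \<in> ?L" "\<And>y. y \<in> ?L \<Longrightarrow> (p - x) \<bullet> v \<le> (y - x) \<bullet> v"
    using continuous_attains_inf[OF L ne cont] by blast
  obtain q where q: "q \<in> ?L" "\<And>y. y \<in> ?L \<Longrightarrow> (y - x) \<bullet> v \<le> (q - x) \<bullet> v"
    using continuous_attains_sup[OF L ne cont] by blast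
  define a where "a = (p - x) \<bullet> v"
  define b where "b = (q - x) \<bullet> v"
  have pq: "x + a *\<^sub>R v = p" "x + b *\<^sub>R v = q" using p(1) q(1) line by (auto simp: a_def b_def)
  have "a \<le> b" using p(2)[OF q(1)] by (simp add: a_def b_def)
  have on_line: "x + t *\<^sub>R v \<in> normal_line v x" for t by (auto simp: normal_line_def)
  have sub: "closed_segment p q \<subseteq> E" using p(1) q(1) E(2) by (simp add: closed_segment_subset)
  have seg: "x + t *\<^sub>R v \<in> closed_segment p q" if t: "a \<le> t" "t \<le> b" for t
  proof (cases "a = b")
    case True
    then show ?thesis using t pq by auto
  next
    case False
    define s where "s = (t - a) / (b - a)"
    have "s * (b - a) = t - a" using False by (simp add: s_def)
    then have t_eq: "t = (1 - s) * a + s * b" by (simp add: algebra_simps)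
    have "x + t *\<^sub>R v = (1 - s) *\<^sub>R p + s *\<^sub>R q"
      unfolding pq[symmetric] t_eq by (simp add: algebra_simps)
    moreover have "0 \<le> s" "s \<le> 1" using t False by (auto simp: s_def)
    ultimately show ?thesis by (auto simp: in_segment)
  qed
  have iff: "x + t *\<^sub>R v \<in> E \<longleftrightarrow> a \<le> t \<and> t \<le> b" for t
  proof
    assume "x + t *\<^sub>R v \<in> E"
    then show "a \<le> t \<and> t \<le> b" using p(2)[of "x + t *\<^sub>R v"] q(2)[of "x + t *\<^sub>R v"] on_line vv
      by (simp add: a_def b_def)
  qed (use seg sub in blast)
  have "?L = closed_segment (x + a *\<^sub>R v) (x + b *\<^sub>R v)"
    unfolding pq
  proof
    show "?L \<subseteq> closed_segment p q"
      using seg iff by (auto simp: normal_line_def)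
    have "closed_segment p q \<subseteq> normal_line v x"
    proof
      fix y assume "y \<in> closed_segment p q"
      then obtain s where "y = (1 - s) *\<^sub>R (x + a *\<^sub>R v) + s *\<^sub>R (x + b *\<^sub>R v)"
        unfolding pq by (auto simp: in_segment)
      then have "y = x + ((1 - s) * a + s * b) *\<^sub>R v" by (simp add: algebra_simps)
      then show "y \<in> normal_line v x" using on_line by simp
    qed
    then show "closed_segment p q \<subseteq> ?L" using sub by blast
  qed
  moreover have "x + a *\<^sub>R v - (x + b *\<^sub>R v) = (a - b) *\<^sub>R v" by (simp add: algebra_simps)
  then have "dist (x + a *\<^sub>R v) (x + b *\<^sub>R v) = b - a"
    using \<open>a \<le> b\<close> v by (simp only: dist_norm norm_scaleR) simp
  ultimately show thesis using that[OF \<open>a \<le> b\<close> _ iff] by (simp add: hausdorff_measure1_segment)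
qed

text \<open>On convex sets the length condition means that the line contains two points of \<open>E\<close> at the prescribed
  distance, which turns the symmetrization into an algebraic condition.\<close>

lemma mem_steiner_iff:
  assumes E: "compact E" "convex E" and v: "norm v = 1"
  shows "z \<in> steiner v E \<longleftrightarrow>
    (\<exists>s. z - (z \<bullet> v) *\<^sub>R v + s *\<^sub>R v \<in> E \<and> z - (z \<bullet> v) *\<^sub>R v + (s + 2 * \<bar>z \<bullet> v\<bar>) *\<^sub>R v \<in> E)"
    (is "_ \<longleftrightarrow> ?R")
proof
  have vv: "v \<bullet> v = 1" using v by (simp add: dot_square_norm)
  assume "z \<in> steiner v E"
  then obtain x r where x: "x \<bullet> v = 0" "normal_line v x \<inter> E \<noteq> {}" "z = x + r *\<^sub>R v"
    and r: "ennreal (2 * \<bar>r\<bar>) \<le> hausdorff_measure1 (E \<inter> normal_line v x)"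
    unfolding steiner_def by blast
  have zv: "z \<bullet> v = r" "z - r *\<^sub>R v = x" using x vv by (simp_all add: inner_add_left)
  obtain a b where ab: "a \<le> b" "hausdorff_measure1 (E \<inter> normal_line v x) = ennreal (b - a)"
    "\<And>t. x + t *\<^sub>R v \<in> E \<longleftrightarrow> a \<le> t \<and> t \<le> b"
    using line_section[OF E v] x(2) by (metis inf_commute)
  have "2 * \<bar>r\<bar> \<le> b - a"
    using r ab(1) unfolding ab(2) by simp
  then show ?R unfolding zv ab(3) using ab(1) by (intro exI[of _ a]) auto
next
  have vv: "v \<bullet> v = 1" using v by (simp add: dot_square_norm)
  define x where "x = z - (z \<bullet> v) *\<^sub>R v"
  assume ?R
  then obtain s where s: "x + s *\<^sub>R v \<in> E" "x + (s + 2 * \<bar>z \<bullet> v\<bar>) *\<^sub>R v \<in> E" by (auto simp: x_def)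
  have ne: "E \<inter> normal_line v x \<noteq> {}" using s(1) by (auto simp: normal_line_def)
  obtain a b where ab: "a \<le> b" "hausdorff_measure1 (E \<inter> normal_line v x) = ennreal (b - a)"
    "\<And>t. x + t *\<^sub>R v \<in> E \<longleftrightarrow> a \<le> t \<and> t \<le> b"
    using line_section[OF E v ne] by metis
  have "ennreal (2 * \<bar>z \<bullet> v\<bar>) \<le> hausdorff_measure1 (E \<inter> normal_line v x)"
    using s ab(1) unfolding ab(2,3) by (intro ennreal_leI) simp
  moreover have "x \<bullet> v = 0" "z = x + (z \<bullet> v) *\<^sub>R v" using vv by (simp_all add: x_def inner_diff_left)
  ultimately show "z \<in> steiner v E"
    unfolding steiner_def using ne by blast
qed

lemma mem_translation_iff:
  fixes c :: "'a::ab_group_add"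
  shows "z \<in> (+) c ` S \<longleftrightarrow> z - c \<in> S"
  by (metis (no_types, lifting) add_diff_cancel_left' diff_add_cancel add.commute image_iff)

lemma steiner_translation:
  assumes E: "compact E" "convex E" and v: "norm v = 1"
  shows "steiner v ((+) a ` E) = (+) (a - (a \<bullet> v) *\<^sub>R v) ` steiner v E"
proof -
  have vv: "v \<bullet> v = 1" using v by (simp add: dot_square_norm)
  let ?a = "a - (a \<bullet> v) *\<^sub>R v"
  have a_v: "?a \<bullet> v = 0" using vv by (simp add: inner_diff_left)
  have E': "compact ((+) a ` E)" "convex ((+) a ` E)"
    using E by (simp_all add: compact_translation convex_translation_eq)
  have "z \<in> steiner v ((+) a ` E) \<longleftrightarrow> z - ?a \<in> steiner v E" for z
  proof -
    have zv: "(z - ?a) \<bullet> v = z \<bullet> v" using a_v by (simp add: inner_diff_left)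
    have shift: "z - (z \<bullet> v) *\<^sub>R v + s *\<^sub>R v - a = z - ?a - (z \<bullet> v) *\<^sub>R v + (s - a \<bullet> v) *\<^sub>R v" for s
      by (simp add: algebra_simps)
    have "z \<in> steiner v ((+) a ` E) \<longleftrightarrow> (\<exists>s. z - ?a - (z \<bullet> v) *\<^sub>R v + (s - a \<bullet> v) *\<^sub>R v \<in> E \<and>
        z - ?a - (z \<bullet> v) *\<^sub>R v + (s + 2 * \<bar>z \<bullet> v\<bar> - a \<bullet> v) *\<^sub>R v \<in> E)"
      unfolding mem_steiner_iff[OF E' v] mem_translation_iff shift ..
    also have "\<dots> \<longleftrightarrow> (\<exists>s. z - ?a - (z \<bullet> v) *\<^sub>R v + s *\<^sub>R v \<in> E \<and>
        z - ?a - (z \<bullet> v) *\<^sub>R v + (s + 2 * \<bar>z \<bullet> v\<bar>) *\<^sub>R v \<in> E)"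
    proof -
      let ?Q = "\<lambda>s. z - ?a - (z \<bullet> v) *\<^sub>R v + s *\<^sub>R v \<in> E \<and> z - ?a - (z \<bullet> v) *\<^sub>R v + (s + 2 * \<bar>z \<bullet> v\<bar>) *\<^sub>R v \<in> E"
      have "s + 2 * \<bar>z \<bullet> v\<bar> - a \<bullet> v = (s - a \<bullet> v) + 2 * \<bar>z \<bullet> v\<bar>" for s by simp
      moreover have "(\<exists>s. ?Q (s - a \<bullet> v)) \<longleftrightarrow> (\<exists>s. ?Q s)" by (metis add_diff_cancel)
      ultimately show ?thesis by (simp only:)
    qed
    finally show ?thesis unfolding mem_steiner_iff[OF E v] zv .
  qed
  then show ?thesis using mem_translation_iff by blast
qed

lemma steiner_of_symmetric:
  assumes E: "compact E" "convex E" and v: "norm v = 1"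
    and sym: "\<And>x. x \<in> E \<Longrightarrow> x - (2 * (x \<bullet> v)) *\<^sub>R v \<in> E"
  shows "steiner v E = E"
proof -
  have vv: "v \<bullet> v = 1" using v by (simp add: dot_square_norm)
  have "z \<in> steiner v E \<longleftrightarrow> z \<in> E" for z
  proof -
    define x where "x = z - (z \<bullet> v) *\<^sub>R v"
    have xv: "x \<bullet> v = 0" using vv by (simp add: x_def inner_diff_left)
    have z: "z = x + (z \<bullet> v) *\<^sub>R v" by (simp add: x_def)
    have flip: "x + (- t) *\<^sub>R v \<in> E" if "x + t *\<^sub>R v \<in> E" for t
    proof -
      have eq: "x + t *\<^sub>R v - (2 * ((x + t *\<^sub>R v) \<bullet> v)) *\<^sub>R v = x + (- t) *\<^sub>R v"
      proof -
        have "(x + t *\<^sub>R v) \<bullet> v = t" using xv vv by (simp add: inner_add_left)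
        moreover have "x + t *\<^sub>R v - (2 * t) *\<^sub>R v = x + (t - 2 * t) *\<^sub>R v"
          by (simp only: scaleR_diff_left) simp
        ultimately show ?thesis by simp
      qed
      show ?thesis using sym[OF that] unfolding eq .
    qed
    have "z \<in> E \<longleftrightarrow> (\<exists>s. x + s *\<^sub>R v \<in> E \<and> x + (s + 2 * \<bar>z \<bullet> v\<bar>) *\<^sub>R v \<in> E)"
    proof
      assume "z \<in> E"
      then have "x + \<bar>z \<bullet> v\<bar> *\<^sub>R v \<in> E" "x + (- \<bar>z \<bullet> v\<bar>) *\<^sub>R v \<in> E"
        using z flip[of "z \<bullet> v"] by (cases "z \<bullet> v \<ge> 0"; simp)+
      moreover have "- \<bar>z \<bullet> v\<bar> + 2 * \<bar>z \<bullet> v\<bar> = \<bar>z \<bullet> v\<bar>" by simp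
      ultimately show "\<exists>s. x + s *\<^sub>R v \<in> E \<and> x + (s + 2 * \<bar>z \<bullet> v\<bar>) *\<^sub>R v \<in> E" by metis
    next
      assume "\<exists>s. x + s *\<^sub>R v \<in> E \<and> x + (s + 2 * \<bar>z \<bullet> v\<bar>) *\<^sub>R v \<in> E"
      then obtain s where s: "x + s *\<^sub>R v \<in> E" "x + (s + 2 * \<bar>z \<bullet> v\<bar>) *\<^sub>R v \<in> E" by blast
      have "(1/2) *\<^sub>R (x + (- s) *\<^sub>R v) + (1/2) *\<^sub>R (x + (s + 2 * \<bar>z \<bullet> v\<bar>) *\<^sub>R v) \<in> E"
        using flip[OF s(1)] s(2) E(2) by (intro convexD) auto
      also have "(1/2) *\<^sub>R (x + (- s) *\<^sub>R v) + (1/2) *\<^sub>R (x + (s + 2 * \<bar>z \<bullet> v\<bar>) *\<^sub>R v) = x + \<bar>z \<bullet> v\<bar> *\<^sub>R v"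
        by (simp add: vec_eq_iff algebra_simps)
      finally show "z \<in> E" using flip[of "\<bar>z \<bullet> v\<bar>"] z by (cases "z \<bullet> v \<ge> 0") auto
    qed
    then show ?thesis unfolding mem_steiner_iff[OF E v] x_def by blast
  qed
  then show ?thesis by blast
qed

section \<open>Symmetrization along a short diagonal\<close>

text \<open>The length of the chord at height \<open>y\<close> does not depend on \<open>b\<close>, only its midpoint does.\<close>

lemma hexagon_chord_iff:
  assumes k: "1 \<le> k" "\<bar>b\<bar> \<le> 1"
  shows "(\<exists>\<sigma>. hex_coords b k \<sigma> y \<and> hex_coords b k (\<sigma> + 2 * \<bar>x\<bar>) y) \<longleftrightarrow> hex_coords 0 k x y"
proof
  assume "\<exists>\<sigma>. hex_coords b k \<sigma> y \<and> hex_coords b k (\<sigma> + 2 * \<bar>x\<bar>) y"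
  then obtain \<sigma> where \<sigma>: "hex_coords b k \<sigma> y" "hex_coords b k (\<sigma> + 2 * \<bar>x\<bar>) y" by blast
  have \<sigma>1: "\<bar>\<sigma>\<bar> \<le> 1" "\<bar>\<sigma> + 2 * \<bar>x\<bar>\<bar> \<le> 1"
    using \<sigma> unfolding hex_coords_def by blast+
  have \<sigma>2: "(k - 1) * (\<sigma> + 2 * \<bar>x\<bar>) + (1 - b) * y \<le> k - b" "- ((k - 1) * \<sigma> - (1 + b) * y) \<le> k + b"
      "(k - 1) * (\<sigma> + 2 * \<bar>x\<bar>) - (1 + b) * y \<le> k + b" "- ((k - 1) * \<sigma> + (1 - b) * y) \<le> k - b"
    using \<sigma> unfolding hex_coords_def abs_le_iff by blast+
  have "\<bar>x\<bar> \<le> 1" using \<sigma>1 by linarith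
  moreover have "(k - 1) * \<bar>x\<bar> + y \<le> k" "(k - 1) * \<bar>x\<bar> - y \<le> k"
    using \<sigma>2 by (simp_all add: algebra_simps)
  then have "(k - 1) * \<bar>x\<bar> + \<bar>y\<bar> \<le> k" by linarith
  then have "\<bar>(k - 1) * x\<bar> + \<bar>y\<bar> \<le> k" using k by (simp add: abs_mult)
  moreover from this have "\<bar>(k - 1) * x + y\<bar> \<le> k" "\<bar>(k - 1) * x - y\<bar> \<le> k"
    using abs_triangle_ineq[of "(k - 1) * x" y] abs_triangle_ineq4[of "(k - 1) * x" y] by linarith+
  ultimately show "hex_coords 0 k x y" by (simp add: hex_coords_def)
next
  assume "hex_coords 0 k x y"
  then have x: "\<bar>x\<bar> \<le> 1" and "\<bar>(k - 1) * x\<bar> + \<bar>y\<bar> \<le> k" by (auto simp: hex_coords_def)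
  then have xy: "(k - 1) * \<bar>x\<bar> + \<bar>y\<bar> \<le> k" using k by (simp add: abs_mult)
  have kx: "0 \<le> (k - 1) * \<bar>x\<bar>" "(k - 1) * \<bar>x\<bar> \<le> k - 1" using k x by (simp_all add: mult_left_le)
  have suff: "hex_coords b k (c - \<bar>x\<bar>) y \<and> hex_coords b k (c - \<bar>x\<bar> + 2 * \<bar>x\<bar>) y"
    if "\<bar>c\<bar> + \<bar>x\<bar> \<le> 1" "(k - 1) * \<bar>x\<bar> + \<bar>(k - 1) * c + (1 - b) * y\<bar> \<le> k - b"
      "(k - 1) * \<bar>x\<bar> + \<bar>(k - 1) * c - (1 + b) * y\<bar> \<le> k + b" for c
  proof -
    have e: "(k - 1) * (c - \<bar>x\<bar>) = (k - 1) * c - (k - 1) * \<bar>x\<bar>"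
      "(k - 1) * (c - \<bar>x\<bar> + 2 * \<bar>x\<bar>) = (k - 1) * c + (k - 1) * \<bar>x\<bar>" by algebra+
    show ?thesis
      unfolding hex_coords_def e using that kx(1) by (intro conjI; linarith)
  qed
  \<comment> \<open>the midpoint of the chord is 0 in the central strip and moves linearly towards the apex outside\<close>
  show "\<exists>\<sigma>. hex_coords b k \<sigma> y \<and> hex_coords b k (\<sigma> + 2 * \<bar>x\<bar>) y"
  proof (cases "\<bar>y\<bar> \<le> 1")
    case True
    have "\<bar>(1 - b) * y\<bar> \<le> 1 - b" "\<bar>(1 + b) * y\<bar> \<le> 1 + b"
      using True k by (simp_all add: abs_mult mult_left_le)
    then show ?thesis using suff[of 0] x kx by (intro exI) auto
  next
    case False
    then have "k > 1" using xy kx by linarith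
    define \<tau> where "\<tau> = (\<bar>y\<bar> - 1) / (k - 1)"
    have \<tau>: "(k - 1) * \<tau> = \<bar>y\<bar> - 1" using \<open>k > 1\<close> by (simp add: \<tau>_def)
    have "(k - 1) * (\<tau> + \<bar>x\<bar>) \<le> (k - 1) * 1" using \<tau> xy by (simp add: algebra_simps)
    then have \<tau>x: "\<tau> + \<bar>x\<bar> \<le> 1" using \<open>k > 1\<close> by simp
    have "\<tau> \<ge> 0" using False \<open>k > 1\<close> by (simp add: \<tau>_def)
    have b\<tau>: "\<bar>b * \<tau>\<bar> \<le> \<tau>" using k \<open>\<tau> \<ge> 0\<close> by (simp add: abs_mult mult_left_le_one_le)
    show ?thesis
    proof (cases "y \<ge> 0")
      case True
      have "(k - 1) * (b * \<tau>) = b * (y - 1)" using \<tau> True by (simp add: mult.left_commute)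
      then have e: "(k - 1) * (b * \<tau>) + (1 - b) * y = y - b" "(k - 1) * (b * \<tau>) - (1 + b) * y = - (y + b)"
        by (simp_all add: algebra_simps)
      show ?thesis
        using suff[of "b * \<tau>", unfolded e] \<tau>x b\<tau> xy True False k by (intro exI) auto
    next
      case y: False
      have "(k - 1) * (- b * \<tau>) = - b * ((k - 1) * \<tau>)" by simp
      also have "\<dots> = b * (y + 1)" unfolding \<tau> using y by (simp add: algebra_simps)
      finally have h: "(k - 1) * (- b * \<tau>) = b * (y + 1)" .
      have e: "(k - 1) * (- b * \<tau>) + (1 - b) * y = y + b" "(k - 1) * (- b * \<tau>) - (1 + b) * y = - y + b"
        unfolding h by (simp_all add: algebra_simps)
      show ?thesis
        using suff[of "- b * \<tau>", unfolded e] \<tau>x b\<tau> xy y False k by (intro exI) auto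
    qed
  qed
qed

definition orthogonal_part :: "real^2 \<Rightarrow> real^2 \<Rightarrow> real^2" where
  "orthogonal_part D M = M - ((M \<bullet> D) / (D \<bullet> D)) *\<^sub>R D"

lemma orthogonal_part_orthogonal: "orthogonal_part D M \<bullet> D = 0"
  by (cases "D = 0") (simp_all add: orthogonal_part_def inner_diff_left)

lemma cross2_orthogonal_part: "cross2 D (orthogonal_part D M) = cross2 D M"
  by (simp add: orthogonal_part_def cross2_def algebra_simps)

text \<open>Symmetrizing along \<open>D\<close> centres all chords: the apex moves to the axis, so that \<open>b\<close> becomes \<open>0\<close>, and \<open>M\<close>
  loses its component along \<open>D\<close>.\<close>

lemma steiner_hexagon:
  assumes D: "cross2 D M \<noteq> 0" and k: "1 \<le> k" "\<bar>b\<bar> \<le> 1"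
  shows "steiner (D /\<^sub>R norm D) (hexagon D M b k) = hexagon D (orthogonal_part D M) 0 k"
proof -
  define E where "E = orthogonal_part D M"
  have ED: "E \<bullet> D = 0" and cE: "cross2 D E \<noteq> 0"
    using D by (simp_all add: E_def orthogonal_part_orthogonal cross2_orthogonal_part)
  have "D \<noteq> 0" using D by (auto simp: cross2_def)
  define v where "v = D /\<^sub>R norm D"
  have v: "norm v = 1" using \<open>D \<noteq> 0\<close> by (simp add: v_def)
  define m where "m = (M \<bullet> D) / (D \<bullet> D)"
  have E_eq: "E = M - m *\<^sub>R D" by (simp add: E_def orthogonal_part_def m_def)
  have "z \<in> steiner v (hexagon D M b k) \<longleftrightarrow> z \<in> hexagon D E 0 k" for z
  proof -
    obtain x y where z: "z = x *\<^sub>R D + y *\<^sub>R E" using coordinates_cross2[OF cE] by blast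
    have zv: "z \<bullet> v = x * norm D"
      using ED \<open>D \<noteq> 0\<close> by (simp add: z v_def inner_add_left dot_square_norm power2_eq_square)
    have base: "z - (x * norm D) *\<^sub>R v = y *\<^sub>R E"
      using \<open>D \<noteq> 0\<close> by (simp add: z v_def)
    have line: "y *\<^sub>R E + s *\<^sub>R v = (s / norm D - y * m) *\<^sub>R D + y *\<^sub>R M" for s
      by (simp add: E_eq v_def algebra_simps divide_inverse_commute)
    have "z \<in> steiner v (hexagon D M b k) \<longleftrightarrow>
        (\<exists>s. hex_coords b k (s / norm D - y * m) y \<and> hex_coords b k ((s + 2 * \<bar>x * norm D\<bar>) / norm D - y * m) y)"
      unfolding mem_steiner_iff[OF compact_hexagon[OF k] convex_hexagon v] zv base line mem_hexagon_iff[OF D] ..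
    also have "\<dots> \<longleftrightarrow> (\<exists>\<sigma>. hex_coords b k \<sigma> y \<and> hex_coords b k (\<sigma> + 2 * \<bar>x\<bar>) y)"
    proof -
      have "(s + 2 * \<bar>x * norm D\<bar>) / norm D - y * m = (s / norm D - y * m) + 2 * \<bar>x\<bar>" for s
        using \<open>D \<noteq> 0\<close> by (simp add: abs_mult add_divide_distrib)
      moreover have "\<exists>s. \<sigma> = s / norm D - y * m" for \<sigma>
        using \<open>D \<noteq> 0\<close> by (intro exI[of _ "(\<sigma> + y * m) * norm D"]) simp
      ultimately show ?thesis by metis
    qed
    also have "\<dots> \<longleftrightarrow> hex_coords 0 k x y" by (rule hexagon_chord_iff[OF k])
    also have "\<dots> \<longleftrightarrow> z \<in> hexagon D E 0 k" unfolding z mem_hexagon_iff[OF cE] ..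
    finally show ?thesis .
  qed
  then show ?thesis unfolding v_def E_def by blast
qed

section \<open>Area\<close>

lemma dual_basis:
  assumes "cross2 D M \<noteq> 0"
  obtains f g where "f \<bullet> D = 1" "f \<bullet> M = 0" "g \<bullet> D = 0" "g \<bullet> M = 1"
proof (rule that)
  let ?f = "(1 / cross2 D M) *\<^sub>R vector [M$2, - M$1] :: real^2"
  let ?g = "(1 / cross2 D M) *\<^sub>R vector [- D$2, D$1] :: real^2"
  show "?f \<bullet> D = 1" "?f \<bullet> M = 0" "?g \<bullet> D = 0" "?g \<bullet> M = 1"
    using assms by (simp_all add: inner_real2 cross2_def divide_simps)
qed

lemma measure_triangle:
  fixes A B C :: "real^2"
  shows "measure lebesgue (convex hull {A, B, C}) = \<bar>cross2 (B - A) (C - A)\<bar> / 2"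
proof -
  have "compact (convex hull {A, B, C})" by (intro finite_imp_compact_convex_hull) simp
  then have "measure lebesgue (convex hull {A, B, C}) = measure lborel (convex hull {A, B, C})"
    by (intro measure_completion) (auto dest: compact_imp_closed)
  then show ?thesis
    unfolding content_triangle cross2_def by (simp add: abs_minus_commute mult.commute)
qed

lemma measure_parallelogram: "measure lebesgue (hexagon D M 0 1) = 4 * \<bar>cross2 D M\<bar>"
proof -
  define f where "f = (\<lambda>z::real^2. z$1 *\<^sub>R D + z$2 *\<^sub>R M)"
  have lin: "linear f" unfolding f_def
    by (intro linearI) (simp_all add: algebra_simps)
  have "hexagon D M 0 1 = f ` cbox (- 1) 1"
  proof -
    have "z \<in> cbox (- 1) 1 \<longleftrightarrow> hex_coords 0 1 (z$1) (z$2)" for z :: "real^2"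
      by (auto simp: mem_box_cart forall_2 hex_coords_def abs_le_iff)
    moreover have "\<exists>z::real^2. z$1 = x \<and> z$2 = y" for x y
      by (intro exI[of _ "vector [x, y]"]) simp
    ultimately show ?thesis unfolding hexagon_def f_def
      by (auto simp: image_iff) metis
  qed
  moreover have "measure lebesgue (cbox (- 1) (1::real^2)) = 4"
  proof -
    have "(0::real^2) \<in> cbox (- 1) 1" by (simp add: mem_box_cart)
    then have "cbox (- 1) (1::real^2) \<noteq> {}" by blast
    then show ?thesis by (simp add: content_cbox_cart prod_2)
  qed
  moreover have "det (matrix f) = cross2 D M"
    by (simp add: det_2 matrix_def f_def cross2_def axis_def algebra_simps)
  ultimately show ?thesis
    using measure_linear_image[OF lin, of "cbox (- 1) 1"] by simp
qed

text \<open>A parallelogram with two triangles attached to a pair of opposite sides.\<close>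

lemma measure_hexagon:
  assumes D: "cross2 D M \<noteq> 0" and k: "1 \<le> k" "\<bar>b\<bar> \<le> 1"
  shows "measure lebesgue (hexagon D M b k) = 2 * (1 + k) * \<bar>cross2 D M\<bar>"
proof -
  obtain g where g: "g \<bullet> D = 0" "g \<bullet> M = 1" using dual_basis[OF D] by blast
  then have "g \<noteq> 0" by auto
  let ?A = "b *\<^sub>R D + k *\<^sub>R M"
  define mid where "mid = hexagon D M 0 1"
  define up where "up = convex hull {D + M, M - D, ?A}"
  define low where "low = convex hull {- D - M, D - M, - ?A}"
  have "hexagon D M b k = mid \<union> up \<union> low"
  proof
    show "hexagon D M b k \<subseteq> mid \<union> up \<union> low"
    proof
      fix z assume "z \<in> hexagon D M b k"
      then obtain x y where z: "z = x *\<^sub>R D + y *\<^sub>R M" and xy: "hex_coords b k x y" by (auto simp: hexagon_def)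
      consider "\<bar>y\<bar> \<le> 1" | "y \<ge> 1" | "- y \<ge> 1" by linarith
      then show "z \<in> mid \<union> up \<union> low"
      proof cases
        case 1
        then have "hex_coords 0 1 x y" using xy by (simp add: hex_coords_def)
        then show ?thesis using z by (auto simp: mid_def hexagon_def)
      next
        case 2
        then have "z \<in> up" unfolding z up_def
          by (intro hexagon_cap_subset_convex[OF convex_convex_hull _ _ _ k(1) xy]) (auto intro: hull_inc)
        then show ?thesis by blast
      next
        case 3
        have xy': "hex_coords b k (- x) (- y)"
          using xy by (rule hex_coords_minus)
        have eq: "z = (- x) *\<^sub>R (- D) + (- y) *\<^sub>R (- M)" by (simp add: z)
        have "z \<in> low" unfolding eq low_def
          by (intro hexagon_cap_subset_convex[OF convex_convex_hull _ _ _ k(1) xy' 3]) (auto intro!: hull_inc)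
        then show ?thesis by blast
      qed
    qed
    have V: "{D + M, M - D, - D - M, D - M, ?A, - ?A} \<subseteq> hexagon D M b k"
      unfolding hexagon_eq_hull[OF k] by (rule hull_subset)
    have comb: "(1/2) *\<^sub>R v + (1/2) *\<^sub>R w \<in> hexagon D M b k" if "v \<in> hexagon D M b k" "w \<in> hexagon D M b k" for v w
      using convex_hexagon that by (intro convexD) auto
    have "(1/2) *\<^sub>R (D + M) + (1/2) *\<^sub>R (M - D) \<in> hexagon D M b k"
      "(1/2) *\<^sub>R (- D - M) + (1/2) *\<^sub>R (D - M) \<in> hexagon D M b k"
      using V by (auto intro!: comb)
    moreover have "(1/2) *\<^sub>R (D + M) + (1/2) *\<^sub>R (M - D) = 0 *\<^sub>R D + 1 *\<^sub>R M"
      "(1/2) *\<^sub>R (- D - M) + (1/2) *\<^sub>R (D - M) = - (0 *\<^sub>R D + 1 *\<^sub>R M)"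
      by (simp_all add: vec_eq_iff algebra_simps)
    ultimately have "mid \<subseteq> hexagon D M b k"
      unfolding mid_def using V by (intro hexagon_subset_convex[OF convex_hexagon]) auto
    moreover have "up \<subseteq> hexagon D M b k" "low \<subseteq> hexagon D M b k"
      unfolding up_def low_def
      by (rule hull_minimal; use V in \<open>simp add: convex_hexagon\<close>)+
    ultimately show "mid \<union> up \<union> low \<subseteq> hexagon D M b k" by blast
  qed
  moreover have meas: "mid \<in> lmeasurable" "up \<in> lmeasurable" "low \<in> lmeasurable"
    unfolding mid_def up_def low_def
    by (auto intro!: lmeasurable_compact compact_hexagon finite_imp_compact_convex_hull)
  moreover have mid_g: "mid \<subseteq> {z. \<bar>g \<bullet> z\<bar> \<le> 1}"
    using g by (auto simp: mid_def hexagon_def hex_coords_def inner_add_right)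
  have up_g: "up \<subseteq> {z. g \<bullet> z \<ge> 1}"
    unfolding up_def using g k
    by (intro hull_minimal) (auto simp: convex_halfspace_ge inner_add_right inner_diff_right)
  have low_g: "low \<subseteq> {z. g \<bullet> z \<le> - 1}"
    unfolding low_def using g k
    by (intro hull_minimal) (auto simp: convex_halfspace_le inner_add_right inner_diff_right)
  have null: "negligible {z. g \<bullet> z = c}" for c
    using negligible_hyperplane[of g c] \<open>g \<noteq> 0\<close> by simp
  have "negligible (mid \<inter> up)"
    by (rule negligible_subset[OF null[of 1]]) (use mid_g up_g in fastforce)
  moreover have "negligible (mid \<inter> low)"
    by (rule negligible_subset[OF null[of "-1"]]) (use mid_g low_g in fastforce)
  moreover have "up \<inter> low = {}" using up_g low_g by fastforce
  then have "negligible (up \<inter> low)" by simp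
  ultimately have "measure lebesgue (hexagon D M b k) = measure lebesgue mid + measure lebesgue up + measure lebesgue low"
    by (intro measure_Un3_negligible) auto
  moreover have "measure lebesgue up = (k - 1) * \<bar>cross2 D M\<bar>"
  proof -
    have "cross2 (M - D - (D + M)) (?A - (D + M)) = - 2 * ((k - 1) * cross2 D M)"
      by (simp add: cross2_def algebra_simps)
    then show ?thesis using k unfolding up_def measure_triangle by (simp add: abs_mult)
  qed
  moreover have "measure lebesgue low = (k - 1) * \<bar>cross2 D M\<bar>"
  proof -
    have "cross2 (D - M - (- D - M)) (- ?A - (- D - M)) = - 2 * ((k - 1) * cross2 D M)"
      by (simp add: cross2_def algebra_simps)
    then show ?thesis using k unfolding low_def measure_triangle by (simp add: abs_mult)
  qed
  ultimately show ?thesis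
    by (simp add: mid_def measure_parallelogram algebra_simps)
qed

section \<open>Hexagons with two axes of symmetry tile the plane\<close>

lemma hex_coords_symmetric_iff:
  assumes "1 \<le> k"
  shows "hex_coords 0 k x y \<longleftrightarrow> \<bar>x\<bar> \<le> 1 \<and> (k - 1) * \<bar>x\<bar> + \<bar>y\<bar> \<le> k"
proof -
  have "\<bar>s + y\<bar> \<le> k \<and> \<bar>s - y\<bar> \<le> k \<longleftrightarrow> \<bar>s\<bar> + \<bar>y\<bar> \<le> k" for s :: real
    by linarith
  from this[of "(k - 1) * x"] show ?thesis
    using assms by (simp add: hex_coords_def abs_mult)
qed

lemma interior_subset_halfspace:
  fixes a :: "'a::euclidean_space"
  assumes "a \<noteq> 0" "S \<subseteq> {z. a \<bullet> z \<le> c}" "z \<in> interior S"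
  shows "a \<bullet> z < c"
  using interior_mono[OF assms(2)] assms(1,3) by auto

text \<open>The three bounds say that the lattice vector \<open>(m + n, (n - m) (k + 1))\<close> is an interior point of twice the
  hexagon with \<open>b = 0\<close>, which is its difference body; hence translates of the hexagon by different lattice
  vectors do not overlap.\<close>

lemma small_lattice_vector_zero:
  fixes m n :: int and k :: real
  assumes "1 \<le> k" "\<bar>real_of_int (m + n)\<bar> < 2" "\<bar>k * n - m\<bar> < k" "\<bar>k * m - n\<bar> < k"
  shows "m = 0 \<and> n = 0"
proof -
  have ge: "k + 1 \<le> (k + 1) * real_of_int i" if "i \<ge> 1" for i
    using mult_left_mono[of 1 "real_of_int i" "k + 1"] that assms(1) by simp
  have le: "(k + 1) * real_of_int i \<le> - (k + 1)" if "i \<le> - 1" for i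
    using mult_left_mono[of "real_of_int i" "-1" "k + 1"] that assms(1) by simp
  have "m + n = 0 \<or> m + n = 1 \<or> m + n = - 1"
    using assms(2) by linarith
  then show ?thesis
  proof (elim disjE)
    assume "m + n = 0"
    then have n: "n = - m" by simp
    then have "\<bar>(k + 1) * m\<bar> < k" using assms(4) by (simp add: algebra_simps)
    then have "\<not> m \<ge> 1" "\<not> m \<le> -1" using ge[of m] le[of m] assms(1) by linarith+
    then show ?thesis using n by simp
  next
    assume "m + n = 1"
    then have m: "m = 1 - n" by simp
    have "(k + 1) * n - 1 < k" "(k + 1) * m - 1 < k"
      using assms(3,4) unfolding m by (simp_all add: algebra_simps abs_less_iff)
    then have "\<not> n \<ge> 1" "\<not> m \<ge> 1" using ge[of n] ge[of m] by linarith+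
    then show ?thesis using m by simp
  next
    assume "m + n = - 1"
    then have m: "m = - 1 - n" by simp
    have "(k + 1) * n + 1 > - k" "(k + 1) * m + 1 > - k"
      using assms(3,4) unfolding m by (simp_all add: algebra_simps abs_less_iff)
    then have "\<not> n \<le> - 1" "\<not> m \<le> - 1" using le[of n] le[of m] by linarith+
    then show ?thesis using m by simp
  qed
qed

text \<open>The translates by multiples of \<open>2 D\<close> form a row, and the next row is shifted by \<open>D + (k + 1) E\<close>. The
  rows fit since for \<open>\<bar>x\<bar> \<le> 1\<close> the boundary heights \<open>k - (k - 1) \<bar>x\<bar>\<close> of one row and
  \<open>(k + 1) - (k - (k - 1) (1 - \<bar>x\<bar>))\<close> of the next one agree.\<close>

lemma tessellates_hexagon:
  assumes D: "cross2 D E \<noteq> 0" and k: "1 \<le> k"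
  shows "tessellates_by_translations (hexagon D E 0 k)"
proof -
  let ?H = "hexagon D E 0 k"
  define \<Lambda> where "\<Lambda> i j = real_of_int (2 * i + j) *\<^sub>R D + (real_of_int j * (k + 1)) *\<^sub>R E" for i j
  have "\<exists>i j. z \<in> (+) (\<Lambda> i j) ` ?H" for z
  proof -
    obtain x y where z: "z = x *\<^sub>R D + y *\<^sub>R E" using coordinates_cross2[OF D] by blast
    have crit: "z \<in> (+) (\<Lambda> i j) ` ?H" if "hex_coords 0 k (x - real_of_int (2 * i + j)) (y - real_of_int j * (k + 1))" for i j
    proof -
      have "z - \<Lambda> i j = (x - real_of_int (2 * i + j)) *\<^sub>R D + (y - real_of_int j * (k + 1)) *\<^sub>R E"
        unfolding z \<Lambda>_def by (simp add: algebra_simps)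
      then show ?thesis unfolding mem_translation_iff using that mem_hexagon_iff[OF D] by simp
    qed
    define j where "j = \<lfloor>y / (k + 1)\<rfloor>"
    define y' where "y' = y - real_of_int j * (k + 1)"
    have y': "0 \<le> y'" "y' < k + 1"
    proof -
      have "real_of_int j \<le> y / (k + 1)" "y / (k + 1) < real_of_int j + 1"
        unfolding j_def by linarith+
      then show "0 \<le> y'" "y' < k + 1" using k by (simp_all add: y'_def field_simps)
    qed
    define i where "i = \<lfloor>(x - real_of_int j + 1) / 2\<rfloor>"
    define x' where "x' = x - real_of_int (2 * i + j)"
    have x': "- 1 \<le> x'" "x' < 1"
    proof -
      have "real_of_int i \<le> (x - real_of_int j + 1) / 2" "(x - real_of_int j + 1) / 2 < real_of_int i + 1"
        unfolding i_def by linarith+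
      then show "- 1 \<le> x'" "x' < 1" unfolding x'_def of_int_add of_int_mult by simp_all
    qed
    show ?thesis
    proof (cases "(k - 1) * \<bar>x'\<bar> + y' \<le> k")
      case True
      then have "hex_coords 0 k x' y'" unfolding hex_coords_symmetric_iff[OF k] using x' y' by auto
      then show ?thesis using crit[of i j] unfolding x'_def y'_def by blast
    next
      case False
      have y1: "y - real_of_int (j + 1) * (k + 1) = y' - (k + 1)" by (simp add: y'_def algebra_simps)
      have "(k - 1) * (1 - \<bar>x'\<bar>) + \<bar>y' - (k + 1)\<bar> \<le> k"
        using False y' by (simp add: algebra_simps)
      moreover have "\<bar>1 - \<bar>x'\<bar>\<bar> \<le> 1" using x' by linarith
      ultimately have h: "hex_coords 0 k x1 (y' - (k + 1))" if "\<bar>x1\<bar> = 1 - \<bar>x'\<bar>" for x1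
        unfolding hex_coords_symmetric_iff[OF k] that by simp
      show ?thesis
      proof (cases "x' \<ge> 0")
        case True
        have "x - real_of_int (2 * i + (j + 1)) = x' - 1" by (simp add: x'_def)
        then show ?thesis using crit[of i "j + 1"] h[of "x' - 1"] True x' y1 by (metis abs_minus_commute abs_of_nonneg diff_ge_0_iff_ge less_imp_le)
      next
        case False
        have "x - real_of_int (2 * (i - 1) + (j + 1)) = x' + 1" by (simp add: x'_def)
        moreover have "\<bar>x' + 1\<bar> = 1 - \<bar>x'\<bar>" using False x' by linarith
        ultimately show ?thesis using crit[of "i - 1" "j + 1"] h[of "x' + 1"] y1 by metis
      qed
    qed
  qed
  then have cover: "(\<Union>t\<in>{\<Lambda> i j | i j. True}. (+) t ` ?H) = UNIV" by blast
  obtain f g where fg: "f \<bullet> D = 1" "f \<bullet> E = 0" "g \<bullet> D = 0" "g \<bullet> E = 1" using dual_basis[OF D] by blast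
  \<comment> \<open>The pairs of sides of the hexagon belong to the functionals \<open>f\<close>, \<open>(k - 1) f + g\<close> and \<open>(k - 1) f - g\<close>.\<close>
  have bound: "\<bar>a \<bullet> (z - t)\<bar> < c" if z: "z \<in> interior ((+) t ` ?H)" and a: "a \<noteq> 0" "\<And>w. w \<in> ?H \<Longrightarrow> \<bar>a \<bullet> w\<bar> \<le> c" for a c z t
  proof -
    have "(+) t ` ?H \<subseteq> {w. a \<bullet> w \<le> c + a \<bullet> t}" "(+) t ` ?H \<subseteq> {w. (- a) \<bullet> w \<le> c - a \<bullet> t}"
      using a(2) by (auto simp: inner_add_right abs_le_iff)
    from interior_subset_halfspace[OF _ this(1) z] interior_subset_halfspace[OF _ this(2) z] show ?thesis
      using a(1) by (simp add: inner_diff_right abs_less_iff)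
  qed
  have "i = i' \<and> j = j'" if z: "z \<in> interior ((+) (\<Lambda> i j) ` ?H)" "z \<in> interior ((+) (\<Lambda> i' j') ` ?H)" for z i j i' j'
  proof -
    have diff: "\<bar>a \<bullet> (\<Lambda> i j - \<Lambda> i' j')\<bar> < 2 * c" if a: "a \<noteq> 0" "\<And>w. w \<in> ?H \<Longrightarrow> \<bar>a \<bullet> w\<bar> \<le> c" for a c
      using bound[OF z(1) a] bound[OF z(2) a] by (simp add: inner_diff_right abs_less_iff)
    let ?n = "(i - i') + (j - j')" and ?m = "i - i'"
    have L: "f \<bullet> (\<Lambda> i j - \<Lambda> i' j') = real_of_int (?m + ?n)" "g \<bullet> (\<Lambda> i j - \<Lambda> i' j') = real_of_int (?n - ?m) * (k + 1)"
      by (simp_all add: \<Lambda>_def inner_add_right inner_diff_right fg algebra_simps)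
    have 1: "\<bar>real_of_int (?m + ?n)\<bar> < 2 * 1"
      unfolding L(1)[symmetric] using fg
      by (intro diff) (auto simp: hexagon_def hex_coords_def inner_add_right)
    have "\<bar>((k - 1) *\<^sub>R f + g) \<bullet> (\<Lambda> i j - \<Lambda> i' j')\<bar> < 2 * k"
    proof (rule diff)
      have "((k - 1) *\<^sub>R f + g) \<bullet> E \<noteq> 0" using fg by (simp add: inner_add_left)
      then show "(k - 1) *\<^sub>R f + g \<noteq> 0" by auto
    qed (auto simp: hexagon_def hex_coords_def inner_add_right inner_add_left fg)
    then have 2: "\<bar>(k - 1) * real_of_int (?m + ?n) + real_of_int (?n - ?m) * (k + 1)\<bar> < 2 * k"
      unfolding inner_add_left inner_scaleR_left L .
    have "\<bar>((k - 1) *\<^sub>R f - g) \<bullet> (\<Lambda> i j - \<Lambda> i' j')\<bar> < 2 * k"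
    proof (rule diff)
      have "((k - 1) *\<^sub>R f - g) \<bullet> E \<noteq> 0" using fg by (simp add: inner_diff_left)
      then show "(k - 1) *\<^sub>R f - g \<noteq> 0" by auto
    qed (auto simp: hexagon_def hex_coords_def inner_add_right inner_diff_left fg)
    then have 3: "\<bar>(k - 1) * real_of_int (?m + ?n) - real_of_int (?n - ?m) * (k + 1)\<bar> < 2 * k"
      unfolding inner_diff_left inner_scaleR_left L .
    have "(k - 1) * real_of_int (?m + ?n) + real_of_int (?n - ?m) * (k + 1) = 2 * (k * ?n - ?m)"
      "(k - 1) * real_of_int (?m + ?n) - real_of_int (?n - ?m) * (k + 1) = 2 * (k * ?m - ?n)"
      by (simp_all add: algebra_simps)
    then have "\<bar>k * ?n - ?m\<bar> < k" "\<bar>k * ?m - ?n\<bar> < k"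
      using 2 3 by (simp_all only: abs_mult) simp_all
    then show ?thesis using small_lattice_vector_zero[of k ?m ?n] k 1 by simp
  qed
  then have "pairwise (\<lambda>s t. interior ((+) s ` ?H) \<inter> interior ((+) t ` ?H) = {}) {\<Lambda> i j | i j. True}"
    unfolding pairwise_def by blast
  then show ?thesis unfolding tessellates_by_translations_def using cover by blast
qed

lemma hexagon_in_tiles:
  assumes D: "cross2 D E \<noteq> 0" and k: "1 \<le> k"
  shows "hexagon D E 0 k \<in> tiles"
proof -
  have "measure lebesgue (hexagon D E 0 k) \<noteq> 0"
    using measure_hexagon[OF D k, of 0] D k by simp
  then have "interior (hexagon D E 0 k) \<noteq> {}"
    using negligible_convex_interior[OF convex_hexagon] negligible_imp_measure0 by blast
  then show ?thesis
    unfolding tiles_def using tessellates_hexagon[OF D k] polytope_hexagon[OF k] by simp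
qed

lemma tiles_translation:
  assumes "P \<in> tiles" shows "(+) c ` P \<in> tiles"
proof -
  obtain T where T: "(\<Union>t\<in>T. (+) t ` P) = UNIV"
      "pairwise (\<lambda>s t. interior ((+) s ` P) \<inter> interior ((+) t ` P) = {}) T"
    and P: "polytope P" "interior P \<noteq> {}"
    using assms unfolding tiles_def tessellates_by_translations_def by blast
  have shift: "(+) (t - c) ` (+) c ` P = (+) t ` P" for t
    by (simp add: image_image)
  have "(\<Union>t\<in>(\<lambda>t. t - c) ` T. (+) t ` (+) c ` P) = UNIV"
    using T(1) by (simp add: shift)
  moreover have "pairwise (\<lambda>s t. interior ((+) s ` (+) c ` P) \<inter> interior ((+) t ` (+) c ` P) = {}) ((\<lambda>t. t - c) ` T)"
    unfolding pairwise_image shift using T(2) unfolding pairwise_def by blast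
  moreover have "polytope ((+) c ` P)" "interior ((+) c ` P) \<noteq> {}"
    using P by (simp_all add: polytope_translation_eq interior_translation)
  ultimately show ?thesis unfolding tiles_def tessellates_by_translations_def by blast
qed

section \<open>Hausdorff distance of polygons\<close>

lemma convex_infdist_le:
  fixes B :: "'a::euclidean_space set"
  assumes "convex B" "closed B" "B \<noteq> {}"
  shows "convex {x. infdist x B \<le> e}"
proof (rule convexI)
  fix x y and u v :: real
  assume xy: "x \<in> {x. infdist x B \<le> e}" "y \<in> {x. infdist x B \<le> e}" and uv: "0 \<le> u" "0 \<le> v" "u + v = 1"
  obtain p where p: "p \<in> B" "infdist x B = dist x p" using infdist_attains_inf[OF assms(2,3)] by metis
  obtain q where q: "q \<in> B" "infdist y B = dist y q" using infdist_attains_inf[OF assms(2,3)] by metis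
  have "u *\<^sub>R p + v *\<^sub>R q \<in> B" using assms(1) p q uv by (intro convexD) auto
  then have "infdist (u *\<^sub>R x + v *\<^sub>R y) B \<le> dist (u *\<^sub>R x + v *\<^sub>R y) (u *\<^sub>R p + v *\<^sub>R q)" by (rule infdist_le)
  also have "\<dots> = norm (u *\<^sub>R (x - p) + v *\<^sub>R (y - q))" by (simp add: dist_norm algebra_simps)
  also have "\<dots> \<le> u * dist x p + v * dist y q"
    using norm_triangle_ineq[of "u *\<^sub>R (x - p)" "v *\<^sub>R (y - q)"] uv by (simp add: dist_norm)
  also have "\<dots> \<le> e" using convex_bound_le[of "dist x p" e "dist y q" u v] xy p q uv by simp
  finally show "u *\<^sub>R x + v *\<^sub>R y \<in> {x. infdist x B \<le> e}" by simp
qed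

lemma infdist_hull_le:
  fixes a b :: "'i \<Rightarrow> 'a::euclidean_space"
  assumes "finite I" "I \<noteq> {}" "\<And>i. i \<in> I \<Longrightarrow> dist (a i) (b i) \<le> e" "x \<in> convex hull (a ` I)"
  shows "infdist x (convex hull (b ` I)) \<le> e"
proof -
  let ?B = "convex hull (b ` I)"
  have "compact ?B" using assms(1) by (intro finite_imp_compact_convex_hull) simp
  then have "convex {x. infdist x ?B \<le> e}"
    using assms(2) by (intro convex_infdist_le) (auto dest: compact_imp_closed)
  moreover have "a ` I \<subseteq> {x. infdist x ?B \<le> e}"
    using assms(3) by (auto intro!: infdist_le2 hull_inc)
  ultimately have "convex hull (a ` I) \<subseteq> {x. infdist x ?B \<le> e}" by (rule hull_minimal[rotated])
  then show ?thesis using assms(4) by blast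
qed

lemma hausdorff_distance_hull_le:
  fixes a b :: "'i \<Rightarrow> 'a::euclidean_space"
  assumes "finite I" "I \<noteq> {}" "\<And>i. i \<in> I \<Longrightarrow> dist (a i) (b i) \<le> e"
  shows "hausdorff_distance (convex hull (a ` I)) (convex hull (b ` I)) \<le> e"
  unfolding hausdorff_distance_def using assms
  by (auto intro!: cSUP_least infdist_hull_le simp: dist_commute)

lemma bdd_above_infdist:
  fixes A B :: "'a::euclidean_space set"
  assumes "compact A"
  shows "bdd_above ((\<lambda>a. infdist a B) ` A)"
  by (intro bounded_imp_bdd_above compact_imp_bounded compact_continuous_image assms continuous_intros)

lemma infdist_le_hausdorff_distance:
  fixes A B :: "'a::euclidean_space set"
  assumes "compact A" "compact B"
  shows "a \<in> A \<Longrightarrow> infdist a B \<le> hausdorff_distance A B" "b \<in> B \<Longrightarrow> infdist b A \<le> hausdorff_distance A B"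
  unfolding hausdorff_distance_def
  using cSUP_upper[OF _ bdd_above_infdist[OF assms(1)], of a B] cSUP_upper[OF _ bdd_above_infdist[OF assms(2)], of b A]
  by (auto simp: le_max_iff_disj)

lemma hausdorff_distance_0_imp_eq:
  fixes A B :: "'a::euclidean_space set"
  assumes "compact A" "compact B" "A \<noteq> {}" "B \<noteq> {}" "hausdorff_distance A B = 0"
  shows "A = B"
proof -
  have "a \<in> B" if "a \<in> A" for a
    using infdist_le_hausdorff_distance(1)[OF assms(1,2) that] assms infdist_nonneg[of a B]
      in_closed_iff_infdist_zero[of B a] by (simp add: compact_imp_closed)
  moreover have "b \<in> A" if "b \<in> B" for b
    using infdist_le_hausdorff_distance(2)[OF assms(1,2) that] assms infdist_nonneg[of b A]
      in_closed_iff_infdist_zero[of A b] by (simp add: compact_imp_closed)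
  ultimately show ?thesis by blast
qed

text \<open>The distance of two polygons is at most the largest distance of corresponding vertices.\<close>

lemma hausdorff_distance_hexagon_tendsto:
  fixes Ds Es :: "nat \<Rightarrow> real^2"
  assumes D: "Ds \<longlonglongrightarrow> D" and E: "Es \<longlonglongrightarrow> E" and k: "ks \<longlonglongrightarrow> k" and k1: "\<And>n. 1 \<le> ks n" "1 \<le> k"
  shows "(\<lambda>n. hausdorff_distance (hexagon (Ds n) (Es n) 0 (ks n)) (hexagon D E 0 k)) \<longlonglongrightarrow> 0"
proof -
  define V where "V D E k i = [D + E, E - D, - D - E, D - E, k *\<^sub>R E, - (k *\<^sub>R E)] ! i" for D E :: "real^2" and k :: real and i :: nat
  have I: "{..<6::nat} = {0, 1, 2, 3, 4, 5}" by auto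
  have hull: "hexagon D E 0 k = convex hull (V D E k ` {..<6})" if "1 \<le> k" for D E k
    using hexagon_eq_hull[OF that, of 0 D E] unfolding I by (simp add: V_def insert_commute)
  define e where "e n = (\<Sum>i<6. dist (V (Ds n) (Es n) (ks n) i) (V D E k i))" for n
  have "e \<longlonglongrightarrow> (\<Sum>i<6::nat. 0)"
    unfolding e_def
  proof (intro tendsto_sum)
    fix i :: nat assume "i \<in> {..<6}"
    then have "(\<lambda>n. V (Ds n) (Es n) (ks n) i) \<longlonglongrightarrow> V D E k i"
      unfolding I by (auto simp: V_def intro!: tendsto_intros D E k)
    then show "(\<lambda>n. dist (V (Ds n) (Es n) (ks n) i) (V D E k i)) \<longlonglongrightarrow> 0"
      by (rule tendsto_dist_iff[THEN iffD1])
  qed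
  then have "e \<longlonglongrightarrow> 0" by simp
  have "hausdorff_distance (hexagon (Ds n) (Es n) 0 (ks n)) (hexagon D E 0 k) \<le> e n" for n
    unfolding hull[OF k1(1)] hull[OF k1(2)] e_def
    by (intro hausdorff_distance_hull_le member_le_sum) (auto simp: I)
  moreover have "0 \<le> hausdorff_distance (hexagon (Ds n) (Es n) 0 (ks n)) (hexagon D E 0 k)" for n
  proof -
    have c: "compact (hexagon (Ds n) (Es n) 0 (ks n))" "compact (hexagon D E 0 k)"
      using k1 by (simp_all add: compact_hexagon)
    have "D + E \<in> hexagon D E 0 k"
      unfolding hull[OF k1(2)] by (rule hull_inc) (auto simp: V_def intro!: image_eqI[of _ _ 0])
    from infdist_le_hausdorff_distance(2)[OF c this] show ?thesis using infdist_nonneg order_trans by blast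
  qed
  ultimately show ?thesis
    by (intro tendsto_sandwich[OF always_eventually always_eventually tendsto_const \<open>e \<longlonglongrightarrow> 0\<close>] allI)
qed

section \<open>Iterated symmetrization\<close>

lemma cross2_squared: "(cross2 D E)\<^sup>2 + (D \<bullet> E)\<^sup>2 = (D \<bullet> D) * (E \<bullet> E)"
  by (simp add: cross2_def inner_real2 power2_eq_square algebra_simps)

text \<open>The last condition says that the hexagon with data \<open>D\<close>, \<open>E\<close>, \<open>k\<close> and \<open>b = 0\<close> has unit area.\<close>

definition unit_biaxial :: "real^2 \<Rightarrow> real^2 \<Rightarrow> real \<Rightarrow> bool" where
  "unit_biaxial D E k \<longleftrightarrow> D \<bullet> E = 0 \<and> 1 \<le> k \<and> 2 * (1 + k) * \<bar>cross2 D E\<bar> = 1"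

lemma unit_biaxial_cross2: "unit_biaxial D E k \<Longrightarrow> cross2 D E \<noteq> 0"
  by (auto simp: unit_biaxial_def)

lemma unit_biaxial_shape: "unit_biaxial D E k \<Longrightarrow> 1 \<le> k"
  by (simp add: unit_biaxial_def)

lemma unit_biaxial_in_tiles: "unit_biaxial D E k \<Longrightarrow> hexagon D E 0 k \<in> tiles"
  by (intro hexagon_in_tiles unit_biaxial_cross2 unit_biaxial_shape)

lemma unit_biaxial_area:
  assumes "unit_biaxial D E k" shows "measure lebesgue (hexagon D E 0 k) = 1"
  using measure_hexagon[OF unit_biaxial_cross2[OF assms] unit_biaxial_shape[OF assms], of 0] assms
  unfolding unit_biaxial_def by simp

lemma unit_biaxial_norms:
  assumes "unit_biaxial D E k"
  shows "4 * (1 + k)\<^sup>2 * ((D \<bullet> D) * (E \<bullet> E)) = 1" "D \<bullet> D > 0" "E \<bullet> E > 0"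
proof -
  have biaxial: "D \<bullet> E = 0" "2 * (1 + k) * \<bar>cross2 D E\<bar> = 1" using assms unfolding unit_biaxial_def by blast+
  have "4 * (1 + k)\<^sup>2 * (cross2 D E)\<^sup>2 = (2 * (1 + k) * \<bar>cross2 D E\<bar>)\<^sup>2"
    by (simp only: power_mult_distrib power2_abs) simp
  then show "4 * (1 + k)\<^sup>2 * ((D \<bullet> D) * (E \<bullet> E)) = 1"
    unfolding biaxial(2) using cross2_squared[of D E] biaxial(1) by simp
  then have "D \<noteq> 0" "E \<noteq> 0" by auto
  then show "D \<bullet> D > 0" "E \<bullet> E > 0" by simp_all
qed

text \<open>The same hexagon in the coordinates that belong to the oblique short diagonal from \<open>D - E\<close> to \<open>k E\<close>, with
  the vertex \<open>D + E\<close> between them as apex.\<close>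

lemma hexagon_other_diagonal:
  assumes "k > 0"
  shows "hexagon D E 0 k = hexagon ((1/2) *\<^sub>R ((k + 1) *\<^sub>R E - D)) ((1/2) *\<^sub>R ((k - 1) *\<^sub>R E + D)) (2 / k - 1) (1 + 2 / k)"
    (is "_ = hexagon ?D ?M _ _")
proof -
  have coords: "hex_coords (2 / k - 1) (1 + 2 / k) x y \<longleftrightarrow> hex_coords 0 k ((y - x) / 2) (((k + 1) * x + (k - 1) * y) / 2)" for x y
  proof -
    have e: "1 + 2 / k - 1 = 2 / k" "1 - (2 / k - 1) = 2 - 2 / k" "1 + 2 / k - (2 / k - 1) = 2"
      "1 + (2 / k - 1) = 2 / k" "1 + 2 / k + (2 / k - 1) = 4 / k" by simp_all
    have r: "2 / k * x + (2 - 2 / k) * y = 2 / k * (x + (k - 1) * y)" "2 / k * x - 2 / k * y = - (4 / k) * ((y - x) / 2)"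
      using assms by (simp_all add: field_simps)
    have abs_k: "\<bar>2 / k\<bar> = 2 / k" "\<bar>- (4 / k)\<bar> = 4 / k" using assms by simp_all
    have "hex_coords (2 / k - 1) (1 + 2 / k) x y \<longleftrightarrow>
        \<bar>x\<bar> \<le> 1 \<and> 2 / k * \<bar>x + (k - 1) * y\<bar> \<le> 2 / k * k \<and> 4 / k * \<bar>(y - x) / 2\<bar> \<le> 4 / k * 1"
      unfolding hex_coords_def e r abs_mult abs_k using assms by simp
    also have "\<dots> \<longleftrightarrow> \<bar>x\<bar> \<le> 1 \<and> \<bar>x + (k - 1) * y\<bar> \<le> k \<and> \<bar>(y - x) / 2\<bar> \<le> 1"
      using assms mult_le_cancel_left_pos[of "2 / k" "\<bar>x + (k - 1) * y\<bar>" k]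
        mult_le_cancel_left_pos[of "4 / k" "\<bar>(y - x) / 2\<bar>" 1] by (simp only: zero_less_divide_iff zero_less_numeral) simp
    also have "\<dots> \<longleftrightarrow> hex_coords 0 k ((y - x) / 2) (((k + 1) * x + (k - 1) * y) / 2)"
    proof -
      have "(k - 1) * ((y - x) / 2) + (1 - 0) * (((k + 1) * x + (k - 1) * y) / 2) = x + (k - 1) * y"
        "(k - 1) * ((y - x) / 2) - (1 + 0) * (((k + 1) * x + (k - 1) * y) / 2) = - (k * x)"
        by (simp_all add: field_simps)
      moreover have "\<bar>k * x\<bar> \<le> k \<longleftrightarrow> \<bar>x\<bar> \<le> 1"
        using assms mult_le_cancel_left_pos[of k "\<bar>x\<bar>" 1] by (simp add: abs_mult)
      ultimately show ?thesis unfolding hex_coords_def by auto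
    qed
    finally show ?thesis .
  qed
  have vec: "x *\<^sub>R ?D + y *\<^sub>R ?M = ((y - x) / 2) *\<^sub>R D + (((k + 1) * x + (k - 1) * y) / 2) *\<^sub>R E" for x y
    by (simp add: vec_eq_iff field_simps)
  have onto: "\<exists>x y. p = (y - x) / 2 \<and> q = ((k + 1) * x + (k - 1) * y) / 2" for p q
    using assms by (intro exI[of _ "(q - (k - 1) * p) / k"] exI[of _ "(q - (k - 1) * p) / k + 2 * p"])
      (simp add: field_simps)
  have "(\<exists>p q. Q p q) \<longleftrightarrow> (\<exists>x y. Q ((y - x) / 2) (((k + 1) * x + (k - 1) * y) / 2))" for Q :: "real \<Rightarrow> real \<Rightarrow> bool"
    using onto by metis
  then show ?thesis
    unfolding hexagon_def vec coords by (intro Collect_cong)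
qed

definition next_D :: "real^2 \<Rightarrow> real^2 \<Rightarrow> real \<Rightarrow> real^2" where
  "next_D D E k = (1/2) *\<^sub>R ((k + 1) *\<^sub>R E - D)"

definition next_E :: "real^2 \<Rightarrow> real^2 \<Rightarrow> real \<Rightarrow> real^2" where
  "next_E D E k = orthogonal_part (next_D D E k) ((1/2) *\<^sub>R ((k - 1) *\<^sub>R E + D))"

lemma
  assumes biaxial: "unit_biaxial D E k"
  shows steiner_biaxial: "steiner (next_D D E k /\<^sub>R norm (next_D D E k)) (hexagon D E 0 k)
      = hexagon (next_D D E k) (next_E D E k) 0 (1 + 2 / k)"
    and unit_biaxial_next: "unit_biaxial (next_D D E k) (next_E D E k) (1 + 2 / k)"
proof -
  let ?M = "(1/2) *\<^sub>R ((k - 1) *\<^sub>R E + D)"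
  have k: "1 \<le> k" using biaxial by (simp add: unit_biaxial_def)
  have cross: "cross2 (next_D D E k) ?M = - (k / 2) * cross2 D E"
    by (simp add: next_D_def cross2_def field_simps)
  then have nz: "cross2 (next_D D E k) ?M \<noteq> 0" using unit_biaxial_cross2[OF biaxial] k by simp
  have "2 / k \<le> 2 / 1" using k by (intro divide_left_mono) auto
  then have k': "1 \<le> 1 + 2 / k" "\<bar>2 / k - 1\<bar> \<le> 1" using k by (simp_all add: abs_le_iff)
  have "hexagon D E 0 k = hexagon (next_D D E k) ?M (2 / k - 1) (1 + 2 / k)"
    unfolding next_D_def using k by (intro hexagon_other_diagonal) simp
  then show "steiner (next_D D E k /\<^sub>R norm (next_D D E k)) (hexagon D E 0 k)
      = hexagon (next_D D E k) (next_E D E k) 0 (1 + 2 / k)"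
    using steiner_hexagon[OF nz k'] by (simp add: next_E_def)
  have "2 * (1 + (1 + 2 / k)) * \<bar>cross2 (next_D D E k) (next_E D E k)\<bar> = 2 * (1 + k) * \<bar>cross2 D E\<bar>"
    unfolding next_E_def cross2_orthogonal_part cross using k by (simp add: abs_mult field_simps)
  then show "unit_biaxial (next_D D E k) (next_E D E k) (1 + 2 / k)"
    using biaxial k' orthogonal_part_orthogonal[of "next_D D E k"] unfolding unit_biaxial_def
    by (simp add: next_E_def inner_commute)
qed

text \<open>Unit area expresses the length of \<open>E\<close> by that of \<open>D\<close> and \<open>k\<close>; then \<open>k\<close> cancels.\<close>

lemma next_D_norm:
  assumes biaxial: "unit_biaxial D E k"
  shows "next_D D E k \<bullet> next_D D E k = (D \<bullet> D + 1 / (4 * (D \<bullet> D))) / 4"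
proof -
  have "D \<bullet> E = 0" using biaxial by (simp add: unit_biaxial_def)
  then have "next_D D E k \<bullet> next_D D E k = ((1 + k)\<^sup>2 * (E \<bullet> E) + D \<bullet> D) / 4"
    by (simp add: next_D_def inner_diff_left inner_diff_right inner_commute power2_eq_square algebra_simps)
  moreover have "(1 + k)\<^sup>2 * (E \<bullet> E) = 1 / (4 * (D \<bullet> D))"
  proof -
    have "(1 + k)\<^sup>2 * (E \<bullet> E) * (4 * (D \<bullet> D)) = 1"
      using unit_biaxial_norms(1)[OF biaxial] by (simp only: mult_ac)
    then show ?thesis using unit_biaxial_norms(2)[OF biaxial] by (intro eq_divide_imp) auto
  qed
  ultimately show ?thesis by simp
qed

lemma compact_biaxial: "unit_biaxial D E k \<Longrightarrow> compact (hexagon D E 0 k)"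
  by (simp add: compact_hexagon unit_biaxial_shape)

lemma biaxial_nonempty: "unit_biaxial D E k \<Longrightarrow> hexagon D E 0 k \<noteq> {}"
  using unit_biaxial_area[of D E k] by auto

text \<open>The first symmetrization, along a short diagonal, leaves the centre on the axis spanned by \<open>E\<close>. The
  second one, along \<open>E\<close>, preserves the shape and moves the centre to the origin.\<close>

lemma tile_symmetrizes_to_biaxial:
  assumes H: "H \<in> tiles" "measure lebesgue H = 1"
  obtains v w a D E k where "norm v = 1" "norm w = 1" "unit_biaxial D E k"
    "steiner v H = (+) a ` hexagon D E 0 k" "steiner w (steiner v H) = hexagon D E 0 k"
proof -
  obtain c D M b k where nz: "cross2 D M \<noteq> 0" and k: "1 \<le> k" "\<bar>b\<bar> \<le> 1" and H_eq: "H = (+) c ` hexagon D M b k"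
    using tile_is_hexagonal[OF H(1)] unfolding hexagonal_def by blast
  define E where "E = orthogonal_part D M"
  define v where "v = D /\<^sub>R norm D"
  define w where "w = E /\<^sub>R norm E"
  define a where "a = c - (c \<bullet> v) *\<^sub>R v"
  have nz': "cross2 D E \<noteq> 0" using nz by (simp add: E_def cross2_orthogonal_part)
  then have "D \<noteq> 0" "E \<noteq> 0" by (auto simp: cross2_def)
  then have norms: "norm v = 1" "norm w = 1" by (simp_all add: v_def w_def)
  have DE: "D \<bullet> E = 0" unfolding E_def inner_commute[of D] by (rule orthogonal_part_orthogonal)
  have "2 * (1 + k) * \<bar>cross2 D M\<bar> = 1"
    using H(2) measure_hexagon[OF nz k] by (simp add: H_eq measure_translation)
  then have biaxial: "unit_biaxial D E k"
    using DE k by (simp add: unit_biaxial_def E_def cross2_orthogonal_part)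
  have S1: "steiner v H = (+) a ` hexagon D E 0 k"
    unfolding H_eq steiner_translation[OF compact_hexagon[OF k] convex_hexagon norms(1)] a_def
    by (simp add: v_def E_def steiner_hexagon[OF nz k])
  have sym: "steiner w (hexagon D E 0 k) = hexagon D E 0 k"
  proof (rule steiner_of_symmetric[OF compact_biaxial[OF biaxial] convex_hexagon norms(2)])
    fix z assume "z \<in> hexagon D E 0 k"
    then obtain x y where z: "z = x *\<^sub>R D + y *\<^sub>R E" and xy: "hex_coords 0 k x y" by (auto simp: hexagon_def)
    have "z \<bullet> w = y * norm E"
      using DE \<open>E \<noteq> 0\<close> by (simp add: z w_def inner_add_left dot_square_norm power2_eq_square)
    then have "(2 * (z \<bullet> w)) *\<^sub>R w = (2 * y) *\<^sub>R E"
      using \<open>E \<noteq> 0\<close> by (simp add: w_def)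
    then have "z - (2 * (z \<bullet> w)) *\<^sub>R w = x *\<^sub>R D + (- y) *\<^sub>R E"
      by (simp add: z scaleR_2 algebra_simps flip: scaleR_add_left)
    moreover have "hex_coords 0 k x (- y)" using xy hex_coords_symmetric_iff[OF k(1)] by simp
    ultimately show "z - (2 * (z \<bullet> w)) *\<^sub>R w \<in> hexagon D E 0 k" unfolding hexagon_def by blast
  qed
  have "a - (a \<bullet> w) *\<^sub>R w = 0"
  proof -
    have "a \<bullet> v = 0" using norms(1) by (simp add: a_def inner_diff_left dot_square_norm)
    then have "a \<bullet> D = 0" using \<open>D \<noteq> 0\<close> by (simp add: v_def)
    moreover obtain x y where a: "a = x *\<^sub>R D + y *\<^sub>R E" using coordinates_cross2[OF nz'] by blast
    ultimately have "x * (D \<bullet> D) = 0" using DE by (simp add: inner_add_left inner_add_right inner_commute)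
    then have a: "a = y *\<^sub>R E" using \<open>D \<noteq> 0\<close> a by simp
    then have aw: "a \<bullet> w = y * norm E" using \<open>E \<noteq> 0\<close> by (simp add: w_def dot_square_norm power2_eq_square)
    show ?thesis unfolding aw unfolding a w_def using \<open>E \<noteq> 0\<close> by simp
  qed
  then have "steiner w (steiner v H) = hexagon D E 0 k"
    unfolding S1 steiner_translation[OF compact_biaxial[OF biaxial] convex_hexagon norms(2)] sym by simp
  then show thesis using that[OF norms biaxial S1] by blast
qed

lemma hexagon_symmetric: "z \<in> hexagon D E b k \<Longrightarrow> - z \<in> hexagon D E b k"
proof -
  assume "z \<in> hexagon D E b k"
  then obtain x y where z: "z = x *\<^sub>R D + y *\<^sub>R E" and xy: "hex_coords b k x y" by (auto simp: hexagon_def)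
  have "hex_coords b k (- x) (- y)" using xy by (rule hex_coords_minus)
  moreover have "- z = (- x) *\<^sub>R D + (- y) *\<^sub>R E" by (simp add: z)
  ultimately show "- z \<in> hexagon D E b k" unfolding hexagon_def by blast
qed

text \<open>If both sets are symmetric about the origin, then \<open>A\<close> is invariant under translation by \<open>2 a\<close>, which
  for a bounded set forces \<open>a = 0\<close>.\<close>

lemma centred_translate_eq:
  fixes A B :: "'a::euclidean_space set"
  assumes "compact A" "A \<noteq> {}" and sym: "\<And>z. z \<in> A \<Longrightarrow> - z \<in> A" "\<And>z. z \<in> B \<Longrightarrow> - z \<in> B"
    and B: "B = (+) a ` A"
  shows "B = A"
proof -
  have "continuous_on A (\<lambda>z. a \<bullet> z)" by (intro continuous_intros)
  then obtain z where z: "z \<in> A" "\<And>w. w \<in> A \<Longrightarrow> a \<bullet> w \<le> a \<bullet> z"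
    using continuous_attains_sup[OF assms(1,2)] by metis
  have "- (a + z) \<in> B" using sym(2) z(1) B by blast
  then obtain w where "w \<in> A" "- (a + z) = a + w" using B by auto
  then have "- w \<in> A" "w = - (a + z) - a" using sym(1) by (auto simp: algebra_simps)
  then have "- w \<in> A" "- w = a + (a + z)" by simp_all
  then have "a \<bullet> (a + (a + z)) \<le> a \<bullet> z" using z(2) by metis
  then have "a \<bullet> a \<le> 0" by (simp add: inner_add_right)
  then have "a = 0" by (metis inner_gt_zero_iff not_le)
  then show ?thesis using B by simp
qed

section \<open>Convergence to a regular hexagon\<close>

lemma contraction_tendsto:
  fixes x :: "nat \<Rightarrow> real"
  assumes "0 \<le> c" "c < 1" "\<And>n. n \<ge> N \<Longrightarrow> \<bar>x (Suc n) - L\<bar> \<le> c * \<bar>x n - L\<bar>"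
  shows "x \<longlonglongrightarrow> L"
proof -
  have bound: "\<bar>x (n + N) - L\<bar> \<le> \<bar>x N - L\<bar> * c ^ n" for n
  proof (induction n)
    case (Suc n)
    have "\<bar>x (Suc n + N) - L\<bar> \<le> c * \<bar>x (n + N) - L\<bar>" using assms(3)[of "n + N"] by simp
    also have "\<dots> \<le> c * (\<bar>x N - L\<bar> * c ^ n)" using Suc assms(1) by (rule mult_left_mono)
    finally show ?case by (simp add: algebra_simps)
  qed simp
  have "(\<lambda>n. \<bar>x N - L\<bar> * c ^ n) \<longlonglongrightarrow> \<bar>x N - L\<bar> * 0"
    using assms by (intro tendsto_intros LIMSEQ_power_zero) auto
  then have lim0: "(\<lambda>n. \<bar>x N - L\<bar> * c ^ n) \<longlonglongrightarrow> 0" by simp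
  have "(\<lambda>n. x (n + N) - L) \<longlonglongrightarrow> 0"
    by (rule Lim_null_comparison[OF _ lim0]) (simp add: bound)
  then have "(\<lambda>n. x (n + N)) \<longlonglongrightarrow> L" by (simp add: LIM_zero_iff)
  then show ?thesis by (rule LIMSEQ_offset)
qed

lemma shape_recurrence_tendsto:
  fixes k :: "nat \<Rightarrow> real"
  assumes "\<And>n. 1 \<le> k n" "\<And>n. k (Suc n) = 1 + 2 / k n"
  shows "k \<longlonglongrightarrow> 2"
  \<comment> \<open>After two steps \<open>k\<close> is at least \<open>5/3\<close>, and every step divides the distance to \<open>2\<close> by \<open>k\<close>.\<close>
proof (rule contraction_tendsto[of "3/5" 2])
  fix n :: nat assume "n \<ge> 2"
  then obtain m where m: "n = Suc (Suc m)" by (metis add_2_eq_Suc le_Suc_ex)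
  have "2 / k m \<le> 2 / 1" using assms(1)[of m] by (intro divide_left_mono) auto
  then have "k (Suc m) \<le> 3" using assms(2)[of m] by simp
  then have "2 / 3 \<le> 2 / k (Suc m)" using assms(1)[of "Suc m"] by (intro divide_left_mono) auto
  then have "k n \<ge> 5/3" using assms(2)[of "Suc m"] by (simp add: m)
  have "k (Suc n) - 2 = (2 - k n) / k n" using assms(1)[of n] by (simp add: assms(2) field_simps)
  then have "\<bar>k (Suc n) - 2\<bar> = \<bar>k n - 2\<bar> / k n" using assms(1)[of n] by (simp add: abs_div abs_minus_commute)
  also have "\<dots> \<le> \<bar>k n - 2\<bar> / (5/3)" using \<open>k n \<ge> 5/3\<close> by (intro divide_left_mono) auto
  finally show "\<bar>k (Suc n) - 2\<bar> \<le> 3/5 * \<bar>k n - 2\<bar>" by simp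
qed auto

text \<open>The inequality of arithmetic and geometric means for \<open>u\<close> and \<open>1 / (4 * u)\<close>.\<close>

lemma size_recurrence:
  fixes u :: real
  assumes "u > 0"
  shows "(u + 1 / (4 * u)) / 4 \<ge> 1/4"
proof -
  have "u + 1 / (4 * u) - 1 = (2 * u - 1)\<^sup>2 / (4 * u)"
    using assms by (simp add: field_simps power2_eq_square)
  then have "u + 1 / (4 * u) - 1 \<ge> 0" using assms by simp
  then show ?thesis by simp
qed

lemma size_recurrence_tendsto:
  fixes u :: "nat \<Rightarrow> real"
  assumes pos: "\<And>n. 0 < u n" and step: "\<And>n. u (Suc n) = (u n + 1 / (4 * u n)) / 4"
    and L: "L > 0" "L\<^sup>2 = 1 / 12"
  shows "u \<longlonglongrightarrow> L"
  \<comment> \<open>After one step \<open>u\<close> is at least \<open>1/4\<close>, and so is \<open>L\<close>; this bounds the factor of \<open>u - L\<close>.\<close>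
proof (rule contraction_tendsto[of "3/4" 1])
  fix n :: nat assume "n \<ge> 1"
  then obtain m where "n = Suc m" by (cases n) auto
  then have "u n \<ge> 1/4" using size_recurrence[OF pos[of m]] by (simp add: step)
  moreover have "L \<ge> 1/4"
    by (rule power2_le_imp_le) (use L in \<open>simp_all add: power2_eq_square\<close>)
  ultimately have "1/4 * (1/4) \<le> u n * L" using L by (intro mult_mono) auto
  then have w: "0 < 1 / (16 * (u n * L))" "1 / (16 * (u n * L)) \<le> 1" by (simp_all add: field_simps)
  have L_eq: "L = (L + 1 / (4 * L)) / 4" using L by (simp add: field_simps power2_eq_square)
  have "u (Suc n) - L = (u n + 1 / (4 * u n)) / 4 - (L + 1 / (4 * L)) / 4"
    using step[of n] L_eq by linarith
  also have "\<dots> = (u n - L) * (1/4 - 1 / (16 * (u n * L)))"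
    using pos[of n] L by (simp add: field_simps)
  finally have "\<bar>u (Suc n) - L\<bar> = \<bar>u n - L\<bar> * \<bar>1/4 - 1 / (16 * (u n * L))\<bar>" by (simp add: abs_mult)
  also have "\<dots> \<le> \<bar>u n - L\<bar> * (3/4)" using w by (intro mult_left_mono) linarith+
  finally show "\<bar>u (Suc n) - L\<bar> \<le> 3/4 * \<bar>u n - L\<bar>" by simp
qed auto

text \<open>The ratio of lengths that makes the hexagon with \<open>k = 2\<close> regular: half of its width and half of its
  circumradius are in the ratio \<open>sqrt 3\<close> to \<open>1\<close>.\<close>

definition regular_pair :: "real^2 \<Rightarrow> real^2 \<Rightarrow> bool" where
  "regular_pair D E \<longleftrightarrow> unit_biaxial D E 2 \<and> D \<bullet> D = 3 * (E \<bullet> E)"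

lemma unit_biaxial_limit:
  assumes "Ds \<longlonglongrightarrow> D" "Es \<longlonglongrightarrow> E" "ks \<longlonglongrightarrow> k" "\<And>n. unit_biaxial (Ds n) (Es n) (ks n)"
  shows "unit_biaxial D E k"
proof -
  have biaxial: "Ds n \<bullet> Es n = 0" "1 \<le> ks n" "2 * (1 + ks n) * \<bar>cross2 (Ds n) (Es n)\<bar> = 1" for n
    using assms(4) by (simp_all add: unit_biaxial_def)
  have "(\<lambda>n. Ds n \<bullet> Es n) \<longlonglongrightarrow> D \<bullet> E" by (intro tendsto_intros assms)
  then have "D \<bullet> E = 0" by (simp add: biaxial LIMSEQ_const_iff)
  moreover have "1 \<le> k" using assms(3) biaxial(2) by (intro LIMSEQ_le_const) auto
  moreover have "(\<lambda>n. 2 * (1 + ks n) * \<bar>cross2 (Ds n) (Es n)\<bar>) \<longlonglongrightarrow> 2 * (1 + k) * \<bar>cross2 D E\<bar>"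
    unfolding cross2_def by (intro tendsto_intros assms)
  then have "2 * (1 + k) * \<bar>cross2 D E\<bar> = 1" unfolding biaxial(3) LIMSEQ_const_iff by (rule sym)
  ultimately show ?thesis by (simp add: unit_biaxial_def)
qed

lemma convergent_subsequence_pair:
  fixes Ds Es :: "nat \<Rightarrow> 'a::euclidean_space"
  assumes "\<And>n. Ds n \<bullet> Ds n \<le> B" "\<And>n. Es n \<bullet> Es n \<le> C"
  obtains r D E where "strict_mono (r :: nat \<Rightarrow> nat)" "(\<lambda>n. Ds (r n)) \<longlonglongrightarrow> D" "(\<lambda>n. Es (r n)) \<longlonglongrightarrow> E"
proof -
  have "norm (Ds n, Es n) \<le> sqrt (B + C)" for n
    using assms(1)[of n] assms(2)[of n] by (simp add: norm_Pair power2_norm_eq_inner)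
  then have "bounded (range (\<lambda>n. (Ds n, Es n)))" by (auto simp: bounded_iff)
  then obtain p r where r: "strict_mono r" "((\<lambda>n. (Ds n, Es n)) \<circ> r) \<longlonglongrightarrow> p"
    using bounded_imp_convergent_subsequence by blast
  obtain D E where "p = (D, E)" by fastforce
  then show thesis
    using that[OF r(1), of D E] tendsto_fst[OF r(2)] tendsto_snd[OF r(2)] by (simp add: comp_def)
qed

text \<open>The lengths of \<open>D\<close> and \<open>E\<close> converge, but their directions need not; compactness provides a convergent
  subsequence of the pairs.\<close>

lemma iterates_converge_to_regular:
  assumes biaxial: "\<And>n. unit_biaxial (Ds n) (Es n) (ks n)"
    and step: "\<And>n. Ds (Suc n) = next_D (Ds n) (Es n) (ks n)" "\<And>n. ks (Suc n) = 1 + 2 / ks n"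
  obtains r D E where "strict_mono r" "regular_pair D E"
    "(\<lambda>n. hausdorff_distance (hexagon (Ds (r n)) (Es (r n)) 0 (ks (r n))) (hexagon D E 0 2)) \<longlonglongrightarrow> 0"
proof -
  have k1: "1 \<le> ks n" for n using biaxial[of n] by (simp add: unit_biaxial_def)
  have k: "ks \<longlonglongrightarrow> 2" using k1 step(2) by (rule shape_recurrence_tendsto)
  define L :: real where "L = sqrt (1/12)"
  have L: "L > 0" "L\<^sup>2 = 1/12" by (simp_all add: L_def)
  define u where "u n = Ds n \<bullet> Ds n" for n
  have u_pos: "u n > 0" for n using unit_biaxial_norms(2)[OF biaxial] by (simp add: u_def)
  have u: "u \<longlonglongrightarrow> L"
    using u_pos by (rule size_recurrence_tendsto[OF _ _ L]) (simp add: u_def step(1) next_D_norm[OF biaxial])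
  obtain B where B: "\<And>n. \<bar>u n\<bar> \<le> B"
    using convergent_imp_bounded[OF u] by (auto simp: bounded_iff)
  have E_eq: "Es n \<bullet> Es n = 1 / (4 * (1 + ks n)\<^sup>2 * u n)" for n
  proof -
    have "Es n \<bullet> Es n * (4 * (1 + ks n)\<^sup>2 * u n) = 1"
      using unit_biaxial_norms(1)[OF biaxial[of n]] by (simp only: u_def mult_ac)
    then show ?thesis using u_pos[of n] k1[of n] by (intro eq_divide_imp) auto
  qed
  have E_lim: "(\<lambda>n. Es n \<bullet> Es n) \<longlonglongrightarrow> 1 / (4 * (1 + 2)\<^sup>2 * L)"
    unfolding E_eq by (intro tendsto_intros k u) (use L in auto)
  obtain C where C: "\<And>n. \<bar>Es n \<bullet> Es n\<bar> \<le> C"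
    using convergent_imp_bounded[OF E_lim] by (auto simp: bounded_iff)
  have "Ds n \<bullet> Ds n \<le> B" "Es n \<bullet> Es n \<le> C" for n
    using B[of n] C[of n] by (simp_all add: u_def)
  then obtain r D E where r: "strict_mono r" and D: "(\<lambda>n. Ds (r n)) \<longlonglongrightarrow> D" and E: "(\<lambda>n. Es (r n)) \<longlonglongrightarrow> E"
    by (rule convergent_subsequence_pair)
  have kr: "(\<lambda>n. ks (r n)) \<longlonglongrightarrow> 2" using LIMSEQ_subseq_LIMSEQ[OF k r] by (simp add: comp_def)
  have biaxial': "unit_biaxial D E 2" using D E kr biaxial by (rule unit_biaxial_limit)
  have "(\<lambda>n. u (r n)) \<longlonglongrightarrow> D \<bullet> D" unfolding u_def by (intro tendsto_intros D)
  then have DL: "D \<bullet> D = L"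
    using LIMSEQ_unique LIMSEQ_subseq_LIMSEQ[OF u r] by (fastforce simp: comp_def)
  have "36 * (L * (E \<bullet> E)) = 1" using unit_biaxial_norms(1)[OF biaxial'] DL by simp
  then have "L\<^sup>2 * (36 * (E \<bullet> E)) = L" by (simp add: power2_eq_square algebra_simps)
  then have "L = 3 * (E \<bullet> E)" unfolding L(2) by simp
  then have "regular_pair D E" using biaxial' DL by (simp add: regular_pair_def)
  moreover have "(\<lambda>n. hausdorff_distance (hexagon (Ds (r n)) (Es (r n)) 0 (ks (r n))) (hexagon D E 0 2)) \<longlonglongrightarrow> 0"
    using k1 by (intro hausdorff_distance_hexagon_tendsto D E kr) auto
  ultimately show thesis using that r by blast
qed

fun iterates :: "real^2 \<Rightarrow> real^2 \<Rightarrow> real \<Rightarrow> nat \<Rightarrow> (real^2) \<times> (real^2) \<times> real" where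
  "iterates D E k 0 = (D, E, k)"
| "iterates D E k (Suc n) = (case iterates D E k n of (D', E', k') \<Rightarrow> (next_D D' E' k', next_E D' E' k', 1 + 2 / k'))"

text \<open>What the proofs of existence and of uniqueness have to know about the iteration.\<close>

lemma iterated_symmetrization:
  assumes biaxial: "unit_biaxial D E k"
  shows "\<exists>H r D' E'. H 0 = hexagon D E 0 k
    \<and> (\<forall>n. \<exists>D E k. unit_biaxial D E k \<and> H n = hexagon D E 0 k)
    \<and> (\<forall>n. \<exists>v. norm v = 1 \<and> steiner v (H n) = H (Suc n))
    \<and> regular_pair D' E' \<and> (\<lambda>n::nat. hausdorff_distance (H (r n)) (hexagon D' E' 0 2)) \<longlonglongrightarrow> 0"
proof -
  define Ds where "Ds n = fst (iterates D E k n)" for n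
  define Es where "Es n = fst (snd (iterates D E k n))" for n
  define ks where "ks n = snd (snd (iterates D E k n))" for n
  define H where "H n = hexagon (Ds n) (Es n) 0 (ks n)" for n
  have 0: "Ds 0 = D" "Es 0 = E" "ks 0 = k" by (simp_all add: Ds_def Es_def ks_def)
  have Suc: "Ds (Suc n) = next_D (Ds n) (Es n) (ks n)" "Es (Suc n) = next_E (Ds n) (Es n) (ks n)" "ks (Suc n) = 1 + 2 / ks n" for n
    by (simp_all add: Ds_def Es_def ks_def split: prod.split)
  have biaxials: "unit_biaxial (Ds n) (Es n) (ks n)" for n
    by (induction n) (simp_all add: 0 Suc biaxial unit_biaxial_next)
  have "\<exists>v. norm v = 1 \<and> steiner v (H n) = H (Suc n)" for n
  proof (intro exI conjI)
    let ?D = "next_D (Ds n) (Es n) (ks n)"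
    have "?D \<noteq> 0" using unit_biaxial_norms(2)[OF biaxials[of "Suc n"]] by (auto simp: Suc)
    then show "norm (?D /\<^sub>R norm ?D) = 1" by simp
    show "steiner (?D /\<^sub>R norm ?D) (H n) = H (Suc n)"
      unfolding H_def Suc by (rule steiner_biaxial[OF biaxials])
  qed
  moreover obtain r D' E' where "strict_mono r" "regular_pair D' E'"
    "(\<lambda>n. hausdorff_distance (H (r n)) (hexagon D' E' 0 2)) \<longlonglongrightarrow> 0"
    by (rule iterates_converge_to_regular[of Ds Es ks, OF biaxials Suc(1,3), folded H_def])
  moreover have "H 0 = hexagon D E 0 k" by (simp add: H_def 0)
  moreover have "\<exists>D E k. unit_biaxial D E k \<and> H n = hexagon D E 0 k" for n
    unfolding H_def using biaxials by blast
  ultimately show ?thesis by blast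
qed

section \<open>Regular hexagons\<close>

lemma hexagon_vertices_regular:
  fixes \<rho> \<theta> :: real
  assumes "\<rho> > 0"
  defines "E \<equiv> (\<rho> / 2) *\<^sub>R vector [cos \<theta>, sin \<theta>] :: real^2"
    and "D \<equiv> (\<rho> * sqrt 3 / 2) *\<^sub>R vector [- sin \<theta>, cos \<theta>] :: real^2"
  shows "convex hull {c + \<rho> *\<^sub>R vector [cos (\<theta> + real k * pi / 3), sin (\<theta> + real k * pi / 3)] | k. k < (6::nat)}
    = (+) c ` hexagon D E 0 2"
proof -
  define w :: "nat \<Rightarrow> real^2" where "w k = \<rho> *\<^sub>R vector [cos (\<theta> + real k * pi / 3), sin (\<theta> + real k * pi / 3)]" for k
  have w0: "w 0 = 2 *\<^sub>R E" by (simp add: w_def E_def)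
  have w1: "w 1 = D + E"
    by (simp add: w_def E_def D_def vec_eq_iff forall_2 cos_add sin_add cos_60 sin_60 algebra_simps)
  have w2: "w 2 = D - E"
  proof -
    have "\<theta> + real 2 * pi / 3 = \<theta> + (pi - pi / 3)" by simp
    then have cs: "cos (\<theta> + real 2 * pi / 3) = - cos \<theta> / 2 - sin \<theta> * (sqrt 3 / 2)"
      "sin (\<theta> + real 2 * pi / 3) = - sin \<theta> / 2 + cos \<theta> * (sqrt 3 / 2)"
      by (simp_all only: cos_add sin_add cos_pi_minus sin_pi_minus cos_60 sin_60)
    show ?thesis unfolding w_def cs E_def D_def by (simp add: vec_eq_iff forall_2 algebra_simps)
  qed
  have w_shift: "w (k + 3) = - w k" for k
  proof -
    have eq: "\<theta> + real (k + 3) * pi / 3 = (\<theta> + real k * pi / 3) + pi" by (simp add: field_simps)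
    show ?thesis unfolding w_def eq by (simp add: vec_eq_iff forall_2)
  qed
  have "{k. k < (6::nat)} = {0, 1, 2, 0 + 3, 1 + 3, 2 + 3}" by auto
  then have "{c + w k | k. k < (6::nat)} = (+) c ` w ` {0, 1, 2, 0 + 3, 1 + 3, 2 + 3}" by blast
  also have "w ` {0, 1, 2, 0 + 3, 1 + 3, 2 + 3} = {w 0, w 1, w 2, - w 0, - w 1, - w 2}"
    by (simp only: image_insert image_empty w_shift)
  also have "\<dots> = {D + E, E - D, - D - E, D - E, 2 *\<^sub>R E, - (2 *\<^sub>R E)}"
    unfolding w0 w1 w2 by auto
  finally have V: "{c + w k | k. k < (6::nat)} = (+) c ` {D + E, E - D, - D - E, D - E, 2 *\<^sub>R E, - (2 *\<^sub>R E)}" .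
  have "hexagon D E 0 2 = convex hull {D + E, E - D, - D - E, D - E, 2 *\<^sub>R E, - (2 *\<^sub>R E)}"
    using hexagon_eq_hull[of 2 0 D E] by simp
  then show ?thesis
    unfolding w_def[symmetric] V by (simp only: convex_hull_translation)
qed

lemma regular_hexagon_iff:
  "regular_hexagon H \<longleftrightarrow>
    (\<exists>c D E. E \<noteq> 0 \<and> D \<bullet> E = 0 \<and> D \<bullet> D = 3 * (E \<bullet> E) \<and> H = (+) c ` hexagon D E 0 2)"
proof
  assume "regular_hexagon H"
  then obtain c \<rho> \<theta> where \<rho>: "\<rho> > 0" and H: "H = convex hull {c + \<rho> *\<^sub>R vector [cos (\<theta> + real k * pi / 3), sin (\<theta> + real k * pi / 3)] | k. k < (6::nat)}"
    unfolding regular_hexagon_def by blast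
  define E :: "real^2" where "E = (\<rho> / 2) *\<^sub>R vector [cos \<theta>, sin \<theta>]"
  define D :: "real^2" where "D = (\<rho> * sqrt 3 / 2) *\<^sub>R vector [- sin \<theta>, cos \<theta>]"
  have unit: "cos \<theta> * cos \<theta> + sin \<theta> * sin \<theta> = 1" using sin_cos_squared_add3[of \<theta>] by simp
  have "vector [cos \<theta>, sin \<theta>] \<bullet> (vector [cos \<theta>, sin \<theta>] :: real^2) = 1"
    "vector [- sin \<theta>, cos \<theta>] \<bullet> (vector [- sin \<theta>, cos \<theta>] :: real^2) = 1"
    "vector [- sin \<theta>, cos \<theta>] \<bullet> (vector [cos \<theta>, sin \<theta>] :: real^2) = 0"
    using unit by (simp_all add: inner_real2 add.commute)
  then have "D \<bullet> E = 0" "D \<bullet> D = 3 * (E \<bullet> E)" "E \<bullet> E > 0"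
    using \<rho> by (simp_all add: D_def E_def field_simps)
  moreover have "H = (+) c ` hexagon D E 0 2"
    unfolding H D_def E_def by (rule hexagon_vertices_regular[OF \<rho>])
  ultimately show "\<exists>c D E. E \<noteq> 0 \<and> D \<bullet> E = 0 \<and> D \<bullet> D = 3 * (E \<bullet> E) \<and> H = (+) c ` hexagon D E 0 2"
    by (metis inner_gt_zero_iff)
next
  assume "\<exists>c D E. E \<noteq> 0 \<and> D \<bullet> E = 0 \<and> D \<bullet> D = 3 * (E \<bullet> E) \<and> H = (+) c ` hexagon D E 0 2"
  then obtain c D E where "E \<noteq> 0" and DE: "D \<bullet> E = 0" "D \<bullet> D = 3 * (E \<bullet> E)" and H: "H = (+) c ` hexagon D E 0 2"
    by blast
  define \<rho> where "\<rho> = 2 * norm E"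
  have \<rho>: "\<rho> > 0" using \<open>E \<noteq> 0\<close> by (simp add: \<rho>_def)
  have "(E$1 / norm E)\<^sup>2 + (E$2 / norm E)\<^sup>2 = 1"
  proof -
    have "(E$1 / norm E)\<^sup>2 + (E$2 / norm E)\<^sup>2 = ((E$1)\<^sup>2 + (E$2)\<^sup>2) / (norm E)\<^sup>2"
      by (simp add: power_divide add_divide_distrib)
    also have "(E$1)\<^sup>2 + (E$2)\<^sup>2 = (norm E)\<^sup>2"
      unfolding power2_norm_eq_inner inner_real2 by (simp add: power2_eq_square)
    finally show ?thesis using \<open>E \<noteq> 0\<close> by simp
  qed
  then obtain \<theta> where \<theta>: "E$1 / norm E = cos \<theta>" "E$2 / norm E = sin \<theta>" using sincos_total_2pi by metis
  have E: "E = (\<rho> / 2) *\<^sub>R vector [cos \<theta>, sin \<theta>]"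
    using \<open>E \<noteq> 0\<close> by (simp add: \<rho>_def vec_eq_iff forall_2 flip: \<theta>)
  define D' :: "real^2" where "D' = (\<rho> * sqrt 3 / 2) *\<^sub>R vector [- sin \<theta>, cos \<theta>]"
  have D'_eq: "D' = sqrt 3 *\<^sub>R vector [- E$2, E$1]"
    using \<open>E \<noteq> 0\<close> by (simp add: D'_def \<rho>_def vec_eq_iff forall_2 flip: \<theta>)
  have "D = D' \<or> D = - D'"
  proof -
    have EE: "E \<bullet> E \<noteq> 0" using \<open>E \<noteq> 0\<close> by simp
    have "vector [- E$2, E$1] \<bullet> E = 0" "(vector [- E$2, E$1] :: real^2) \<noteq> 0"
      using \<open>E \<noteq> 0\<close> by (auto simp: inner_real2 vec_eq_iff forall_2)
    then obtain s where Ds: "D = s *\<^sub>R vector [- E$2, E$1]"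
      using parallel_if_orthogonal_to_same[OF DE(1) _ \<open>E \<noteq> 0\<close>] by blast
    have "s\<^sup>2 * (E \<bullet> E) = 3 * (E \<bullet> E)"
      using DE(2) unfolding Ds by (simp add: inner_real2 power2_eq_square algebra_simps)
    then have "s\<^sup>2 = 3" unfolding mult_right_cancel[OF EE] .
    then have "s\<^sup>2 = (sqrt 3)\<^sup>2" by simp
    then have "s = sqrt 3 \<or> s = - sqrt 3" by (simp only: power2_eq_iff)
    then show ?thesis unfolding D'_eq Ds by auto
  qed
  moreover have "hexagon (- D') E 0 2 = hexagon D' E 0 2"
    unfolding hexagon_eq_hull[of 2 0, simplified] by (simp add: insert_commute add.commute)
  ultimately have "H = (+) c ` hexagon D' E 0 2" using H by auto
  then show "regular_hexagon H"
    unfolding regular_hexagon_def using \<rho> hexagon_vertices_regular[OF \<rho>, of c \<theta>, folded D'_def E, symmetric]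
    by blast
qed

lemma regular_pair_imp_regular_hexagon:
  assumes "regular_pair D E" shows "unit_regular_hexagon (hexagon D E 0 2)"
proof -
  have "E \<noteq> 0" "D \<bullet> E = 0"
    using assms unit_biaxial_norms(3)[of D E 2] by (auto simp: regular_pair_def unit_biaxial_def)
  then have "regular_hexagon (hexagon D E 0 2)"
    unfolding regular_hexagon_iff using assms
    by (intro exI[of _ 0] exI[of _ D] exI[of _ E]) (simp add: regular_pair_def)
  then show ?thesis
    using unit_biaxial_area assms by (simp add: unit_regular_hexagon_def regular_pair_def)
qed

lemma unit_regular_hexagon_translation:
  assumes "unit_regular_hexagon K" shows "unit_regular_hexagon ((+) a ` K)"
proof -
  obtain c D E where "E \<noteq> 0" "D \<bullet> E = 0" "D \<bullet> D = 3 * (E \<bullet> E)" "K = (+) c ` hexagon D E 0 2"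
    using assms unfolding unit_regular_hexagon_def regular_hexagon_iff by blast
  moreover from this have "(+) a ` K = (+) (a + c) ` hexagon D E 0 2"
    by (auto simp: image_image add.assoc)
  ultimately have "regular_hexagon ((+) a ` K)" unfolding regular_hexagon_iff by blast
  then show ?thesis using assms by (simp add: unit_regular_hexagon_def measure_translation)
qed

lemma unit_regular_hexagon_in_tiles:
  assumes "unit_regular_hexagon K" shows "K \<in> tiles"
proof -
  obtain c D E where *: "E \<noteq> 0" "D \<bullet> E = 0" "D \<bullet> D = 3 * (E \<bullet> E)" "K = (+) c ` hexagon D E 0 2"
    using assms unfolding unit_regular_hexagon_def regular_hexagon_iff by blast
  have "(cross2 D E)\<^sup>2 = 3 * (E \<bullet> E) * (E \<bullet> E)" using cross2_squared[of D E] * by simp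
  then have "cross2 D E \<noteq> 0" using \<open>E \<noteq> 0\<close> by auto
  then show ?thesis using hexagon_in_tiles tiles_translation *(4) by simp
qed

section \<open>Minimizers\<close>

locale steiner_functional =
  fixes F :: "(real^2) set \<Rightarrow> ereal"
  assumes lower_semicontinuous:
      "\<And>Hs H. (\<And>n. Hs n \<in> tiles) \<Longrightarrow> H \<in> tiles \<Longrightarrow>
         (\<lambda>n. hausdorff_distance (Hs n) H) \<longlonglongrightarrow> 0 \<Longrightarrow>
         liminf (\<lambda>n. F (Hs n)) \<ge> F H"
    and steiner_le: "steiner_decreasing F"
begin

lemma limit_le:
  assumes "\<And>n. Hs n \<in> tiles" "H \<in> tiles" "(\<lambda>n. hausdorff_distance (Hs n) H) \<longlonglongrightarrow> 0" "\<And>n. F (Hs n) \<le> c"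
  shows "F H \<le> c"
proof -
  have "liminf (\<lambda>n. F (Hs n)) \<le> liminf (\<lambda>n. c)"
    using assms(4) by (intro Liminf_mono always_eventually allI)
  also have "\<dots> = c" by (simp add: Liminf_const)
  finally show ?thesis using lower_semicontinuous[OF assms(1-3)] by (rule order_trans[rotated])
qed

lemma steiner_tile_le: "norm v = 1 \<Longrightarrow> H \<in> tiles \<Longrightarrow> steiner v H \<in> tiles \<Longrightarrow> F (steiner v H) \<le> F H"
  using steiner_le unfolding steiner_decreasing_def by blast

lemma regular_below_biaxial:
  assumes biaxial: "unit_biaxial D E k"
  obtains D' E' where "regular_pair D' E'" "F (hexagon D' E' 0 2) \<le> F (hexagon D E 0 k)"
proof -
  obtain H r D' E' where H: "H 0 = hexagon D E 0 k" "\<forall>n. \<exists>D E k. unit_biaxial D E k \<and> H n = hexagon D E 0 k"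
    and st: "\<forall>n. \<exists>v. norm v = 1 \<and> steiner v (H n) = H (Suc n)"
    and r: "regular_pair D' E'" "(\<lambda>n. hausdorff_distance (H (r n)) (hexagon D' E' 0 2)) \<longlonglongrightarrow> 0"
    using iterated_symmetrization[OF biaxial] by blast
  have tiles: "H n \<in> tiles" for n using H(2) unit_biaxial_in_tiles by metis
  have le: "F (H n) \<le> F (hexagon D E 0 k)" for n
  proof (induction n)
    case (Suc n)
    have "F (H (Suc n)) \<le> F (H n)" using st steiner_tile_le tiles by metis
    then show ?case using Suc by (rule order_trans)
  qed (simp add: H(1))
  have "hexagon D' E' 0 2 \<in> tiles" using r(1) by (simp add: regular_pair_def unit_biaxial_in_tiles)
  from limit_le[OF tiles this r(2) le] show thesis using that r(1) by blast
qed

lemma regular_below_tile: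
  assumes "H \<in> tiles" "measure lebesgue H = 1"
  obtains D E where "regular_pair D E" "F (hexagon D E 0 2) \<le> F H"
proof -
  obtain v w a D E k where *: "norm v = 1" "norm w = 1" "unit_biaxial D E k"
    "steiner v H = (+) a ` hexagon D E 0 k" "steiner w (steiner v H) = hexagon D E 0 k"
    by (rule tile_symmetrizes_to_biaxial[OF assms])
  have "steiner v H \<in> tiles" unfolding *(4) by (rule tiles_translation[OF unit_biaxial_in_tiles[OF *(3)]])
  moreover have "hexagon D E 0 k \<in> tiles" by (rule unit_biaxial_in_tiles[OF *(3)])
  ultimately have "F (hexagon D E 0 k) \<le> F H"
    using steiner_tile_le[OF *(1) assms(1)] steiner_tile_le[OF *(2), of "steiner v H", unfolded *(5)] order_trans by blast
  then show thesis using regular_below_biaxial[OF *(3)] that order_trans by metis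
qed

text \<open>The pairs describing centred regular hexagons of unit area form a compact set, and \<open>F\<close> is lower
  semicontinuous on it.\<close>

lemma best_regular_pair:
  obtains D E where "regular_pair D E" "\<And>D' E'. regular_pair D' E' \<Longrightarrow> F (hexagon D E 0 2) \<le> F (hexagon D' E' 0 2)"
proof -
  define A where "A = {F (hexagon D E 0 2) | D E. regular_pair D E}"
  have "A \<noteq> {}"
  proof -
    \<comment> \<open>half of the circumradius of the regular hexagon of unit area\<close>
    define s :: real where "s = sqrt (1 / (6 * sqrt 3))"
    have "s > 0" "sqrt 3 * (s * s) = 1 / 6" by (simp_all add: s_def)
    then have "unit_biaxial (vector [0, sqrt 3 * s]) (vector [s, 0]) 2"
      by (simp add: unit_biaxial_def inner_real2 cross2_def abs_mult mult.assoc)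
    moreover have "sqrt 3 * s * (sqrt 3 * s) = (sqrt 3 * sqrt 3) * (s * s)" by (simp only: mult_ac)
    ultimately have "regular_pair (vector [0, sqrt 3 * s]) (vector [s, 0])"
      by (simp add: regular_pair_def inner_real2)
    then show ?thesis unfolding A_def by blast
  qed
  then obtain f where f: "\<And>n. f n \<in> A" "f \<longlonglongrightarrow> Inf A" using Inf_as_limit[of A] by auto
  then have "\<exists>D E. regular_pair D E \<and> f n = F (hexagon D E 0 2)" for n unfolding A_def by blast
  then obtain Ds Es where DE: "\<And>n. regular_pair (Ds n) (Es n)" "\<And>n. f n = F (hexagon (Ds n) (Es n) 0 2)" by metis
  then have biaxial: "unit_biaxial (Ds n) (Es n) 2" and DD: "Ds n \<bullet> Ds n = 3 * (Es n \<bullet> Es n)" for n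
    by (simp_all add: regular_pair_def)
  have E_le: "Es n \<bullet> Es n \<le> 1" for n
  proof -
    have "108 * (Es n \<bullet> Es n)\<^sup>2 = 1"
      using unit_biaxial_norms(1)[OF biaxial[of n]] DD[of n] by (simp add: power2_eq_square)
    then have "(Es n \<bullet> Es n)\<^sup>2 \<le> 1\<^sup>2" by simp
    then show ?thesis by (rule power2_le_imp_le) simp
  qed
  then have "Ds n \<bullet> Ds n \<le> 3" for n using DD[of n] by simp
  then obtain r D E where r: "strict_mono r" and D: "(\<lambda>n. Ds (r n)) \<longlonglongrightarrow> D" and E: "(\<lambda>n. Es (r n)) \<longlonglongrightarrow> E"
    using E_le by (rule convergent_subsequence_pair)
  have "unit_biaxial D E 2" using D E tendsto_const biaxial by (rule unit_biaxial_limit)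
  moreover have "D \<bullet> D = 3 * (E \<bullet> E)"
  proof (rule LIMSEQ_unique)
    show "(\<lambda>n. Ds (r n) \<bullet> Ds (r n)) \<longlonglongrightarrow> D \<bullet> D" by (intro tendsto_intros D)
    show "(\<lambda>n. Ds (r n) \<bullet> Ds (r n)) \<longlonglongrightarrow> 3 * (E \<bullet> E)" unfolding DD by (intro tendsto_intros E)
  qed
  ultimately have pair: "regular_pair D E" by (simp add: regular_pair_def)
  have "(\<lambda>n. hausdorff_distance (hexagon (Ds (r n)) (Es (r n)) 0 2) (hexagon D E 0 2)) \<longlonglongrightarrow> 0"
    by (intro hausdorff_distance_hexagon_tendsto D E tendsto_const) auto
  then have "F (hexagon D E 0 2) \<le> liminf (\<lambda>n. F (hexagon (Ds (r n)) (Es (r n)) 0 2))"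
    using pair biaxial by (intro lower_semicontinuous unit_biaxial_in_tiles) (simp_all add: regular_pair_def)
  also have "(\<lambda>n. F (hexagon (Ds (r n)) (Es (r n)) 0 2)) \<longlonglongrightarrow> Inf A"
    using LIMSEQ_subseq_LIMSEQ[OF f(2) r] by (simp add: comp_def DE(2))
  then have "liminf (\<lambda>n. F (hexagon (Ds (r n)) (Es (r n)) 0 2)) = Inf A"
    by (intro lim_imp_Liminf) simp_all
  finally have "F (hexagon D E 0 2) \<le> F (hexagon D' E' 0 2)" if "regular_pair D' E'" for D' E'
    using that by (auto simp: A_def intro!: Inf_lower2 intro: order_trans Inf_lower)
  then show thesis using that pair by blast
qed

lemma regular_minimizer:
  obtains D E where "regular_pair D E" "unit_area_minimizer F (hexagon D E 0 2)"
proof -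
  obtain D E where best: "regular_pair D E" "\<And>D' E'. regular_pair D' E' \<Longrightarrow> F (hexagon D E 0 2) \<le> F (hexagon D' E' 0 2)"
    using best_regular_pair by metis
  have "F (hexagon D E 0 2) \<le> F H" if "H \<in> tiles" "measure lebesgue H = 1" for H
    using regular_below_tile[OF that] best(2) order_trans by metis
  then have "unit_area_minimizer F (hexagon D E 0 2)"
    using best(1) unit_biaxial_in_tiles unit_biaxial_area unfolding unit_area_minimizer_def is_arg_min_def regular_pair_def
    by (auto simp: not_less)
  then show thesis using that best(1) by blast
qed

text \<open>A symmetrization that is not a translate would have a smaller value than the minimizer.\<close>

lemma minimizer_symmetrization_translate:
  assumes strict: "strictly_steiner_decreasing F" and H: "unit_area_minimizer F H"
    and v: "norm v = 1" and S: "steiner v H \<in> tiles" "measure lebesgue (steiner v H) = 1"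
  obtains a where "steiner v H = (+) a ` H" "unit_area_minimizer F (steiner v H)"
proof -
  have tile: "H \<in> tiles" "measure lebesgue H = 1" and min: "\<And>K. K \<in> tiles \<Longrightarrow> measure lebesgue K = 1 \<Longrightarrow> \<not> F K < F H"
    using H unfolding unit_area_minimizer_def is_arg_min_def by blast+
  have "\<exists>a. steiner v H = (+) a ` H"
    using strict v tile S min[OF S] unfolding strictly_steiner_decreasing_def by blast
  moreover have "unit_area_minimizer F (steiner v H)"
    using S min steiner_tile_le[OF v tile(1) S(1)] unfolding unit_area_minimizer_def is_arg_min_def
    by (meson order_less_le_trans)
  ultimately show thesis using that by blast
qed

text \<open>All iterates are minimizers, so each is a translate of its predecessor; being centred at the origin
  they are all equal, and a constant sequence is equal to its limit.\<close>

lemma biaxial_minimizer_regular: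
  assumes strict: "strictly_steiner_decreasing F" and biaxial: "unit_biaxial D E k"
    and min: "unit_area_minimizer F (hexagon D E 0 k)"
  shows "unit_regular_hexagon (hexagon D E 0 k)"
proof -
  obtain H r D' E' where H: "H 0 = hexagon D E 0 k" "\<forall>n. \<exists>D E k. unit_biaxial D E k \<and> H n = hexagon D E 0 k"
    and st: "\<forall>n. \<exists>v. norm v = 1 \<and> steiner v (H n) = H (Suc n)"
    and r: "regular_pair D' E'" "(\<lambda>n. hausdorff_distance (H (r n)) (hexagon D' E' 0 2)) \<longlonglongrightarrow> 0"
    using iterated_symmetrization[OF biaxial] by blast
  have same: "H n = hexagon D E 0 k" for n
  proof (induction n)
    case (Suc n)
    obtain v where v: "norm v = 1" "steiner v (H n) = H (Suc n)" using st by blast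
    obtain D1 E1 k1 where H1: "unit_biaxial D1 E1 k1" "H (Suc n) = hexagon D1 E1 0 k1" using H(2) by blast
    have "unit_area_minimizer F (H n)" using min Suc by simp
    then obtain a where "H (Suc n) = (+) a ` H n"
      using minimizer_symmetrization_translate[OF strict _ v(1), of "H n"] v(2)
        unit_biaxial_in_tiles[OF H1(1)] unit_biaxial_area[OF H1(1)] H1(2) by metis
    then show ?case
      using centred_translate_eq[OF compact_biaxial[OF biaxial] biaxial_nonempty[OF biaxial] hexagon_symmetric hexagon_symmetric]
      unfolding Suc H1(2) by blast
  qed (simp add: H(1))
  then have "hausdorff_distance (hexagon D E 0 k) (hexagon D' E' 0 2) = 0"
    using r(2) by (simp add: LIMSEQ_const_iff)
  moreover have "unit_biaxial D' E' 2" using r(1) by (simp add: regular_pair_def)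
  ultimately have "hexagon D E 0 k = hexagon D' E' 0 2"
    using biaxial by (intro hausdorff_distance_0_imp_eq compact_biaxial biaxial_nonempty) auto
  then show ?thesis using regular_pair_imp_regular_hexagon[OF r(1)] by simp
qed

lemma minimizer_regular:
  assumes strict: "strictly_steiner_decreasing F" and H: "unit_area_minimizer F H"
  shows "unit_regular_hexagon H"
proof -
  have tile: "H \<in> tiles" "measure lebesgue H = 1"
    using H unfolding unit_area_minimizer_def is_arg_min_def by blast+
  obtain v w a D E k where *: "norm v = 1" "norm w = 1" "unit_biaxial D E k"
    "steiner v H = (+) a ` hexagon D E 0 k" "steiner w (steiner v H) = hexagon D E 0 k"
    by (rule tile_symmetrizes_to_biaxial[OF tile])
  have S: "steiner v H \<in> tiles" "measure lebesgue (steiner v H) = 1"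
    unfolding *(4) by (simp_all add: tiles_translation unit_biaxial_in_tiles measure_translation unit_biaxial_area *(3))
  obtain d where d: "steiner v H = (+) d ` H" "unit_area_minimizer F (steiner v H)"
    using minimizer_symmetrization_translate[OF strict H *(1) S] by blast
  have "unit_area_minimizer F (hexagon D E 0 k)"
    using minimizer_symmetrization_translate[OF strict d(2) *(2)] *(5)
      unit_biaxial_in_tiles[OF *(3)] unit_biaxial_area[OF *(3)] by metis
  then have reg: "unit_regular_hexagon (hexagon D E 0 k)" by (rule biaxial_minimizer_regular[OF strict *(3)])
  have "H = (+) (- d) ` steiner v H" unfolding d(1) by (simp add: image_image)
  also have "\<dots> = (+) (- d) ` (+) a ` hexagon D E 0 k" unfolding *(4) ..
  finally show ?thesis using reg unit_regular_hexagon_translation by metis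
qed

end

theorem theorem3p1:
  fixes F :: "(real^2) set \<Rightarrow> ereal"
  assumes not_minus_infinity: "\<And>H. H \<in> tiles \<Longrightarrow> F H \<noteq> -\<infinity>"
    and lower_semicontinuous:
      "\<And>Hs H. (\<And>n. Hs n \<in> tiles) \<Longrightarrow> H \<in> tiles \<Longrightarrow>
         (\<lambda>n. hausdorff_distance (Hs n) H) \<longlonglongrightarrow> 0 \<Longrightarrow>
         liminf (\<lambda>n. F (Hs n)) \<ge> F H"
    and steiner: "steiner_decreasing F"
  shows "(\<exists>Hstar. unit_regular_hexagon Hstar \<and> unit_area_minimizer F Hstar)
    \<and> ((\<forall>K K'. unit_regular_hexagon K \<longrightarrow> unit_regular_hexagon K' \<longrightarrow> F K = F K') \<longrightarrow>
         (\<forall>Hstar. unit_regular_hexagon Hstar \<longrightarrow> unit_area_minimizer F Hstar))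
    \<and> (strictly_steiner_decreasing F \<longrightarrow>
         (\<forall>H. unit_area_minimizer F H \<longrightarrow> unit_regular_hexagon H))"
proof -
  interpret steiner_functional F
    by unfold_locales (use lower_semicontinuous steiner in blast)+
  obtain D E where min: "regular_pair D E" "unit_area_minimizer F (hexagon D E 0 2)"
    by (rule regular_minimizer)
  note reg = regular_pair_imp_regular_hexagon[OF min(1)]
  have "unit_area_minimizer F Hstar"
    if eq: "\<forall>K K'. unit_regular_hexagon K \<longrightarrow> unit_regular_hexagon K' \<longrightarrow> F K = F K'" and H: "unit_regular_hexagon Hstar" for Hstar
  proof -
    have "F Hstar = F (hexagon D E 0 2)" using eq H reg by blast
    then show ?thesis
      using min(2) unit_regular_hexagon_in_tiles[OF H] H
      unfolding unit_area_minimizer_def is_arg_min_def unit_regular_hexagon_def by simp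
  qed
  then show ?thesis using min(2) reg minimizer_regular by blast
qed

end
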